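(* Let $\ell\ge 0$ be an integer. Suppose that the initial value $f_0\in\mathcal{C}^{\max\{\ell+1,3\}}$ is non-negative and compactly supported in velocity ($f_0$ being $L$-periodic in $x$), and let $f(t)$, $t\in[0,T]$, be the solution of the Vlasov--Poisson problem $$\partial_t f=-v\,\partial_x f-E(f(t,\cdot,\cdot),x)\,\partial_v f,\qquad \partial_xE(f(t,\cdot,\cdot),x)=\int_{\mathbb{R}}f(t,x,v)\,\mathrm{d}v-1,\qquad f(0,x,v)=f_0(x,v),$$ with $L$-periodic boundary conditions in $x$. Consider the fully discrete Strang splitting / discontinuous Galerkin scheme $$\tilde f_0=Pf_0,\qquad \tilde f_{k+1}=\tilde S_k\tilde f_k,\qquad \tilde S_k=\tilde S^{(A)}\tilde S^{(B)}_k\tilde S^{(A)},$$ $$\tilde S^{(A)}=P\,\mathrm{e}^{\frac{\tau}{2}A},\qquad \tilde S^{(B)}_k=P\,\mathrm{e}^{\tau B(\tilde f_{k+1/2})},\qquad \tilde f_{k+1/2}=\tilde S^{(A)}\tilde f_k,$$ with time step $\tau>0$, cell size $h>0$ and $N\tau=T$, $N\in\mathbb{N}$. Then the global error satisfies the bound $$\sup_{0\le n\le N}\left\Vert\Big(\prod_{k=0}^{n-1}\tilde S_k\Big)\tilde f_0-f(n\tau)\right\Vert_2\le C\left(\tau^2+\frac{h^{\ell+1}}{\tau}+h^{\ell+1}\right),$$ where $C$ depends on $T$ but is independent of $\tau,h,n$ for $0\le n\tau\le N\tau=T$.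
   Context: Fix $L,T>0$. The number $\tau$ is the time step and $h$ the cell size. $\|\cdot\|_2$ is the $L^2$ norm on $[0,L]\times\mathbb{R}$. The product $\big(\prod_{k=0}^{n-1}\tilde S_k\big)\tilde f_0$ denotes $\tilde S_{n-1}\cdots\tilde S_0\tilde f_0=\tilde f_n$. The constant $C$ may depend on the fixed data of the problem ($f_0$, $L$, $T$, $v_{\max}$, $\ell$). Electric field: for $g$ on $[0,L]\times\mathbb{R}$, $$E(g,x)=\int_0^LK(x,y)\Big(\int_{\mathbb{R}}g(y,v)\,\mathrm{d}v-1\Big)\mathrm{d}y,\qquad K(x,y)=\begin{cases}\frac yL,&0<y<x,\\ \frac yL-1,&x<y<L,\end{cases}$$ extended $L$-periodically in $x$; $E$ is the solution of the Poisson equation with zero integral mean over $[0,L]$. The periodic Poisson equation is assumed solvable, i.e. $\int_0^L\int_{\mathbb{R}}f_0\,\mathrm{d}v\,\mathrm{d}x=L$. Operators: $Af=-v\,\partial_xf$ and $B(g)f=-E(g,x)\,\partial_vf$; thus $\mathrm{e}^{sA}f(x,v)=f(x-sv,v)$ and $\mathrm{e}^{sB(g)}f(x,v)=f(x,v-sE(g,x))$. Space discretization: the velocity is cut off to $[-v_{\max},v_{\max}]$, and $[0,L]\times[-v_{\max},v_{\max}]$ is divided into square cells $R_{ij}=[ih,(i+1)h]\times[jh-v_{\max},(j+1)h-v_{\max}]$, $0\le i<N_x$, $0\le j<N_v$, with $N_xh=L$ and $N_vh=2v_{\max}$. $P$ is the operator on $L^2([0,L]\times[-v_{\max},v_{\max}])$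 such that, for each cell, $Pg|_{R_{ij}}$ is the $L^2(R_{ij})$-orthogonal projection of $g|_{R_{ij}}$ onto the $(\ell+1)^2$-dimensional space of polynomials of degree at most $\ell$ in $x$ and at most $\ell$ in $v$. Functions on $[0,L]\times[-v_{\max},v_{\max}]$ are extended $L$-periodically in $x$ and by zero for $|v|>v_{\max}$ before a translation is applied, and restricted to the strip before projecting. The number $v_{\max}$ is fixed (independently of $\tau,h$) and sufficiently large that the cutoff is exact: the supports in $v$ of the exact solution $f(t)$, $t\in[0,T]$, and of the functions arising when one time step of the (exact or projected) splitting is applied to $f(t)$ or $Pf(t)$ lie in $[-v_{\max},v_{\max}]$. *)

theory Defs
  imports "HOL-Analysis.Analysis"
begin

text \<open>
  Functions on phase space are functions of the pair \<open>(x, v)\<close>. Functions on the torus are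
  represented by their \<open>L\<close>-periodic extension to all real \<open>x\<close>.
\<close>

type_synonym phase_fun = "real \<times> real \<Rightarrow> real"

primrec C_k :: "nat \<Rightarrow> ('a::euclidean_space \<Rightarrow> real) \<Rightarrow> bool" where
  "C_k 0 f \<longleftrightarrow> continuous_on UNIV f"
| "C_k (Suc k) f \<longleftrightarrow>
     f differentiable_on UNIV \<and> (\<forall>b\<in>Basis. C_k k (\<lambda>z. frechet_derivative f (at z) b))"

definition x_periodic :: "real \<Rightarrow> phase_fun \<Rightarrow> bool" where
  "x_periodic L g \<longleftrightarrow> (\<forall>x v. g (x + L, v) = g (x, v))"

definition v_supported :: "real \<Rightarrow> phase_fun \<Rightarrow> bool" where
  "v_supported R g \<longleftrightarrow> (\<forall>x v. R < \<bar>v\<bar> \<longrightarrow> g (x, v) = 0)"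

definition l2_norm :: "real \<Rightarrow> phase_fun \<Rightarrow> real" where
  "l2_norm L g = sqrt (LINT z:{0..L} \<times> UNIV|lborel. (g z)\<^sup>2)"

definition wrap :: "real \<Rightarrow> real \<Rightarrow> real" where
  "wrap L x = x - L * of_int \<lfloor>x / L\<rfloor>"


subsection \<open>The electric field and the Vlasov--Poisson problem\<close>

text \<open>The diagonal \<open>y = x\<close>, where the kernel is left undefined, is a null set.\<close>

definition poisson_kernel :: "real \<Rightarrow> real \<Rightarrow> real \<Rightarrow> real" where
  "poisson_kernel L x y = (if y < x then y / L else y / L - 1)"

definition E_field :: "real \<Rightarrow> phase_fun \<Rightarrow> real \<Rightarrow> real" where
  "E_field L g x =
     (LINT y:{0..L}|lborel. poisson_kernel L (wrap L x) y * ((LINT v|lborel. g (y, v)) - 1))"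

text \<open>
  Classical solutions: \<open>f\<close> is continuously differentiable on \<open>[0, T] \<times> \<real>\<^sup>2\<close>, with one-sided time
  derivatives at the end points.
\<close>

definition vlasov_poisson_solution ::
    "real \<Rightarrow> real \<Rightarrow> phase_fun \<Rightarrow> (real \<Rightarrow> phase_fun) \<Rightarrow> bool" where
  "vlasov_poisson_solution L T f0 f \<longleftrightarrow>
     f 0 = f0 \<and>
     (\<forall>t\<in>{0..T}. x_periodic L (f t)) \<and>
     (\<exists>f\<^sub>t f\<^sub>x f\<^sub>v.
        continuous_on ({0..T} \<times> UNIV) (\<lambda>(t, z). f\<^sub>t t z) \<and>
        continuous_on ({0..T} \<times> UNIV) (\<lambda>(t, z). f\<^sub>x t z) \<and>
        continuous_on ({0..T} \<times> UNIV) (\<lambda>(t, z). f\<^sub>v t z) \<and>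
        (\<forall>t\<in>{0..T}. \<forall>x v.
           ((\<lambda>s. f s (x, v)) has_real_derivative f\<^sub>t t (x, v)) (at t within {0..T}) \<and>
           ((\<lambda>y. f t (y, v)) has_real_derivative f\<^sub>x t (x, v)) (at x) \<and>
           ((\<lambda>w. f t (x, w)) has_real_derivative f\<^sub>v t (x, v)) (at v) \<and>
           f\<^sub>t t (x, v) = - v * f\<^sub>x t (x, v) - E_field L (f t) x * f\<^sub>v t (x, v))) \<and>
     (\<forall>t\<in>{0..T}. \<forall>x.
        (E_field L (f t) has_real_derivative (LINT v|lborel. f t (x, v)) - 1) (at x))"


subsection \<open>The discontinuous Galerkin projection\<close>

definition tensor_polys :: "nat \<Rightarrow> phase_fun set" where
  "tensor_polys l = {p. \<exists>c :: nat \<Rightarrow> nat \<Rightarrow> real. p = (\<lambda>(x, v). \<Sum>a\<le>l. \<Sum>b\<le>l. c a b * x ^ a * v ^ b)}"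

definition L2_proj :: "nat \<Rightarrow> (real \<times> real) set \<Rightarrow> phase_fun \<Rightarrow> phase_fun" where
  "L2_proj l R g =
     (THE p. p \<in> tensor_polys l \<and>
             (\<forall>q\<in>tensor_polys l. (LINT z:R|lborel. (g z - p z) * q z) = 0))"

text \<open>
  Half-open cells, so that they are disjoint; they differ from the closed cells by null sets only.
\<close>

definition dg_cell :: "real \<Rightarrow> real \<Rightarrow> nat \<Rightarrow> nat \<Rightarrow> (real \<times> real) set" where
  "dg_cell vmax h i j =
     {real i * h ..< real (i + 1) * h} \<times> {real j * h - vmax ..< real (j + 1) * h - vmax}"

text \<open>
  The projection reads its argument on the strip \<open>[0, L] \<times> [-vmax, vmax]\<close> only, and its result
  is extended from the strip periodically in \<open>x\<close> and by zero in \<open>v\<close>.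
\<close>

definition dg_proj ::
    "real \<Rightarrow> real \<Rightarrow> nat \<Rightarrow> real \<Rightarrow> nat \<Rightarrow> nat \<Rightarrow> phase_fun \<Rightarrow> phase_fun" where
  "dg_proj L vmax l h Nx Nv g = (\<lambda>(x, v).
     \<Sum>i<Nx. \<Sum>j<Nv. indicator (dg_cell vmax h i j) (wrap L x, v) *
                         L2_proj l (dg_cell vmax h i j) g (wrap L x, v))"


subsection \<open>The splitting scheme\<close>

definition exp_A :: "real \<Rightarrow> phase_fun \<Rightarrow> phase_fun" where
  "exp_A s g = (\<lambda>(x, v). g (x - s * v, v))"

definition exp_B :: "real \<Rightarrow> real \<Rightarrow> phase_fun \<Rightarrow> phase_fun \<Rightarrow> phase_fun" where
  "exp_B L s g0 g = (\<lambda>(x, v). g (x, v - s * E_field L g0 x))"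

text \<open>
  In the following the operator \<open>P\<close> is applied after each substep; \<open>P = id\<close> gives the splitting
  without space discretization.
\<close>

definition S_A :: "(phase_fun \<Rightarrow> phase_fun) \<Rightarrow> real \<Rightarrow> phase_fun \<Rightarrow> phase_fun" where
  "S_A P \<tau> g = P (exp_A (\<tau> / 2) g)"

definition S_B ::
    "(phase_fun \<Rightarrow> phase_fun) \<Rightarrow> real \<Rightarrow> real \<Rightarrow> phase_fun \<Rightarrow> phase_fun \<Rightarrow> phase_fun" where
  "S_B P L \<tau> g_half g = P (exp_B L \<tau> g_half g)"

text \<open>
  \<open>S_strang P L \<tau> g\<^sub>k\<close> is the linear operator of the \<open>k\<close>-th step, whose electric field is frozen at
  the half step computed from \<open>g\<^sub>k\<close>.
\<close>

definition S_strang ::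
    "(phase_fun \<Rightarrow> phase_fun) \<Rightarrow> real \<Rightarrow> real \<Rightarrow> phase_fun \<Rightarrow> phase_fun \<Rightarrow> phase_fun" where
  "S_strang P L \<tau> g\<^sub>k g = S_A P \<tau> (S_B P L \<tau> (S_A P \<tau> g\<^sub>k) (S_A P \<tau> g))"

primrec strang_dg ::
    "(phase_fun \<Rightarrow> phase_fun) \<Rightarrow> real \<Rightarrow> real \<Rightarrow> phase_fun \<Rightarrow> nat \<Rightarrow> phase_fun" where
  "strang_dg P L \<tau> f0 0 = P f0"
| "strang_dg P L \<tau> f0 (Suc k) = S_strang P L \<tau> (strang_dg P L \<tau> f0 k) (strang_dg P L \<tau> f0 k)"

text \<open>
  All functions arising in one step of the splitting applied to \<open>g\<close> have velocity support in
  \<open>[-vmax, vmax]\<close>. The translated functions are considered before \<open>P\<close> is applied, since the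
  projection restricts to the strip.
\<close>

definition step_v_supported ::
    "real \<Rightarrow> (phase_fun \<Rightarrow> phase_fun) \<Rightarrow> real \<Rightarrow> real \<Rightarrow> phase_fun \<Rightarrow> bool" where
  "step_v_supported vmax P L \<tau> g \<longleftrightarrow>
     (let g1 = exp_A (\<tau> / 2) g;
          g2 = exp_B L \<tau> (P g1) (P g1);
          g3 = exp_A (\<tau> / 2) (P g2)
      in \<forall>u\<in>{g1, P g1, g2, P g2, g3, P g3}. v_supported vmax u)"

definition cutoff_exact ::
    "real \<Rightarrow> (phase_fun \<Rightarrow> phase_fun) \<Rightarrow> real \<Rightarrow> real \<Rightarrow> real \<Rightarrow> (real \<Rightarrow> phase_fun) \<Rightarrow> bool" where
  "cutoff_exact vmax P L T \<tau> f \<longleftrightarrow>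
     (\<forall>t\<in>{0..T}. \<forall>Q\<in>{id, P}. \<forall>g\<in>{f t, P (f t)}. step_v_supported vmax Q L \<tau> g)"

end

theory Submission
  imports Defs
begin

text \<open>
  The projection is a contraction of \<open>L\<^sup>2\<close>, the translations are isometries, and the field depends on
  the density in a Lipschitz way. Comparing a projected step with the exact splitting applied to
  \<open>f(n\<tau>)\<close> therefore gives \<open>e\<^sub>n\<^sub>+\<^sub>1 \<le> (1 + C\<tau>) (e\<^sub>n + \<epsilon>) + 2\<epsilon> + C\<tau>\<^sup>3\<close>, where \<open>\<epsilon>\<close> bounds the projection error of
  the smooth functions arising in that splitting step. Smoothness of the numerical solution is never
  needed.

  The local error \<open>C\<tau>\<^sup>3\<close> only needs \<open>f\<close> to be continuously differentiable: the field then has Lipschitz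
  first derivatives in time and space, because \<open>\<partial>\<^sub>xE = \<rho> - 1\<close> and \<open>\<partial>\<^sub>tE = - J + mean J\<close> with the current
  \<open>J = \<integral> v f dv\<close>, and the foot of a characteristic is determined up to \<open>O(\<tau>\<^sup>3)\<close>.

  For \<open>\<epsilon> = O(h\<^sup>l\<^sup>+\<^sup>1)\<close> one has to know that the exact solution inherits the smoothness of \<open>f\<^sub>0\<close>. It is the
  \<open>L\<^sup>2\<close> limit of the splitting without projection and with finer and finer time steps, and these
  approximations have uniformly bounded derivatives along smooth curves: bounds of order \<open>k\<close> on the
  densities give bounds of order \<open>k + 1\<close> on the fields, hence on the orbits of the splitting by a
  discrete Gronwall argument, hence on the densities. The projection estimate passes to the limit,
  so that no differentiability of characteristic flows is required.
\<close>

section \<open>The \<open>L\<^sup>2\<close> norm on the torus\<close>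

text \<open>The nonlinear substep is handled asymmetrically: in
  \<open>exp_B L \<tau> a a - exp_B L \<tau> b b\<close> the difference \<open>a - b\<close> is
  carried along by the field of \<open>a\<close>, and only the remaining change of field is paid for
  with the Lipschitz constant in v of \<open>b\<close>. With \<open>b\<close> taken from the exact
  solution, all smoothness sits on that side. Field differences are measured in L1 and then, by
  Cauchy-Schwarz on a strip of bounded velocity, in L2; hence the care for supports. The regularity
  argument meets a circle: supports of the approximations grow with the field, and the field depends
  on the density. Positivity and conservation of mass break it, since a density of mass L has a
  field of size at most 2L whatever its support. The other obstacle is uniformity in the number of
  steps: the top derivative is tracked separately and changes in each step only by a factor 1 +
  O(\<delta>) and an increment O(\<delta>). In the final bound, \<tau>^2 and h^(l+1)/\<tau> are
  local and projection errors summed over at most T/\<tau> steps; h^(l+1) is the projection error of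
  the initial value.\<close>

lemma borel_measurable_fst_snd [measurable]:
  "(fst :: real \<times> real \<Rightarrow> real) \<in> borel_measurable borel"
  "(snd :: real \<times> real \<Rightarrow> real) \<in> borel_measurable borel"
  by (auto intro!: borel_measurable_continuous_onI continuous_intros)

text \<open>Pointwise functions instead of L2 classes, because they are evaluated along
  characteristics. Boundedness and bounded velocity support make every norm, density and field
  integral converge, and the class is closed under differences, both translations and the
  projection.\<close>

definition admissible :: "real \<Rightarrow> phase_fun \<Rightarrow> bool" where
  "admissible L g \<longleftrightarrow> g \<in> borel_measurable borel \<and> x_periodic L g \<and>
     (\<exists>B. \<forall>z. \<bar>g z\<bar> \<le> B) \<and> (\<exists>R. v_supported R g)"

lemma admissible_measurable [measurable_dest]: "admissible L g \<Longrightarrow> g \<in> borel_measurable borel"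
  by (simp add: admissible_def)

lemma v_supported_mono: "v_supported R g \<Longrightarrow> R \<le> R' \<Longrightarrow> v_supported R' g"
  unfolding v_supported_def by force

lemma admissible_diff:
  assumes "admissible L f" "admissible L g"
  shows "admissible L (\<lambda>z. f z - g z)"
proof -
  obtain B B' R R' where B: "\<forall>z. \<bar>f z\<bar> \<le> B" "\<forall>z. \<bar>g z\<bar> \<le> B'"
    and R: "v_supported R f" "v_supported R' g"
    using assms unfolding admissible_def by blast
  have "\<bar>f z - g z\<bar> \<le> B + B'" for z
    using B[THEN spec, of z] by linarith
  moreover have "v_supported (max R R') (\<lambda>z. f z - g z)"
    using R unfolding v_supported_def by auto
  moreover have "(\<lambda>z. f z - g z) \<in> borel_measurable borel" "x_periodic L (\<lambda>z. f z - g z)"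
    using assms unfolding admissible_def x_periodic_def by auto
  ultimately show ?thesis
    unfolding admissible_def by blast
qed

section \<open>Periodic functions and invariance of integrals under the translations\<close>

lemma periodic_add_int:
  fixes \<phi> :: "real \<Rightarrow> 'a"
  assumes "\<And>x. \<phi> (x + L) = \<phi> x"
  shows "\<phi> (x + L * of_int k) = \<phi> x"
proof -
  have nat: "\<phi> (x + L * real n) = \<phi> x" for n x
  proof (induction n)
    case (Suc n)
    have "\<phi> (x + L * real (Suc n)) = \<phi> ((x + L * real n) + L)"
      by (simp add: algebra_simps)
    then show ?case using assms Suc by simp
  qed simp
  show ?thesis
  proof (cases "k \<ge> 0")
    case True
    then show ?thesis using nat[of x "nat k"] by simp
  next
    case False
    then show ?thesis using nat[of "x + L * of_int k" "nat (- k)"] by (simp add: algebra_simps)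
  qed
qed

lemma wrap_bounds: "0 < L \<Longrightarrow> 0 \<le> wrap L x \<and> wrap L x < L"
  unfolding wrap_def
  using floor_divide_lower[of L x] floor_divide_upper[of L x] by (simp add: algebra_simps)

lemma wrap_id: "0 \<le> x \<Longrightarrow> x < L \<Longrightarrow> wrap L x = x"
  unfolding wrap_def by (simp add: floor_eq_iff)

lemma wrap_eq: "wrap L x = x + L * of_int (- \<lfloor>x / L\<rfloor>)"
  unfolding wrap_def by simp

lemma wrap_periodic: "0 < L \<Longrightarrow> wrap L (x + L) = wrap L x"
  unfolding wrap_def by (simp add: add_divide_distrib algebra_simps)

lemma wrap_measurable [measurable]: "wrap L \<in> borel_measurable borel"
  unfolding wrap_def by measurable

lemma periodic_wrap:
  assumes "\<And>x. \<phi> (x + L) = \<phi> x"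
  shows "\<phi> (wrap L x) = \<phi> x"
  unfolding wrap_eq by (rule periodic_add_int[of \<phi>, OF assms])

lemma x_periodic_wrap: "x_periodic L g \<Longrightarrow> g (wrap L x, v) = g (x, v)"
  unfolding x_periodic_def using periodic_wrap[of "\<lambda>x. g (x, v)"] by blast

lemma nn_integral_shift:
  fixes \<phi> :: "real \<Rightarrow> ennreal"
  assumes [measurable]: "\<phi> \<in> borel_measurable borel"
  shows "(\<integral>\<^sup>+x. \<phi> (x + c) \<partial>lborel) = (\<integral>\<^sup>+x. \<phi> x \<partial>lborel)"
  using nn_integral_real_affine[of \<phi> 1 c] by (simp add: add.commute)

text \<open>The window [c, c + L] contains a multiple of L. Cutting there and moving the left piece
  by one period joins the two pieces to a full period starting at that multiple, which is then moved
  back to 0.\<close>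

lemma nn_integral_periodic_shift:
  fixes \<phi> :: "real \<Rightarrow> ennreal"
  assumes [measurable]: "\<phi> \<in> borel_measurable borel"
    and L: "0 < L" and per: "\<And>x. \<phi> (x + L) = \<phi> x"
  shows "(\<integral>\<^sup>+x. \<phi> (x + c) * indicator {0..L} x \<partial>lborel) = (\<integral>\<^sup>+x. \<phi> x * indicator {0..L} x \<partial>lborel)"
proof -
  \<comment> \<open>Half-open windows fit together exactly; the end point lost is a null
    set.\<close>
  have half_open: "(\<integral>\<^sup>+x. \<psi> x * indicator {0..L} x \<partial>lborel) = (\<integral>\<^sup>+x. \<psi> x * indicator {0..<L} x \<partial>lborel)"
    if [measurable]: "\<psi> \<in> borel_measurable borel" for \<psi> :: "real \<Rightarrow> ennreal"
    by (rule nn_integral_cong_AE) (use AE_lborel_singleton[of L] in \<open>auto split: split_indicator\<close>)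
  have shift: "(\<integral>\<^sup>+x. \<phi> x * indicator {a..<b} x \<partial>lborel)
      = (\<integral>\<^sup>+x. \<phi> x * indicator {a + L * of_int k..<b + L * of_int k} x \<partial>lborel)" for a b k
  proof -
    have "(\<integral>\<^sup>+x. \<phi> x * indicator {a + L * of_int k..<b + L * of_int k} x \<partial>lborel)
        = (\<integral>\<^sup>+x. \<phi> (x + L * of_int k) * indicator {a + L * of_int k..<b + L * of_int k} (x + L * of_int k) \<partial>lborel)"
      by (rule nn_integral_shift[symmetric]) simp
    also have "\<dots> = (\<integral>\<^sup>+x. \<phi> x * indicator {a..<b} x \<partial>lborel)"
      by (simp add: periodic_add_int[of \<phi>, OF per] indicator_def)
    finally show ?thesis by simp
  qed
  have split: "(\<integral>\<^sup>+x. \<phi> x * indicator {a..<c} x \<partial>lborel) =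
      (\<integral>\<^sup>+x. \<phi> x * indicator {a..<b} x \<partial>lborel) + (\<integral>\<^sup>+x. \<phi> x * indicator {b..<c} x \<partial>lborel)"
    if "a \<le> b" "b \<le> c" for a b c
    by (subst nn_integral_add[symmetric])
       (use that in \<open>auto intro!: nn_integral_cong split: split_indicator\<close>)
  define k where "k = \<lceil>c / L\<rceil>"
  have k: "c \<le> L * of_int k" "L * of_int k \<le> c + L"
    unfolding k_def
    using L ceiling_divide_lower[of L c] ceiling_divide_upper[of L c] by (auto simp: algebra_simps)
  have "(\<integral>\<^sup>+x. \<phi> (x + c) * indicator {0..L} x \<partial>lborel) = (\<integral>\<^sup>+x. \<phi> (x + c) * indicator {0..<L} x \<partial>lborel)"
    by (rule half_open) simp
  also have "\<dots> = (\<integral>\<^sup>+x. \<phi> (x + c) * indicator {c..<c + L} (x + c) \<partial>lborel)"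
    by (rule nn_integral_cong) (auto split: split_indicator)
  also have "\<dots> = (\<integral>\<^sup>+x. \<phi> x * indicator {c..<c + L} x \<partial>lborel)"
    by (rule nn_integral_shift[of "\<lambda>x. \<phi> x * indicator {c..<c + L} x"]) simp
  also have "\<dots> = (\<integral>\<^sup>+x. \<phi> x * indicator {c..<L * of_int k} x \<partial>lborel)
       + (\<integral>\<^sup>+x. \<phi> x * indicator {L * of_int k..<c + L} x \<partial>lborel)"
    using k by (rule split)
  also have "(\<integral>\<^sup>+x. \<phi> x * indicator {c..<L * of_int k} x \<partial>lborel) =
       (\<integral>\<^sup>+x. \<phi> x * indicator {c + L..<L * of_int k + L} x \<partial>lborel)"
    using shift[of c _ 1] by simp
  also have "\<dots> + (\<integral>\<^sup>+x. \<phi> x * indicator {L * of_int k..<c + L} x \<partial>lborel)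
     = (\<integral>\<^sup>+x. \<phi> x * indicator {L * of_int k..<L * of_int k + L} x \<partial>lborel)"
    using k split[of "L * of_int k" "c + L" "L * of_int k + L"] by (simp add: add.commute)
  also have "\<dots> = (\<integral>\<^sup>+x. \<phi> x * indicator {0..<L} x \<partial>lborel)"
    using shift[of 0 L k] by (simp add: add.commute)
  finally show ?thesis
    using half_open[of \<phi>] by simp
qed

definition torus :: "real \<Rightarrow> (real \<times> real) set" where
  "torus L = {0..L} \<times> UNIV"

lemma torus_sets [measurable]: "torus L \<in> sets borel"
  unfolding torus_def by (intro borel_closed closed_Times) auto

lemma nn_integral_lborel_fst:
  fixes u :: "real \<times> real \<Rightarrow> ennreal"
  assumes [measurable]: "u \<in> borel_measurable borel"
  shows "(\<integral>\<^sup>+z. u z \<partial>lborel) = (\<integral>\<^sup>+x. (\<integral>\<^sup>+v. u (x, v) \<partial>lborel) \<partial>lborel)"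
  unfolding lborel_prod[symmetric]
  by (rule lborel.nn_integral_fst[symmetric]) (simp add: lborel_prod)

lemma nn_integral_lborel_snd:
  fixes u :: "real \<times> real \<Rightarrow> ennreal"
  assumes [measurable]: "u \<in> borel_measurable borel"
  shows "(\<integral>\<^sup>+z. u z \<partial>lborel) = (\<integral>\<^sup>+v. (\<integral>\<^sup>+x. u (x, v) \<partial>lborel) \<partial>lborel)"
  unfolding lborel_prod[symmetric]
  by (rule lborel_pair.nn_integral_snd[symmetric]) (simp add: lborel_prod)

text \<open>Fubini with x innermost: for fixed v the map is a shift of x by s * v, harmless by
  periodicity.\<close>

lemma nn_integral_exp_A:
  fixes u :: "real \<times> real \<Rightarrow> ennreal"
  assumes [measurable]: "u \<in> borel_measurable borel"
    and L: "0 < L" and per: "\<And>x v. u (x + L, v) = u (x, v)"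
  shows "(\<integral>\<^sup>+z. u (fst z - s * snd z, snd z) * indicator (torus L) z \<partial>lborel)
       = (\<integral>\<^sup>+z. u z * indicator (torus L) z \<partial>lborel)"
proof -
  have "(\<integral>\<^sup>+z. u (fst z - s * snd z, snd z) * indicator (torus L) z \<partial>lborel)
    = (\<integral>\<^sup>+v. (\<integral>\<^sup>+x. u (x + (- s * v), v) * indicator {0..L} x \<partial>lborel) \<partial>lborel)"
    by (subst nn_integral_lborel_snd) (auto simp: torus_def indicator_times)
  also have "\<dots> = (\<integral>\<^sup>+v. (\<integral>\<^sup>+x. u (x, v) * indicator {0..L} x \<partial>lborel) \<partial>lborel)"
    by (subst nn_integral_periodic_shift) (use L per in auto)
  also have "\<dots> = (\<integral>\<^sup>+z. u z * indicator (torus L) z \<partial>lborel)"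
    by (subst nn_integral_lborel_snd) (auto simp: torus_def indicator_times)
  finally show ?thesis .
qed

text \<open>Here v is innermost: for fixed x the map is a shift of the whole line.\<close>

lemma nn_integral_exp_B:
  fixes u :: "real \<times> real \<Rightarrow> ennreal"
  assumes [measurable]: "u \<in> borel_measurable borel" "e \<in> borel_measurable borel"
  shows "(\<integral>\<^sup>+z. u (fst z, snd z - e (fst z)) * indicator (torus L) z \<partial>lborel)
       = (\<integral>\<^sup>+z. u z * indicator (torus L) z \<partial>lborel)"
proof -
  have "(\<integral>\<^sup>+z. u (fst z, snd z - e (fst z)) * indicator (torus L) z \<partial>lborel)
    = (\<integral>\<^sup>+x. (\<integral>\<^sup>+v. u (x, v + (- e x)) * indicator {0..L} x \<partial>lborel) \<partial>lborel)"
    by (subst nn_integral_lborel_fst) (auto simp: torus_def indicator_times)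
  also have "\<dots> = (\<integral>\<^sup>+x. (\<integral>\<^sup>+v. u (x, v) * indicator {0..L} x \<partial>lborel) \<partial>lborel)"
    by (intro nn_integral_cong nn_integral_shift[of "\<lambda>v. u (x, v) * indicator {0..L} x" for x]) simp
  also have "\<dots> = (\<integral>\<^sup>+z. u z * indicator (torus L) z \<partial>lborel)"
    by (subst nn_integral_lborel_fst) (auto simp: torus_def indicator_times)
  finally show ?thesis .
qed

text \<open>If the square is not integrable, both sides are 0, by the conventions of the Bochner
  integral and of \<open>enn2real\<close>. Norms can therefore be handled in the extended
  non-negative reals, with measurability as the only side condition.\<close>

lemma l2_norm_eq_nn_integral:
  assumes [measurable]: "g \<in> borel_measurable borel"
  shows "l2_norm L g = sqrt (enn2real (\<integral>\<^sup>+z. ennreal ((g z)\<^sup>2) * indicator (torus L) z \<partial>lborel))"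
  unfolding l2_norm_def set_lebesgue_integral_def torus_def[symmetric]
  by (subst integral_eq_nn_integral)
     (auto intro!: nn_integral_cong arg_cong[where f=enn2real] split: split_indicator)

lemma E_field_measurable [measurable]:
  assumes [measurable]: "g \<in> borel_measurable borel"
  shows "E_field L g \<in> borel_measurable borel"
proof -
  have [measurable]: "g \<in> borel_measurable (lborel \<Otimes>\<^sub>M lborel)" by (simp add: lborel_prod)
  show ?thesis
    unfolding E_field_def set_lebesgue_integral_def poisson_kernel_def by measurable
qed

lemma E_field_periodic: "0 < L \<Longrightarrow> E_field L g (x + L) = E_field L g x"
  unfolding E_field_def by (simp add: wrap_periodic)

lemma exp_A_measurable [measurable]:
  assumes [measurable]: "g \<in> borel_measurable borel"
  shows "exp_A s g \<in> borel_measurable borel"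
  unfolding exp_A_def split_beta by measurable

lemma exp_B_measurable [measurable]:
  assumes [measurable]: "g0 \<in> borel_measurable borel" "g \<in> borel_measurable borel"
  shows "exp_B L s g0 g \<in> borel_measurable borel"
  unfolding exp_B_def split_beta by measurable

lemma x_periodic_exp_A: "x_periodic L g \<Longrightarrow> x_periodic L (exp_A s g)"
  unfolding x_periodic_def exp_A_def by (metis add_diff_eq diff_add_eq case_prod_conv)

lemma x_periodic_exp_B: "0 < L \<Longrightarrow> x_periodic L g \<Longrightarrow> x_periodic L (exp_B L s g0 g)"
  unfolding x_periodic_def exp_B_def by (simp add: E_field_periodic)

lemma v_supported_exp_A: "v_supported R g \<Longrightarrow> v_supported R (exp_A s g)"
  unfolding v_supported_def exp_A_def by simp

lemma abs_exp_A_le: "\<forall>z. \<bar>g z\<bar> \<le> B \<Longrightarrow> \<forall>z. \<bar>exp_A s g z\<bar> \<le> B"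
  unfolding exp_A_def by simp

lemma admissible_exp_A: "admissible L g \<Longrightarrow> admissible L (exp_A s g)"
  unfolding admissible_def
  using exp_A_measurable[of g] x_periodic_exp_A[of L g] v_supported_exp_A[of _ g] abs_exp_A_le[of g] by blast

lemma l2_norm_exp_A:
  assumes "0 < L" "g \<in> borel_measurable borel" "x_periodic L g"
  shows "l2_norm L (exp_A s g) = l2_norm L g"
proof -
  note [measurable] = assms(2)
  have "(\<integral>\<^sup>+z. ennreal ((exp_A s g z)\<^sup>2) * indicator (torus L) z \<partial>lborel)
      = (\<integral>\<^sup>+z. ennreal ((g z)\<^sup>2) * indicator (torus L) z \<partial>lborel)"
    using nn_integral_exp_A[of "\<lambda>z. ennreal ((g z)\<^sup>2)" L s] assms
    by (simp add: exp_A_def split_beta x_periodic_def)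
  then show ?thesis
    by (simp only: l2_norm_eq_nn_integral[OF assms(2)] l2_norm_eq_nn_integral[OF exp_A_measurable[OF assms(2)]])
qed

lemma l2_norm_exp_B:
  assumes [measurable]: "g0 \<in> borel_measurable borel" "g \<in> borel_measurable borel"
  shows "l2_norm L (exp_B L s g0 g) = l2_norm L g"
proof -
  have "(\<integral>\<^sup>+z. ennreal ((exp_B L s g0 g z)\<^sup>2) * indicator (torus L) z \<partial>lborel)
      = (\<integral>\<^sup>+z. ennreal ((g z)\<^sup>2) * indicator (torus L) z \<partial>lborel)"
    using nn_integral_exp_B[of "\<lambda>z. ennreal ((g z)\<^sup>2)" "\<lambda>x. s * E_field L g0 x" L]
    by (simp add: exp_B_def split_beta)
  then show ?thesis
    by (simp only: l2_norm_eq_nn_integral[OF assms(2)] l2_norm_eq_nn_integral[OF exp_B_measurable[OF assms]])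
qed

text \<open>This area is the source of the constants \<open>sqrt (2 * R * L)\<close> in all later
  estimates.\<close>

lemma nn_integral_strip:
  fixes L R :: real
  assumes "0 \<le> L" "0 \<le> R"
  shows "(\<integral>\<^sup>+z. indicator {z. \<bar>snd z\<bar> \<le> R} z * indicator (torus L) z \<partial>lborel) = ennreal (2 * R * L)"
proof -
  have m [measurable]: "{z::real\<times>real. \<bar>snd z\<bar> \<le> R} \<in> sets borel" by measurable
  have [measurable]: "({0..L} \<times> UNIV :: (real \<times> real) set) \<in> sets borel"
    using torus_sets[of L] by (simp add: torus_def)
  have "(\<integral>\<^sup>+z. indicator {z. \<bar>snd z\<bar> \<le> R} z * indicator (torus L) z \<partial>lborel)
     = (\<integral>\<^sup>+x. (\<integral>\<^sup>+v. indicator {-R..R} v * indicator {0..L} x \<partial>lborel) \<partial>(lborel :: real measure))"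
    by (subst nn_integral_lborel_fst)
       (auto intro!: nn_integral_cong simp: torus_def split: split_indicator)
  also have "\<dots> = (\<integral>\<^sup>+x. ennreal (2 * R) * indicator {0..L} x \<partial>(lborel :: real measure))"
    using assms by (simp add: nn_integral_multc)
  also have "\<dots> = ennreal (2 * R * L)"
    using assms by (simp add: nn_integral_cmult ennreal_mult[symmetric])
  finally show ?thesis .
qed

lemma admissible_square_finite:
  assumes "admissible L g" "0 < L"
  shows "(\<integral>\<^sup>+z. ennreal ((g z)\<^sup>2) * indicator (torus L) z \<partial>lborel) < \<infinity>"
proof -
  obtain B R where B: "\<And>z. \<bar>g z\<bar> \<le> B" and R: "v_supported R g"
    using assms unfolding admissible_def by blast
  have [measurable]: "{z::real\<times>real. \<bar>snd z\<bar> \<le> \<bar>R\<bar>} \<in> sets borel" by measurable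
  have "ennreal ((g z)\<^sup>2) * indicator (torus L) z
      \<le> ennreal (B\<^sup>2) * (indicator {z. \<bar>snd z\<bar> \<le> \<bar>R\<bar>} z * indicator (torus L) z)" for z
  proof -
    have "(g z)\<^sup>2 \<le> B\<^sup>2" using B[of z] by (rule abs_le_square_iff[THEN iffD1, OF order_trans]) simp
    moreover have "\<bar>snd z\<bar> > \<bar>R\<bar> \<Longrightarrow> g z = 0"
      using R unfolding v_supported_def by (cases z) auto
    ultimately show ?thesis by (auto split: split_indicator)
  qed
  then have "(\<integral>\<^sup>+z. ennreal ((g z)\<^sup>2) * indicator (torus L) z \<partial>lborel) \<le>
     (\<integral>\<^sup>+z. ennreal (B\<^sup>2) * (indicator {z. \<bar>snd z\<bar> \<le> \<bar>R\<bar>} z * indicator (torus L) z) \<partial>lborel)"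
    by (intro nn_integral_mono)
  also have "\<dots> = ennreal (B\<^sup>2) * ennreal (2 * \<bar>R\<bar> * L)"
    using assms nn_integral_strip[of L "\<bar>R\<bar>"] by (subst nn_integral_cmult) simp_all
  also have "\<dots> < \<infinity>"
    by (simp add: ennreal_mult_less_top)
  finally show ?thesis .
qed

lemma l2_norm_nonneg: "0 \<le> l2_norm L g"
  unfolding l2_norm_def set_lebesgue_integral_def by (intro real_sqrt_ge_zero Bochner_Integration.integral_nonneg) simp

lemma ennreal_l2_norm_sq:
  assumes "admissible L g" "0 < L"
  shows "ennreal ((l2_norm L g)\<^sup>2) = (\<integral>\<^sup>+z. ennreal ((g z)\<^sup>2) * indicator (torus L) z \<partial>lborel)"
  using admissible_square_finite[OF assms] assms
  by (simp add: l2_norm_eq_nn_integral admissible_measurable)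

lemma l2_norm_le_nn_integral:
  assumes "g \<in> borel_measurable borel" "0 \<le> K"
    and "(\<integral>\<^sup>+z. ennreal ((g z)\<^sup>2) * indicator (torus L) z \<partial>lborel) \<le> ennreal (K\<^sup>2)"
  shows "l2_norm L g \<le> K"
proof -
  have "enn2real (\<integral>\<^sup>+z. ennreal ((g z)\<^sup>2) * indicator (torus L) z \<partial>lborel) \<le> K\<^sup>2"
    using assms(3) by (simp add: enn2real_leI)
  then show ?thesis
    using assms by (simp add: l2_norm_eq_nn_integral real_le_lsqrt)
qed

lemma l2_norm_le_sup:
  assumes [measurable]: "g \<in> borel_measurable borel"
    and "0 \<le> K" "0 \<le> L" "0 \<le> R" "v_supported R g" "\<And>z. \<bar>g z\<bar> \<le> K"
  shows "l2_norm L g \<le> K * sqrt (2 * R * L)"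
proof (rule l2_norm_le_nn_integral)
  have [measurable]: "{z::real\<times>real. \<bar>snd z\<bar> \<le> R} \<in> sets borel" by measurable
  have "ennreal ((g z)\<^sup>2) * indicator (torus L) z
      \<le> ennreal (K\<^sup>2) * (indicator {z. \<bar>snd z\<bar> \<le> R} z * indicator (torus L) z)" for z
  proof -
    have "(g z)\<^sup>2 \<le> K\<^sup>2" using assms(6)[of z] by (rule abs_le_square_iff[THEN iffD1, OF order_trans]) simp
    moreover have "\<bar>snd z\<bar> > R \<Longrightarrow> g z = 0"
      using assms(5) unfolding v_supported_def by (cases z) auto
    ultimately show ?thesis by (auto split: split_indicator)
  qed
  then have "(\<integral>\<^sup>+z. ennreal ((g z)\<^sup>2) * indicator (torus L) z \<partial>lborel) \<le>
     (\<integral>\<^sup>+z. ennreal (K\<^sup>2) * (indicator {z. \<bar>snd z\<bar> \<le> R} z * indicator (torus L) z) \<partial>lborel)"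
    by (intro nn_integral_mono)
  also have "\<dots> = ennreal (K\<^sup>2) * ennreal (2 * R * L)"
    using assms nn_integral_strip[of L R] by (subst nn_integral_cmult) simp_all
  also have "\<dots> = ennreal ((K * sqrt (2 * R * L))\<^sup>2)"
    using assms by (simp add: ennreal_mult[symmetric] power_mult_distrib)
  finally show "(\<integral>\<^sup>+z. ennreal ((g z)\<^sup>2) * indicator (torus L) z \<partial>lborel) \<le> ennreal ((K * sqrt (2 * R * L))\<^sup>2)" .
qed (use assms in auto)

text \<open>Expansion of the square, with Cauchy-Schwarz for the mixed term. Only pointwise
  domination is asked of \<open>h\<close>, which covers sums and differences at once.\<close>

lemma l2_norm_triangle:
  assumes f: "admissible L f" and g: "admissible L g" and L: "0 < L"
    and h: "\<And>z. \<bar>h z\<bar> \<le> \<bar>f z\<bar> + \<bar>g z\<bar>" "h \<in> borel_measurable borel"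
  shows "l2_norm L h \<le> l2_norm L f + l2_norm L g"
proof (rule l2_norm_le_nn_integral)
  note [measurable] = admissible_measurable[OF f] admissible_measurable[OF g] h(2)
  let ?I = "\<lambda>u. \<integral>\<^sup>+z. u z * indicator (torus L) z \<partial>lborel"
  have fg: "?I (\<lambda>z. ennreal (\<bar>f z\<bar> * \<bar>g z\<bar>)) \<le> ennreal (l2_norm L f * l2_norm L g)"
  proof -
    have "(?I (\<lambda>z. ennreal (\<bar>f z\<bar> * \<bar>g z\<bar>)))\<^sup>2 =
       (\<integral>\<^sup>+z. (ennreal \<bar>f z\<bar> * indicator (torus L) z) * (ennreal \<bar>g z\<bar> * indicator (torus L) z) \<partial>lborel)\<^sup>2"
      by (intro arg_cong[where f="\<lambda>x. x\<^sup>2"] nn_integral_cong)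
         (auto simp: ennreal_mult split: split_indicator)
    also have "\<dots> \<le> (\<integral>\<^sup>+z. (ennreal \<bar>f z\<bar> * indicator (torus L) z)\<^sup>2 \<partial>lborel) * (\<integral>\<^sup>+z. (ennreal \<bar>g z\<bar> * indicator (torus L) z)\<^sup>2 \<partial>lborel)"
      by (rule Cauchy_Schwarz_nn_integral) auto
    also have "\<dots> = ?I (\<lambda>z. ennreal ((f z)\<^sup>2)) * ?I (\<lambda>z. ennreal ((g z)\<^sup>2))"
      by (intro arg_cong2[where f="(*)"] nn_integral_cong)
         (auto simp: ennreal_power split: split_indicator)
    also have "\<dots> = (ennreal (l2_norm L f * l2_norm L g))\<^sup>2"
      using L by (simp add: ennreal_l2_norm_sq[symmetric] f g ennreal_mult[symmetric] ennreal_power power_mult_distrib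
         l2_norm_nonneg)
    finally have sq: "(?I (\<lambda>z. ennreal (\<bar>f z\<bar> * \<bar>g z\<bar>)))\<^sup>2 \<le> (ennreal (l2_norm L f * l2_norm L g))\<^sup>2" .
    show ?thesis
    proof (cases "?I (\<lambda>z. ennreal (\<bar>f z\<bar> * \<bar>g z\<bar>))")
      case (real r)
      then have "r\<^sup>2 \<le> (l2_norm L f * l2_norm L g)\<^sup>2"
        using sq by (simp add: ennreal_power l2_norm_nonneg)
      then have "r \<le> l2_norm L f * l2_norm L g"
        by (rule power2_le_imp_le) (simp add: l2_norm_nonneg)
      then show ?thesis using real by (simp add: ennreal_leI)
    next
      case top
      then show ?thesis using sq by (simp add: ennreal_power l2_norm_nonneg top_unique)
    qed
  qed
  have "?I (\<lambda>z. ennreal ((h z)\<^sup>2)) \<le> (\<integral>\<^sup>+z. ennreal ((f z)\<^sup>2) * indicator (torus L) z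
      + ennreal ((g z)\<^sup>2) * indicator (torus L) z + 2 * (ennreal (\<bar>f z\<bar> * \<bar>g z\<bar>) * indicator (torus L) z) \<partial>lborel)"
  proof (intro nn_integral_mono)
    fix z
    have "(h z)\<^sup>2 \<le> (\<bar>f z\<bar> + \<bar>g z\<bar>)\<^sup>2" using h(1)[of z] by (rule abs_le_square_iff[THEN iffD1, OF order_trans]) simp
    also have "\<dots> = (f z)\<^sup>2 + (g z)\<^sup>2 + 2 * (\<bar>f z\<bar> * \<bar>g z\<bar>)"
      by (simp add: power2_eq_square algebra_simps)
    finally have "ennreal ((h z)\<^sup>2) \<le> ennreal ((f z)\<^sup>2 + (g z)\<^sup>2 + 2 * (\<bar>f z\<bar> * \<bar>g z\<bar>))"
      by (rule ennreal_leI)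
    also have "\<dots> = ennreal ((f z)\<^sup>2) + ennreal ((g z)\<^sup>2) + 2 * ennreal (\<bar>f z\<bar> * \<bar>g z\<bar>)"
      by (simp add: ennreal_mult)
    finally show "ennreal ((h z)\<^sup>2) * indicator (torus L) z \<le> ennreal ((f z)\<^sup>2) * indicator (torus L) z
      + ennreal ((g z)\<^sup>2) * indicator (torus L) z + 2 * (ennreal (\<bar>f z\<bar> * \<bar>g z\<bar>) * indicator (torus L) z)"
      by (auto split: split_indicator)
  qed
  also have "\<dots> = ?I (\<lambda>z. ennreal ((f z)\<^sup>2)) + ?I (\<lambda>z. ennreal ((g z)\<^sup>2)) + 2 * ?I (\<lambda>z. ennreal (\<bar>f z\<bar> * \<bar>g z\<bar>))"
    by (subst nn_integral_add, simp, simp)+ (subst nn_integral_cmult, simp_all)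
  also have "\<dots> \<le> ennreal ((l2_norm L f)\<^sup>2) + ennreal ((l2_norm L g)\<^sup>2) + 2 * ennreal (l2_norm L f * l2_norm L g)"
    using fg by (intro add_mono mult_mono) (simp_all add: ennreal_l2_norm_sq f g L)
  also have "\<dots> = ennreal ((l2_norm L f + l2_norm L g)\<^sup>2)"
    by (simp add: ennreal_mult l2_norm_nonneg power2_sum algebra_simps)
  finally show "?I (\<lambda>z. ennreal ((h z)\<^sup>2)) \<le> ennreal ((l2_norm L f + l2_norm L g)\<^sup>2)" .
qed (use h l2_norm_nonneg in auto)

section \<open>Functions and curves with bounded derivatives\<close>

text \<open>
  Derivatives up to order \<open>k\<close>: those of order less than \<open>k\<close> are bounded by \<open>M\<close>, the top one by \<open>N\<close>.
  The two bounds are kept apart because the top derivative obeys a linear recursion along the orbits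
  of the splitting, in which the lower ones only enter as coefficients.
\<close>

primrec bounded_derivs :: "nat \<Rightarrow> real \<Rightarrow> real \<Rightarrow> (real \<Rightarrow> real) \<Rightarrow> bool" where
  "bounded_derivs 0 M N g \<longleftrightarrow> (\<forall>x. \<bar>g x\<bar> \<le> N)"
| "bounded_derivs (Suc k) M N g \<longleftrightarrow> (\<forall>x. \<bar>g x\<bar> \<le> M) \<and>
     (\<exists>g'. (\<forall>x. (g has_real_derivative g' x) (at x)) \<and> bounded_derivs k M N g')"

text \<open>The same for curves, which need not be bounded themselves.\<close>

fun bounded_curve :: "nat \<Rightarrow> real \<Rightarrow> real \<Rightarrow> (real \<Rightarrow> real) \<Rightarrow> bool" where
  "bounded_curve 0 M N g \<longleftrightarrow> True"
| "bounded_curve (Suc k) M N g \<longleftrightarrow>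
     (\<exists>g'. (\<forall>x. (g has_real_derivative g' x) (at x)) \<and> bounded_derivs k M N g')"

lemma bounded_derivs_SucI:
  assumes "\<And>x. \<bar>g x\<bar> \<le> M" "\<And>x. (g has_real_derivative g' x) (at x)" "bounded_derivs k M N g'"
  shows "bounded_derivs (Suc k) M N g"
  using assms by auto

lemma bounded_derivs_SucE:
  assumes "bounded_derivs (Suc k) M N g"
  obtains g' where "\<And>x. \<bar>g x\<bar> \<le> M" "\<And>x. (g has_real_derivative g' x) (at x)" "bounded_derivs k M N g'"
  using assms by auto

lemma bounded_curve_SucI:
  assumes "\<And>x. (g has_real_derivative g' x) (at x)" "bounded_derivs k M N g'"
  shows "bounded_curve (Suc k) M N g"
  using assms by auto

lemma bounded_curve_SucE:
  assumes "bounded_curve (Suc k) M N g"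
  obtains g' where "\<And>x. (g has_real_derivative g' x) (at x)" "bounded_derivs k M N g'"
  using assms by auto

lemma bounded_derivs_mono:
  "bounded_derivs k M N g \<Longrightarrow> M \<le> M' \<Longrightarrow> N \<le> N' \<Longrightarrow> bounded_derivs k M' N' g"
proof (induction k arbitrary: g)
  case (Suc k)
  from Suc.prems(1) show ?case
    by (elim bounded_derivs_SucE, intro bounded_derivs_SucI)
       (use Suc in \<open>auto intro: order_trans\<close>)
qed (auto intro: order_trans)

lemma bounded_derivs_lower: "bounded_derivs (Suc k) M N g \<Longrightarrow> bounded_derivs k M M g"
  by (induction k arbitrary: g) auto

text \<open>Glues two separately obtained estimates: the lower orders from the first, the top order
  from the second, whose \<open>M'\<close> is discarded. Uniqueness of derivatives identifies the
  two chains of derivatives.\<close>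

lemma bounded_derivs_top:
  "bounded_derivs k M M g \<Longrightarrow> bounded_derivs (Suc k) M' N g \<Longrightarrow> bounded_derivs (Suc k) M N g"
proof (induction k arbitrary: g)
  case (Suc k)
  obtain g' where g': "\<And>x. (g has_real_derivative g' x) (at x)" "bounded_derivs k M M g'"
    using Suc.prems(1) by auto
  obtain g'' where g'': "\<And>x. (g has_real_derivative g'' x) (at x)" "bounded_derivs (Suc k) M' N g''"
    using bounded_derivs_SucE[OF Suc.prems(2)] by blast
  have "g' = g''" using g'(1) g''(1) DERIV_unique by blast
  then have "bounded_derivs (Suc k) M N g'"
    using Suc.IH[OF g'(2)] g''(2) by blast
  then show ?case using Suc.prems(1) g'(1) by auto
qed auto

lemma bounded_derivs_const:
  "0 \<le> M \<Longrightarrow> 0 \<le> N \<Longrightarrow> \<bar>c\<bar> \<le> M \<Longrightarrow> \<bar>c\<bar> \<le> N \<Longrightarrow> bounded_derivs k M N (\<lambda>x. c)"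
proof (induction k arbitrary: c)
  case (Suc k)
  then show ?case by (auto intro!: exI[of _ "\<lambda>x. 0"])
qed auto

lemma bounded_derivs_add:
  "bounded_derivs k M N f \<Longrightarrow> bounded_derivs k M' N' g \<Longrightarrow>
   bounded_derivs k (M + M') (N + N') (\<lambda>x. f x + g x)"
proof (induction k arbitrary: f g)
  case 0
  then show ?case by (auto intro: order_trans[OF abs_triangle_ineq] add_mono)
next
  case (Suc k)
  then obtain f' g' where "\<And>x. (f has_real_derivative f' x) (at x)" "bounded_derivs k M N f'"
     "\<And>x. (g has_real_derivative g' x) (at x)" "bounded_derivs k M' N' g'" by auto
  moreover have "\<bar>f x + g x\<bar> \<le> M + M'" for x
    using Suc.prems by (auto intro: order_trans[OF abs_triangle_ineq] add_mono)
  ultimately show ?case using Suc.IH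
    by (intro bounded_derivs_SucI[where g'="\<lambda>x. f' x + g' x"]) (auto intro: DERIV_add)
qed

lemma bounded_derivs_cmult:
  "bounded_derivs k M N f \<Longrightarrow> bounded_derivs k (\<bar>c\<bar> * M) (\<bar>c\<bar> * N) (\<lambda>x. c * f x)"
proof (induction k arbitrary: f)
  case 0
  then show ?case by (auto simp: abs_mult mult_left_mono)
next
  case (Suc k)
  then obtain f' where "\<And>x. (f has_real_derivative f' x) (at x)" "bounded_derivs k M N f'" by auto
  then show ?case using Suc
    by (auto simp: abs_mult mult_left_mono intro!: exI[of _ "\<lambda>x. c * f' x"] DERIV_cmult)
qed

text \<open>Leibniz rule with the one term containing the top derivative of \<open>g\<close> singled
  out: it is \<open>f\<close> times that derivative, so N enters with the factor A only, and all
  other terms involve M. This linearity in N is what a Gronwall argument can use; the powers of 2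
  are crude binomial constants.\<close>

lemma bounded_derivs_mult:
  "bounded_derivs k A A f \<Longrightarrow> bounded_derivs k M N g \<Longrightarrow>
   bounded_derivs k (2 ^ k * A * M) (A * N + real k * 2 ^ k * A * M) (\<lambda>x. f x * g x)"
proof (induction k arbitrary: f g N)
  case 0
  have "0 \<le> A" using 0(1) by (auto intro: order_trans[OF abs_ge_zero])
  with 0 show ?case by (auto simp: abs_mult intro: mult_mono)
next
  case (Suc k)
  obtain f' where f': "\<And>x. (f has_real_derivative f' x) (at x)" "bounded_derivs k A A f'"
    using Suc.prems(1) by auto
  obtain g' where g': "\<And>x. (g has_real_derivative g' x) (at x)" "bounded_derivs k M N g'"
    using Suc.prems(2) by auto
  have fb: "\<And>x. \<bar>f x\<bar> \<le> A" and gb: "\<And>x. \<bar>g x\<bar> \<le> M" using Suc.prems by auto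
  have A: "0 \<le> A" and M: "0 \<le> M"
    using order_trans[OF abs_ge_zero fb[of 0]] order_trans[OF abs_ge_zero gb[of 0]] by auto
  have "bounded_derivs k (2 ^ k * A * M + 2 ^ k * A * M)
    ((A * M + real k * 2 ^ k * A * M) + (A * N + real k * 2 ^ k * A * M)) (\<lambda>x. f' x * g x + f x * g' x)"
    by (intro bounded_derivs_add Suc.IH f' g' bounded_derivs_lower[OF Suc.prems(1)] bounded_derivs_lower[OF Suc.prems(2)])
  \<comment> \<open>The spare \<open>A * M\<close> stems from \<open>f' * g\<close>, where the top
    order of \<open>g\<close> is already bounded by M; the step from k to k + 1 in the last constant
    absorbs it.\<close>
  moreover have "A * M \<le> 2 * 2 ^ k * A * M"
  proof -
    have "1 * (A * M) \<le> (2 * 2 ^ k) * (A * M)"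
      using A M one_le_power[of "2::real" k] by (intro mult_right_mono mult_nonneg_nonneg) linarith+
    then show ?thesis by (simp add: mult.assoc)
  qed
  ultimately have "bounded_derivs k (2 ^ Suc k * A * M) (A * N + real (Suc k) * 2 ^ Suc k * A * M)
      (\<lambda>x. f' x * g x + f x * g' x)"
    by (elim bounded_derivs_mono) (simp_all add: algebra_simps)
  moreover have "((\<lambda>x. f x * g x) has_real_derivative f' x * g x + f x * g' x) (at x)" for x
    using DERIV_mult[OF f'(1) g'(1), of x] by (simp add: algebra_simps)
  moreover have "\<bar>f x * g x\<bar> \<le> 2 ^ Suc k * A * M" for x
  proof -
    have "\<bar>f x * g x\<bar> \<le> 1 * (A * M)"
      using mult_mono[OF fb[of x] gb[of x]] A by (simp add: abs_mult)
    also have "\<dots> \<le> (2 * 2 ^ k) * (A * M)"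
      using A M one_le_power[of "2::real" k] by (intro mult_right_mono mult_nonneg_nonneg) linarith+
    finally show ?thesis by (simp add: mult.assoc)
  qed
  ultimately show ?case by (intro bounded_derivs_SucI)
qed

lemma bounded_curve_mono:
  "bounded_curve k M N g \<Longrightarrow> M \<le> M' \<Longrightarrow> N \<le> N' \<Longrightarrow> bounded_curve k M' N' g"
  by (cases k) (auto intro: bounded_derivs_mono)

lemma bounded_curve_lower: "bounded_curve (Suc k) M N g \<Longrightarrow> bounded_curve k M M g"
  by (cases k) (auto simp del: bounded_derivs.simps intro: bounded_derivs_lower)

lemma bounded_curve_top:
  assumes "bounded_curve k M M g" "bounded_curve (Suc k) M' N g"
  shows "bounded_curve (Suc k) M N g"
proof (cases k)
  case (Suc j)
  obtain g' where g': "\<And>x. (g has_real_derivative g' x) (at x)" "bounded_derivs j M M g'"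
    using assms(1) Suc by auto
  obtain g'' where g'': "\<And>x. (g has_real_derivative g'' x) (at x)" "bounded_derivs (Suc j) M' N g''"
    using assms(2) Suc by (auto elim!: bounded_curve_SucE simp del: bounded_derivs.simps)
  have "g' = g''" using g'(1) g''(1) DERIV_unique by blast
  with bounded_derivs_top[OF g'(2)] g'' Suc show ?thesis
    by (auto simp del: bounded_derivs.simps)
qed (use assms in auto)

lemma bounded_curve_add:
  "bounded_curve k M N f \<Longrightarrow> bounded_curve k M' N' g \<Longrightarrow>
   bounded_curve k (M + M') (N + N') (\<lambda>x. f x + g x)"
  by (cases k) (auto elim!: bounded_curve_SucE intro!: bounded_curve_SucI DERIV_add bounded_derivs_add
      simp del: bounded_curve.simps(2))

lemma bounded_curve_cmult:
  "bounded_curve k M N f \<Longrightarrow> bounded_curve k (\<bar>c\<bar> * M) (\<bar>c\<bar> * N) (\<lambda>x. c * f x)"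
  by (cases k) (auto elim!: bounded_curve_SucE intro!: bounded_curve_SucI DERIV_cmult bounded_derivs_cmult
      simp del: bounded_curve.simps(2))

lemma bounded_curve_diff_cmult:
  assumes "bounded_curve k M N f" "bounded_curve k M' N' g"
  shows "bounded_curve k (M + \<bar>c\<bar> * M') (N + \<bar>c\<bar> * N') (\<lambda>x. f x - c * g x)"
  using bounded_curve_add[OF assms(1) bounded_curve_cmult[OF assms(2), of "- c"]] by simp

text \<open>The derivative of F o X is (F' o X) X': the first factor is controlled by induction on
  k, the product by the Leibniz bound. The constant is chosen before F and X, hence depends on k, A
  and M alone; X may be unbounded, as it only serves as an argument of F.\<close>

lemma bounded_derivs_compose:
  "\<exists>C\<ge>0. \<forall>F X. bounded_derivs k A A F \<longrightarrow> bounded_curve k M M X \<longrightarrow> bounded_derivs k C C (\<lambda>s. F (X s))"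
proof (induction k)
  case 0
  show ?case by (auto intro!: exI[of _ "\<bar>A\<bar>"] intro: order_trans)
next
  case (Suc k)
  then obtain C where C: "0 \<le> C" "\<And>F X. bounded_derivs k A A F \<Longrightarrow> bounded_curve k M M X \<Longrightarrow> bounded_derivs k C C (\<lambda>s. F (X s))"
    by blast
  define D where "D = \<bar>A\<bar> + 2 ^ k * C * \<bar>M\<bar> + (C * \<bar>M\<bar> + real k * 2 ^ k * C * \<bar>M\<bar>)"
  have "0 \<le> 2 ^ k * C * \<bar>M\<bar>" "0 \<le> C * \<bar>M\<bar>" "0 \<le> real k * 2 ^ k * C * \<bar>M\<bar>"
    using C(1) by auto
  then have D: "0 \<le> D" "2 ^ k * C * \<bar>M\<bar> \<le> D" "C * \<bar>M\<bar> + real k * 2 ^ k * C * \<bar>M\<bar> \<le> D" "A \<le> D"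
    unfolding D_def using abs_ge_self[of A] abs_ge_zero[of A] by linarith+
  have "bounded_derivs (Suc k) D D (\<lambda>s. F (X s))"
    if F: "bounded_derivs (Suc k) A A F" and X: "bounded_curve (Suc k) M M X" for F X
  proof -
    obtain F' where F': "\<And>x. (F has_real_derivative F' x) (at x)" "bounded_derivs k A A F'"
      using F by auto
    obtain X' where X': "\<And>x. (X has_real_derivative X' x) (at x)" "bounded_derivs k M M X'"
      using X by auto
    have "bounded_derivs k C C (\<lambda>s. F' (X s))"
      by (rule C(2)[OF F'(2) bounded_curve_lower[OF X]])
    then have "bounded_derivs k (2 ^ k * C * \<bar>M\<bar>) (C * \<bar>M\<bar> + real k * 2 ^ k * C * \<bar>M\<bar>) (\<lambda>s. F' (X s) * X' s)"
      using bounded_derivs_mono[OF X'(2)] by (intro bounded_derivs_mult) auto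
    then have "bounded_derivs k D D (\<lambda>s. F' (X s) * X' s)"
      using D by (elim bounded_derivs_mono) auto
    moreover have "((\<lambda>s. F (X s)) has_real_derivative F' (X s) * X' s) (at s)" for s
      by (rule DERIV_chain2[OF F'(1) X'(1)])
    moreover have "\<bar>F (X s)\<bar> \<le> D" for s
      using F D(4) by (auto intro: order_trans)
    ultimately show ?thesis by (intro bounded_derivs_SucI)
  qed
  then show ?case using D(1) by blast
qed

text \<open>Unfolds the nested existentials into the sequence of derivatives that
  \<open>Taylor_up\<close> expects.\<close>

lemma bounded_derivs_sequence:
  "bounded_derivs k M N g \<Longrightarrow>
   \<exists>D. D 0 = g \<and> (\<forall>m<k. \<forall>x. (D m has_real_derivative D (Suc m) x) (at x)) \<and> (\<forall>x. \<bar>D k x\<bar> \<le> N)"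
proof (induction k arbitrary: g)
  case 0
  then show ?case by (auto intro!: exI[of _ "\<lambda>_. g"])
next
  case (Suc k)
  then obtain g' where g': "\<And>x. (g has_real_derivative g' x) (at x)" "bounded_derivs k M N g'"
    by auto
  obtain D where D: "D 0 = g'" "\<And>m x. m < k \<Longrightarrow> (D m has_real_derivative D (Suc m) x) (at x)" "\<And>x. \<bar>D k x\<bar> \<le> N"
    using Suc.IH[OF g'(2)] by auto
  have "(case_nat g D m has_real_derivative case_nat g D (Suc m) x) (at x)" if "m < Suc k" for m x
    using that g'(1) D by (cases m) auto
  then show ?case
    using D(3) by (intro exI[of _ "case_nat g D"]) auto
qed

section \<open>The discontinuous Galerkin projection\<close>

lemma tensor_polys_continuous: "p \<in> tensor_polys l \<Longrightarrow> continuous_on UNIV p"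
  unfolding tensor_polys_def by (auto simp: split_beta intro!: continuous_intros)

lemma tensor_polys_add_scaled:
  assumes "p \<in> tensor_polys l" "q \<in> tensor_polys l"
  shows "(\<lambda>z. p z + c * q z) \<in> tensor_polys l"
proof -
  obtain a b where p: "p = (\<lambda>(x, v). \<Sum>i\<le>l. \<Sum>j\<le>l. a i j * x ^ i * v ^ j)"
    and q: "q = (\<lambda>(x, v). \<Sum>i\<le>l. \<Sum>j\<le>l. b i j * x ^ i * v ^ j)"
    using assms unfolding tensor_polys_def by blast
  have "(\<lambda>z. p z + c * q z) = (\<lambda>(x, v). \<Sum>i\<le>l. \<Sum>j\<le>l. (a i j + c * b i j) * x ^ i * v ^ j)"
    unfolding p q by (auto simp: fun_eq_iff sum.distrib sum_distrib_left algebra_simps)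
  then show ?thesis
    unfolding tensor_polys_def mem_Collect_eq by (rule exI[of _ "\<lambda>i j. a i j + c * b i j"])
qed

lemma tensor_polys_zero: "(\<lambda>z. 0) \<in> tensor_polys l"
  unfolding tensor_polys_def by (auto intro!: exI[of _ "\<lambda>_ _. 0"])

lemma tensor_polys_diff:
  "p \<in> tensor_polys l \<Longrightarrow> q \<in> tensor_polys l \<Longrightarrow> (\<lambda>z. p z - q z) \<in> tensor_polys l"
  using tensor_polys_add_scaled[of p l q "- 1"] by simp

lemma tensor_polys_sum:
  assumes "finite I" "\<And>i. i \<in> I \<Longrightarrow> p i \<in> tensor_polys l"
  shows "(\<lambda>z. \<Sum>i\<in>I. p i z) \<in> tensor_polys l"
  using assms
proof (induction I rule: finite_induct)
  case (insert i I)
  then show ?case using tensor_polys_add_scaled[of "\<lambda>z. \<Sum>i\<in>I. p i z" l "p i" 1] by (simp add: add.commute)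
qed (simp add: tensor_polys_zero)

lemma poly_eq_sum_atMost:
  fixes p :: "real poly"
  assumes "degree p \<le> l"
  shows "poly p x = (\<Sum>i\<le>l. coeff p i * x ^ i)"
  unfolding poly_altdef
  by (rule sum.mono_neutral_left) (use assms in \<open>auto simp: coeff_eq_0\<close>)

lemma tensor_polys_product:
  fixes p q :: "real poly"
  assumes "degree p \<le> l" "degree q \<le> l"
  shows "(\<lambda>(x, v). poly p x * poly q v) \<in> tensor_polys l"
  unfolding tensor_polys_def
  by (auto simp: fun_eq_iff poly_eq_sum_atMost[OF assms(1)] poly_eq_sum_atMost[OF assms(2)]
      sum_product mult_ac intro!: exI[of _ "\<lambda>i j. coeff p i * coeff q j"])

lemma polyfun_zero_on_interval:
  fixes c :: "nat \<Rightarrow> real"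
  assumes "a < b" "\<And>x. a < x \<Longrightarrow> x < b \<Longrightarrow> (\<Sum>i\<le>n. c i * x ^ i) = 0" "i \<le> n"
  shows "c i = 0"
proof (rule ccontr)
  assume "c i \<noteq> 0"
  then have "finite {x. (\<Sum>i\<le>n. c i * x ^ i) = 0}"
    using polyfun_finite_roots assms(3) by blast
  moreover have "{a<..<b} \<subseteq> {x. (\<Sum>i\<le>n. c i * x ^ i) = 0}" using assms by auto
  ultimately show False using \<open>a < b\<close> infinite_Ioo finite_subset by blast
qed

text \<open>A polynomial in one variable with infinitely many roots vanishes; this is used first in
  x for fixed v, then in v for each resulting coefficient.\<close>

lemma tensor_polys_zero_on_box:
  assumes "p \<in> tensor_polys l" "a < b" "c < d"
    and zero: "\<And>x v. a < x \<Longrightarrow> x < b \<Longrightarrow> c < v \<Longrightarrow> v < d \<Longrightarrow> p (x, v) = 0"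
  shows "p = (\<lambda>z. 0)"
proof -
  obtain k where p: "p = (\<lambda>(x, v). \<Sum>i\<le>l. \<Sum>j\<le>l. k i j * x ^ i * v ^ j)"
    using assms unfolding tensor_polys_def by blast
  have "(\<Sum>j\<le>l. k i j * v ^ j) = 0" if "c < v" "v < d" "i \<le> l" for v i
  proof (rule polyfun_zero_on_interval[OF \<open>a < b\<close> _ \<open>i \<le> l\<close>])
    fix x assume "a < x" "x < b"
    then show "(\<Sum>i\<le>l. (\<Sum>j\<le>l. k i j * v ^ j) * x ^ i) = 0"
      using zero[of x v] that by (simp add: p sum_distrib_right sum_distrib_left mult_ac)
  qed
  then have "k i j = 0" if "i \<le> l" "j \<le> l" for i j
    using polyfun_zero_on_interval[where n=l and c="k i" and i=j, OF \<open>c < d\<close>] that by blast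
  then show ?thesis unfolding p by (simp add: fun_eq_iff)
qed

text \<open>Along a null direction a semidefinite quadratic form is affine, so its slope must
  vanish: the degenerate case of Cauchy-Schwarz.\<close>

lemma affine_nonneg_imp_constant:
  fixes A B C :: real
  assumes "\<And>t. 0 \<le> A + 2 * t * C" shows "C = 0"
proof (rule ccontr)
  assume "C \<noteq> 0"
  then have "2 * (- (A + 1) / (2 * C)) * C = - (A + 1)" by simp
  then show False using assms[of "- (A + 1) / (2 * C)"] by simp
qed

text \<open>
  Gram--Schmidt: the projection onto the span of finitely many vectors is built by adding them one
  at a time. The form need only be semidefinite.
\<close>

lemma orthogonal_projection_exists:
  fixes ip :: "('a \<Rightarrow> real) \<Rightarrow> ('a \<Rightarrow> real) \<Rightarrow> real"
  assumes V: "\<And>f g c. f \<in> V \<Longrightarrow> g \<in> V \<Longrightarrow> (\<lambda>z. f z + c * g z) \<in> V" "(\<lambda>z. 0) \<in> V"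
    and lin: "\<And>f g h c. f \<in> V \<Longrightarrow> g \<in> V \<Longrightarrow> h \<in> V \<Longrightarrow> ip (\<lambda>z. f z + c * g z) h = ip f h + c * ip g h"
    and sym: "\<And>f g. ip f g = ip g f"
    and pos: "\<And>f. 0 \<le> ip f f"
    and "finite I" "\<And>i. i \<in> I \<Longrightarrow> b i \<in> V" "g \<in> V"
  shows "\<exists>c. \<forall>j\<in>I. ip (\<lambda>z. g z - (\<Sum>i\<in>I. c i * b i z)) (b j) = 0"
  using assms(6-8)
proof (induction I arbitrary: g rule: finite_induct)
  case (insert k I)
  have sumV: "(\<lambda>z. \<Sum>i\<in>I. c i * b i z) \<in> V" for c
    using insert.hyps(1) insert.prems(1)
  proof (induction I rule: finite_induct)
    case (insert i J)
    then have "(\<lambda>z. (\<Sum>i\<in>J. c i * b i z) + c i * b i z) \<in> V" by (intro V) auto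
    with insert.hyps show ?case by (simp add: add.commute)
  qed (simp add: V)
  have diffV: "(\<lambda>z. f z - h z) \<in> V" if "f \<in> V" "h \<in> V" for f h
    using V(1)[OF that, of "- 1"] by simp
  have ip0: "ip (\<lambda>z. 0) h = 0" if "h \<in> V" for h
    using lin[OF that that that, of "- 1"] by simp
  have ip_sum: "ip h (\<lambda>z. \<Sum>i\<in>I. c i * b i z) = 0" if h: "h \<in> V" "\<And>j. j \<in> I \<Longrightarrow> ip h (b j) = 0" for h c
    using insert.hyps(1) insert.prems(1) h(2)
  proof (induction I rule: finite_induct)
    case empty
    show ?case by (subst sym) (simp add: ip0[OF h(1)])
  next
    case (insert i J)
    have "(\<lambda>z. \<Sum>i\<in>J. c i * b i z) \<in> V"
      using insert.hyps(1) insert.prems(1)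
    proof (induction J rule: finite_induct)
      case (insert i J)
      then have "(\<lambda>z. (\<Sum>i\<in>J. c i * b i z) + c i * b i z) \<in> V" by (intro V) auto
      with insert.hyps show ?case by (simp add: add.commute)
    qed (simp add: V)
    then have "ip (\<lambda>z. (\<Sum>i\<in>J. c i * b i z) + c i * b i z) h
        = ip (\<lambda>z. \<Sum>i\<in>J. c i * b i z) h + c i * ip (b i) h"
      using insert.prems(1) by (intro lin h) auto
    moreover have "ip (\<lambda>z. \<Sum>i\<in>J. c i * b i z) h = 0"
      by (subst sym, rule insert.IH) (use insert.prems in auto)
    moreover have "ip (b i) h = 0" using insert.prems by (subst sym) simp
    ultimately have "ip h (\<lambda>z. (\<Sum>i\<in>J. c i * b i z) + c i * b i z) = 0"
      by (subst sym) simp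
    with insert.hyps show ?case by (simp add: add.commute)
  qed
  have bV: "b k \<in> V" and gV: "g \<in> V" using insert by auto
  obtain c where c: "\<And>j. j \<in> I \<Longrightarrow> ip (\<lambda>z. g z - (\<Sum>i\<in>I. c i * b i z)) (b j) = 0"
    using insert.IH[of g] insert.prems by auto
  obtain d where d: "\<And>j. j \<in> I \<Longrightarrow> ip (\<lambda>z. b k z - (\<Sum>i\<in>I. d i * b i z)) (b j) = 0"
    using insert.IH[of "b k"] insert.prems by auto
  \<comment> \<open>Residuals of \<open>g\<close> and of the new vector after projection onto the
    old ones; the new residual of \<open>g\<close> will be \<open>g'\<close> minus a multiple of
    \<open>u\<close>.\<close>
  define g' where "g' = (\<lambda>z. g z - (\<Sum>i\<in>I. c i * b i z))"
  define u where "u = (\<lambda>z. b k z - (\<Sum>i\<in>I. d i * b i z))"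
  have g'V: "g' \<in> V" and uV: "u \<in> V" unfolding g'_def u_def by (auto intro!: diffV sumV gV bV)
  \<comment> \<open>Against vectors orthogonal to the old family, the new vector and its residual
    are interchangeable.\<close>
  have orth_k: "ip h (b k) = ip h u" if "h \<in> V" "\<And>j. j \<in> I \<Longrightarrow> ip h (b j) = 0" for h
  proof -
    have "ip (\<lambda>z. u z + 1 * (\<Sum>i\<in>I. d i * b i z)) h = ip u h + 1 * ip (\<lambda>z. \<Sum>i\<in>I. d i * b i z) h"
      using uV sumV[of d] that by (intro lin)
    moreover have "ip (\<lambda>z. \<Sum>i\<in>I. d i * b i z) h = 0"
      by (subst sym) (rule ip_sum[OF that])
    moreover have "(\<lambda>z. u z + 1 * (\<Sum>i\<in>I. d i * b i z)) = b k" by (simp add: u_def)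
    ultimately have "ip (b k) h = ip u h" by simp
    then show ?thesis by (simp only: sym[of h])
  qed
  \<comment> \<open>If \<open>u\<close> is a null vector, then \<open>ip g' u = 0\<close> and any
    coefficient works; 0 is taken.\<close>
  define t where "t = (if ip u u = 0 then 0 else ip g' u / ip u u)"
  have tu: "ip g' u - t * ip u u = 0"
  proof (cases "ip u u = 0")
    case True
    have "0 \<le> ip g' g' + 2 * s * ip g' u" for s
    proof -
      have "ip (\<lambda>z. g' z + s * u z) (\<lambda>z. g' z + s * u z) = ip g' g' + s * ip g' u + s * (ip g' u + s * ip u u)"
      proof -
        have V': "(\<lambda>z. g' z + s * u z) \<in> V" by (intro V g'V uV)
        have "ip (\<lambda>z. g' z + s * u z) (\<lambda>z. g' z + s * u z)
          = ip g' (\<lambda>z. g' z + s * u z) + s * ip u (\<lambda>z. g' z + s * u z)"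
          by (rule lin[OF g'V uV V'])
        also have "ip g' (\<lambda>z. g' z + s * u z) = ip g' g' + s * ip u g'"
          by (subst sym) (rule lin[OF g'V uV g'V])
        also have "ip u (\<lambda>z. g' z + s * u z) = ip g' u + s * ip u u"
          by (subst sym) (rule lin[OF g'V uV uV])
        finally show ?thesis by (simp only: sym[of u g'])
      qed
      then show ?thesis using pos[of "\<lambda>z. g' z + s * u z"] True by (simp add: algebra_simps)
    qed
    then have "ip g' u = 0" by (rule affine_nonneg_imp_constant)
    then show ?thesis using True by simp
  qed (simp add: t_def)
  define h where "h = (\<lambda>z. g' z + (- t) * u z)"
  have hV: "h \<in> V" unfolding h_def by (intro V g'V uV)
  have hI: "ip h (b j) = 0" if "j \<in> I" for j
    unfolding h_def using that c d insert.prems g'V uV by (subst lin) (auto simp: g'_def u_def)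
  moreover have "ip h (b k) = 0"
  proof -
    have "ip h (b k) = ip h u" using hV hI by (rule orth_k)
    also have "\<dots> = 0" unfolding h_def using g'V uV tu by (subst lin) auto
    finally show ?thesis .
  qed
  \<comment> \<open>Collecting coefficients: the new vector receives t, and the correction contained
    in \<open>u\<close> changes the old coefficients by \<open>- t * d i\<close>.\<close>
  moreover have "h = (\<lambda>z. g z - (\<Sum>i\<in>insert k I. (if i = k then t else c i - t * d i) * b i z))"
  proof
    fix z
    have "(\<Sum>i\<in>I. (if i = k then t else c i - t * d i) * b i z) = (\<Sum>i\<in>I. c i * b i z) - t * (\<Sum>i\<in>I. d i * b i z)"
    proof -
      have "(\<Sum>i\<in>I. (if i = k then t else c i - t * d i) * b i z) = (\<Sum>i\<in>I. (c i - t * d i) * b i z)"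
        using insert.hyps by (intro sum.cong) auto
      then show ?thesis by (simp add: sum_subtractf sum_distrib_left left_diff_distrib mult.assoc)
    qed
    then show "h z = g z - (\<Sum>i\<in>insert k I. (if i = k then t else c i - t * d i) * b i z)"
      using insert.hyps unfolding h_def g'_def u_def by (simp add: algebra_simps)
  qed
  ultimately show ?case by (intro exI[of _ "\<lambda>i. if i = k then t else c i - t * d i"]) auto
qed simp

section \<open>The projection on a single cell\<close>

text \<open>The vector space on which the form is used. Boundedness is asked on the cell only, so
  that polynomials belong to it along with the admissible functions.\<close>

definition cell_bounded :: "(real \<times> real) set \<Rightarrow> phase_fun set" where
  "cell_bounded Q = {g. g \<in> borel_measurable borel \<and> (\<exists>B. \<forall>z\<in>Q. \<bar>g z\<bar> \<le> B)}"

lemma cell_bounded_add_scaled: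
  assumes "f \<in> cell_bounded Q" "g \<in> cell_bounded Q"
  shows "(\<lambda>z. f z + c * g z) \<in> cell_bounded Q"
proof -
  obtain B B' where "\<forall>z\<in>Q. \<bar>f z\<bar> \<le> B" "\<forall>z\<in>Q. \<bar>g z\<bar> \<le> B'"
    using assms unfolding cell_bounded_def by blast
  then have "\<forall>z\<in>Q. \<bar>f z + c * g z\<bar> \<le> B + \<bar>c\<bar> * B'"
    by (auto intro!: order_trans[OF abs_triangle_ineq] add_mono simp: abs_mult mult_left_mono)
  then show ?thesis using assms unfolding cell_bounded_def by auto
qed

lemma cell_bounded_diff:
  "f \<in> cell_bounded Q \<Longrightarrow> g \<in> cell_bounded Q \<Longrightarrow> (\<lambda>z. f z - g z) \<in> cell_bounded Q"
  using cell_bounded_add_scaled[of f Q g "- 1"] by simp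

lemma cell_bounded_mult:
  assumes "f \<in> cell_bounded Q" "g \<in> cell_bounded Q"
  shows "(\<lambda>z. f z * g z) \<in> cell_bounded Q"
proof -
  obtain B B' where B: "\<forall>z\<in>Q. \<bar>f z\<bar> \<le> B" "\<forall>z\<in>Q. \<bar>g z\<bar> \<le> B'"
    using assms unfolding cell_bounded_def by blast
  have "\<forall>z\<in>Q. \<bar>f z * g z\<bar> \<le> B * B'"
  proof
    fix z assume "z \<in> Q"
    then show "\<bar>f z * g z\<bar> \<le> B * B'"
      using B by (simp add: abs_mult mult_mono' order_trans[OF abs_ge_zero])
  qed
  then show ?thesis using assms unfolding cell_bounded_def by auto
qed

lemma admissible_cell_bounded: "admissible L g \<Longrightarrow> g \<in> cell_bounded Q"
  unfolding admissible_def cell_bounded_def by blast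

definition half_open_box :: "real \<Rightarrow> real \<Rightarrow> real \<Rightarrow> real \<Rightarrow> (real \<times> real) set" where
  "half_open_box a b c d = {a..<b} \<times> {c..<d}"

lemma half_open_box_sets [measurable]: "half_open_box a b c d \<in> sets borel"
  unfolding half_open_box_def borel_prod[symmetric] by (intro pair_measureI) auto

lemma emeasure_half_open_box: "a \<le> b \<Longrightarrow> c \<le> d \<Longrightarrow> emeasure lborel (half_open_box a b c d) = ennreal ((b - a) * (d - c))"
  unfolding half_open_box_def lborel_prod[symmetric]
  by (subst lborel.emeasure_pair_measure_Times) (auto simp: ennreal_mult)

locale dg_box =
  fixes a b c d :: real and Q
  assumes ab: "a < b" and cd: "c < d"
  defines "Q \<equiv> half_open_box a b c d"
begin

lemma Q_sets [measurable]: "Q \<in> sets borel"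
  unfolding Q_def by simp

lemma set_integrable_Q:
  assumes "g \<in> cell_bounded Q"
  shows "set_integrable lborel Q g"
proof -
  obtain B where B: "\<forall>z\<in>Q. \<bar>g z\<bar> \<le> B" and [measurable]: "g \<in> borel_measurable borel"
    using assms unfolding cell_bounded_def by blast
  have "set_integrable lborel Q (\<lambda>z. B)"
    unfolding set_integrable_def using ab cd
    by (auto simp: integrable_indicator_iff emeasure_half_open_box Q_def intro!: integrable_mult_left)
  then show ?thesis
    by (rule set_integrable_bound)
       (use B in \<open>auto simp: set_borel_measurable_def intro!: AE_I2 intro: order_trans[OF _ abs_ge_self]\<close>)
qed

lemma tensor_polys_cell_bounded: "p \<in> tensor_polys l \<Longrightarrow> p \<in> cell_bounded Q"
proof -
  assume p: "p \<in> tensor_polys l"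
  have "compact (p ` ({a..b} \<times> {c..d}))"
    using tensor_polys_continuous[OF p] by (intro compact_continuous_image compact_Times) (auto intro: continuous_on_subset)
  then obtain B where "\<And>y. y \<in> p ` ({a..b} \<times> {c..d}) \<Longrightarrow> norm y \<le> B"
    using compact_imp_bounded bounded_iff by metis
  then have "\<forall>z\<in>Q. \<bar>p z\<bar> \<le> B" unfolding Q_def half_open_box_def by force
  moreover have "p \<in> borel_measurable borel"
    using tensor_polys_continuous[OF p] by (rule borel_measurable_continuous_onI)
  ultimately show ?thesis unfolding cell_bounded_def by blast
qed

lemma integral_add_scaled:
  assumes "f \<in> cell_bounded Q" "g \<in> cell_bounded Q"
  shows "(LINT z:Q|lborel. f z + k * g z) = (LINT z:Q|lborel. f z) + k * (LINT z:Q|lborel. g z)"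
  using set_integral_add(2)[OF set_integrable_Q[OF assms(1)] set_integrable_mult_right[OF set_integrable_Q[OF assms(2)]], of k]
  by simp

lemma integral_diff:
  assumes "f \<in> cell_bounded Q" "g \<in> cell_bounded Q"
  shows "(LINT z:Q|lborel. f z - g z) = (LINT z:Q|lborel. f z) - (LINT z:Q|lborel. g z)"
  using integral_add_scaled[OF assms, of "- 1"] by simp

lemma integral_square_nonneg:
  fixes f :: phase_fun
  shows "0 \<le> (LINT z:Q|lborel. (f z)\<^sup>2)"
  unfolding set_lebesgue_integral_def by (intro Bochner_Integration.integral_nonneg) simp

text \<open>Definiteness on polynomials, the source of uniqueness of the projection. The points of
  the open box where p does not vanish form an open null set, hence there are none.\<close>

lemma tensor_polys_integral_square_zero:
  assumes p: "p \<in> tensor_polys l" and zero: "(LINT z:Q|lborel. (p z)\<^sup>2) = 0"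
  shows "p = (\<lambda>z. 0)"
proof (rule tensor_polys_zero_on_box[OF p ab cd])
  have pb: "(\<lambda>z. (p z)\<^sup>2) \<in> cell_bounded Q"
    using cell_bounded_mult[OF tensor_polys_cell_bounded[OF p] tensor_polys_cell_bounded[OF p]]
    by (simp add: power2_eq_square)
  have "AE z in lborel. indicator Q z *\<^sub>R (p z)\<^sup>2 = 0"
    using zero set_integrable_Q[OF pb] unfolding set_lebesgue_integral_def set_integrable_def
    by (subst (asm) integral_nonneg_eq_0_iff_AE) auto
  define U where "U = {z \<in> {a<..<b} \<times> {c<..<d}. p z \<noteq> 0}"
  have openU: "open U"
  proof -
    have "open (({a<..<b} \<times> {c<..<d}) \<inter> p -` (- {0}))"
      using tensor_polys_continuous[OF p]
      by (intro open_Int open_Times open_vimage) (auto simp: continuous_on_eq_continuous_within intro: open_vimage)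
    also have "({a<..<b} \<times> {c<..<d}) \<inter> p -` (- {0}) = U" unfolding U_def by auto
    finally show ?thesis .
  qed
  have "AE z in lborel. z \<notin> U"
    using \<open>AE z in lborel. indicator Q z *\<^sub>R (p z)\<^sup>2 = 0\<close>
    by eventually_elim (auto simp: U_def Q_def half_open_box_def indicator_def split: if_splits)
  then have "emeasure lborel U = 0"
    using openU by (subst (asm) AE_iff_measurable[OF _ refl]) (auto simp: borel_open)
  then have "negligible U"
    using openU by (simp add: negligible_iff_null_sets null_sets_completionI null_setsI borel_open)
  then have "U = {}" using open_not_negligible[OF openU] by blast
  fix x v assume "a < x" "x < b" "c < v" "v < d"
  with \<open>U = {}\<close> show "p (x, v) = 0" unfolding U_def by auto
qed

lemma L2_proj_exists:
  assumes g: "g \<in> cell_bounded Q"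
  shows "\<exists>p\<in>tensor_polys l. \<forall>q\<in>tensor_polys l. (LINT z:Q|lborel. (g z - p z) * q z) = 0"
proof -
  let ?ip = "\<lambda>(f :: phase_fun) (g :: phase_fun). LINT z:Q|lborel. f z * g z"
  define B where "B = (\<lambda>(i :: nat, j :: nat) (x :: real, v :: real). x ^ i * v ^ j)"
  let ?I = "{..l} \<times> {..l}"
  have bT: "B i \<in> tensor_polys l" if "i \<in> ?I" for i
    using that tensor_polys_product[of "monom 1 (fst i)" l "monom 1 (snd i)"]
    by (auto simp: B_def degree_monom_eq poly_monom split_beta)
  have mbT: "(\<lambda>z. m * B i z) \<in> tensor_polys l" if "i \<in> ?I" for i m
    using tensor_polys_add_scaled[OF tensor_polys_zero bT[OF that], of m] by simp
  have ip_lin: "?ip (\<lambda>z. f z + k * g z) h = ?ip f h + k * ?ip g h"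
    if "f \<in> cell_bounded Q" "g \<in> cell_bounded Q" "h \<in> cell_bounded Q" for f g h k
    using integral_add_scaled[OF cell_bounded_mult[OF that(1,3)] cell_bounded_mult[OF that(2,3)], of k]
    by (simp add: algebra_simps)
  have "\<exists>k. \<forall>j\<in>?I. ?ip (\<lambda>z. g z - (\<Sum>i\<in>?I. k i * B i z)) (B j) = 0"
  proof (rule orthogonal_projection_exists[where V="cell_bounded Q" and ip="?ip"])
    show "0 \<le> ?ip f f" for f using integral_square_nonneg[of f] by (simp add: power2_eq_square)
    show "B i \<in> cell_bounded Q" if "i \<in> ?I" for i using bT[OF that] by (rule tensor_polys_cell_bounded)
    show "?ip f g = ?ip g f" for f g by (simp add: mult.commute)
  qed (use g in \<open>auto intro: cell_bounded_add_scaled ip_lin tensor_polys_cell_bounded[OF tensor_polys_zero]\<close>)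
  then obtain k where k: "\<And>j. j \<in> ?I \<Longrightarrow> ?ip (\<lambda>z. g z - (\<Sum>i\<in>?I. k i * B i z)) (B j) = 0"
    by blast
  define p where "p = (\<lambda>z. \<Sum>i\<in>?I. k i * B i z)"
  have pT: "p \<in> tensor_polys l"
    unfolding p_def by (intro tensor_polys_sum mbT) auto
  define r where "r = (\<lambda>z. g z - p z)"
  have r: "r \<in> cell_bounded Q" unfolding r_def
    by (intro cell_bounded_diff g tensor_polys_cell_bounded[OF pT])
  have rb: "?ip r (B j) = 0" if "j \<in> ?I" for j using k[OF that] by (simp add: r_def p_def)
  have sum0: "?ip r (\<lambda>z. \<Sum>j\<in>J. m j * B j z) = 0" if "finite J" "J \<subseteq> ?I" for J m
    using that
  proof (induction J rule: finite_induct)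
    case (insert j J)
    have "(\<lambda>z. \<Sum>j\<in>J. m j * B j z) \<in> tensor_polys l"
    proof (rule tensor_polys_sum[OF insert.hyps(1)])
      fix i assume "i \<in> J"
      with insert.prems have "i \<in> ?I" by blast
      then show "(\<lambda>z. m i * B i z) \<in> tensor_polys l" by (rule mbT)
    qed
    from ip_lin[OF tensor_polys_cell_bounded[OF this] tensor_polys_cell_bounded[OF bT] r, of j "m j"] insert.prems
    have "?ip (\<lambda>z. (\<Sum>j\<in>J. m j * B j z) + m j * B j z) r = ?ip (\<lambda>z. \<Sum>j\<in>J. m j * B j z) r + m j * ?ip (B j) r"
      by simp
    then show ?case using insert rb[of j] by (simp add: mult.commute[of "r _"] add.commute)
  qed (simp add: set_lebesgue_integral_def)
  have "?ip r q = 0" if "q \<in> tensor_polys l" for q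
  proof -
    obtain m where "q = (\<lambda>(x, v). \<Sum>i\<le>l. \<Sum>j\<le>l. m i j * x ^ i * v ^ j)"
      using \<open>q \<in> tensor_polys l\<close> unfolding tensor_polys_def by blast
    then have "q = (\<lambda>z. \<Sum>ij\<in>?I. m (fst ij) (snd ij) * B ij z)"
      by (auto simp: B_def fun_eq_iff sum.cartesian_product split_beta mult_ac)
    then show ?thesis using sum0[of ?I "\<lambda>ij. m (fst ij) (snd ij)"] by simp
  qed
  then show ?thesis using pT unfolding r_def by blast
qed

text \<open>Makes the definite description in \<open>L2_proj\<close> meaningful: existence comes
  from Gram-Schmidt on the monomials, uniqueness because the difference of two candidates is a
  polynomial orthogonal to itself.\<close>

lemma L2_proj_orthogonal:
  assumes g: "g \<in> cell_bounded Q"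
  shows "L2_proj l Q g \<in> tensor_polys l"
    and "q \<in> tensor_polys l \<Longrightarrow> (LINT z:Q|lborel. (g z - L2_proj l Q g z) * q z) = 0"
proof -
  let ?P = "\<lambda>p. p \<in> tensor_polys l \<and> (\<forall>q\<in>tensor_polys l. (LINT z:Q|lborel. (g z - p z) * q z) = 0)"
  have "\<exists>!p. ?P p"
  proof (rule ex_ex1I)
    show "\<exists>p. ?P p" using L2_proj_exists[OF g] by blast
    fix p p' assume p: "?P p" and p': "?P p'"
    define r where "r = (\<lambda>z. p z - p' z)"
    have r: "r \<in> tensor_polys l" unfolding r_def using p p' by (intro tensor_polys_diff) auto
    have "(LINT z:Q|lborel. (r z)\<^sup>2) = (LINT z:Q|lborel. (g z - p' z) * r z - (g z - p z) * r z)"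
      by (simp add: r_def power2_eq_square algebra_simps)
    also have "\<dots> = (LINT z:Q|lborel. (g z - p' z) * r z) - (LINT z:Q|lborel. (g z - p z) * r z)"
      using p p' r g by (intro integral_diff cell_bounded_mult cell_bounded_diff) (auto intro: tensor_polys_cell_bounded)
    also have "\<dots> = 0" using p p' r by simp
    finally have "r = (\<lambda>z. 0)" by (rule tensor_polys_integral_square_zero[OF r])
    then show "p = p'" unfolding r_def by (simp add: fun_eq_iff)
  qed
  from theI'[OF this] have "?P (L2_proj l Q g)" unfolding L2_proj_def by blast
  then show "L2_proj l Q g \<in> tensor_polys l"
    and "q \<in> tensor_polys l \<Longrightarrow> (LINT z:Q|lborel. (g z - L2_proj l Q g z) * q z) = 0" by auto
qed

text \<open>Pythagoras for the cell integral: the mixed term drops out. Contraction and best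
  approximation both follow by omitting one of the squares.\<close>

lemma orthogonal_square_le:
  assumes f: "f \<in> cell_bounded Q" and p: "p \<in> cell_bounded Q" and "(LINT z:Q|lborel. f z * p z) = 0"
  shows "(LINT z:Q|lborel. (f z + p z)\<^sup>2) = (LINT z:Q|lborel. (f z)\<^sup>2) + (LINT z:Q|lborel. (p z)\<^sup>2)"
proof -
  have "(LINT z:Q|lborel. (f z + p z)\<^sup>2) = (LINT z:Q|lborel. (f z * f z + 1 * (p z * p z)) + 2 * (f z * p z))"
    by (simp add: power2_eq_square algebra_simps)
  also have "\<dots> = (LINT z:Q|lborel. f z * f z) + 1 * (LINT z:Q|lborel. p z * p z) + 2 * (LINT z:Q|lborel. f z * p z)"
    by (subst integral_add_scaled integral_add_scaled, intro f p cell_bounded_mult cell_bounded_add_scaled, intro f p cell_bounded_mult cell_bounded_add_scaled)+ simp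
  finally show ?thesis using assms by (simp add: power2_eq_square)
qed

text \<open>Formulated for a difference, since \<open>L2_proj\<close> is a definite description
  without established linearity: the difference of the residuals is orthogonal to the difference of
  the projections.\<close>

lemma L2_proj_contraction:
  assumes u: "u \<in> cell_bounded Q" and w: "w \<in> cell_bounded Q"
  shows "(LINT z:Q|lborel. (L2_proj l Q u z - L2_proj l Q w z)\<^sup>2) \<le> (LINT z:Q|lborel. (u z - w z)\<^sup>2)"
proof -
  define p where "p = (\<lambda>z. L2_proj l Q u z - L2_proj l Q w z)"
  define f where "f = (\<lambda>z. (u z - L2_proj l Q u z) - (w z - L2_proj l Q w z))"
  note P = L2_proj_orthogonal(1)[OF u, of l] L2_proj_orthogonal(2)[OF u, of _ l]
    L2_proj_orthogonal(1)[OF w, of l] L2_proj_orthogonal(2)[OF w, of _ l]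
  note PQ = tensor_polys_cell_bounded[OF P(1)] tensor_polys_cell_bounded[OF P(3)]
  have p: "p \<in> tensor_polys l" unfolding p_def by (intro tensor_polys_diff P)
  have f: "f \<in> cell_bounded Q" unfolding f_def by (intro cell_bounded_diff u w PQ)
  have "(LINT z:Q|lborel. f z * p z) =
     (LINT z:Q|lborel. (u z - L2_proj l Q u z) * p z - (w z - L2_proj l Q w z) * p z)"
    by (simp add: f_def algebra_simps)
  also have "\<dots> = (LINT z:Q|lborel. (u z - L2_proj l Q u z) * p z) - (LINT z:Q|lborel. (w z - L2_proj l Q w z) * p z)"
    by (intro integral_diff cell_bounded_mult cell_bounded_diff u w PQ tensor_polys_cell_bounded[OF p])
  also have "\<dots> = 0" using P(2)[OF p] P(4)[OF p] by simp
  finally have "(LINT z:Q|lborel. (f z + p z)\<^sup>2) = (LINT z:Q|lborel. (f z)\<^sup>2) + (LINT z:Q|lborel. (p z)\<^sup>2)"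
    by (intro orthogonal_square_le f tensor_polys_cell_bounded[OF p])
  then show ?thesis using integral_square_nonneg[of f] by (simp add: f_def p_def)
qed

lemma L2_proj_best:
  assumes g: "g \<in> cell_bounded Q" and q: "q \<in> tensor_polys l"
  shows "(LINT z:Q|lborel. (g z - L2_proj l Q g z)\<^sup>2) \<le> (LINT z:Q|lborel. (g z - q z)\<^sup>2)"
proof -
  note P = L2_proj_orthogonal(1)[OF g, of l] L2_proj_orthogonal(2)[OF g, of _ l]
  have d: "(\<lambda>z. L2_proj l Q g z - q z) \<in> tensor_polys l" by (intro tensor_polys_diff P q)
  have "(LINT z:Q|lborel. ((g z - L2_proj l Q g z) + (L2_proj l Q g z - q z))\<^sup>2)
     = (LINT z:Q|lborel. (g z - L2_proj l Q g z)\<^sup>2) + (LINT z:Q|lborel. (L2_proj l Q g z - q z)\<^sup>2)"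
    by (intro orthogonal_square_le cell_bounded_diff g tensor_polys_cell_bounded[OF P(1)] tensor_polys_cell_bounded[OF d] P(2)[OF d]
         tensor_polys_cell_bounded[OF q])
  then show ?thesis using integral_square_nonneg[of "\<lambda>z. L2_proj l Q g z - q z"] by simp
qed

end

section \<open>Polynomial approximation on a cell\<close>

text \<open>Expansion at the left end of the cell with the Lagrange remainder, whose factorial is
  dropped because only the power of \<open>x - a\<close> matters.\<close>

lemma taylor_poly:
  assumes "bounded_derivs (Suc l) C C g"
  shows "\<exists>p. degree p \<le> l \<and> (\<forall>x\<ge>a. \<bar>g x - poly p x\<bar> \<le> C * (x - a) ^ (l + 1))"
proof -
  obtain D where D: "D 0 = g" "\<And>m x. m < Suc l \<Longrightarrow> (D m has_real_derivative D (Suc m) x) (at x)"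
    "\<And>x. \<bar>D (Suc l) x\<bar> \<le> C"
    using bounded_derivs_sequence[OF assms] by blast
  define r where "r = (\<Sum>m\<le>l. monom (D m a / fact m) m)"
  define p where "p = pcompose r [:- a, 1:]"
  have r: "poly r y = (\<Sum>m\<le>l. D m a / fact m * y ^ m)" for y
    unfolding r_def by (simp add: poly_sum poly_monom)
  have "degree r \<le> l" unfolding r_def
    by (intro degree_sum_le) (auto intro: order_trans[OF degree_monom_le])
  then have "degree p \<le> l" unfolding p_def
    using degree_pcompose_le[of r "[:- a, 1:]"] by simp
  moreover have "\<bar>g x - poly p x\<bar> \<le> C * (x - a) ^ (l + 1)" if "a \<le> x" for x
  proof (cases "x = a")
    case True
    \<comment> \<open>Taylor's formula is available for x > a only; at x = a just the term m = 0
      survives, as \<open>0 ^ 0 = 1\<close>.\<close>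
    have "(\<Sum>m\<le>l. D m a / fact m * 0 ^ m) = D 0 a"
      by (subst sum.atMost_shift) simp
    then show ?thesis using True D(1) by (simp add: p_def poly_pcompose r)
  next
    case False
    then have "a < x" using that by simp
    then obtain t where t: "g x = (\<Sum>m<Suc l. D m a / fact m * (x - a) ^ m) + D (Suc l) t / fact (Suc l) * (x - a) ^ Suc l"
      using Taylor_up[of "Suc l" D g a x a] D by auto
    have "g x - poly p x = D (Suc l) t / fact (Suc l) * (x - a) ^ Suc l"
      unfolding t by (simp add: p_def poly_pcompose r lessThan_Suc_atMost)
    moreover have "\<bar>D (Suc l) t / fact (Suc l)\<bar> \<le> C / 1"
      unfolding abs_divide using D(3)[of t] order_trans[OF abs_ge_zero D(3)[of t]]
      by (intro frac_le) (simp_all add: fact_ge_1 del: fact_Suc)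
    moreover have "\<bar>(x - a) ^ Suc l\<bar> = (x - a) ^ Suc l" using that by simp
    ultimately have "\<bar>g x - poly p x\<bar> \<le> C / 1 * (x - a) ^ Suc l"
      using that by (simp only: abs_mult) (intro mult_right_mono, auto)
    then show ?thesis by simp
  qed
  ultimately show ?thesis by blast
qed

text \<open>The nodes are 0, ..., l, which keeps all bounds free of h. A side of length h is mapped
  onto [0, l + 1], so its nodes lie inside the cell at distance h / (l + 1).\<close>

definition lagrange_basis :: "nat \<Rightarrow> nat \<Rightarrow> real poly" where
  "lagrange_basis l j = (\<Prod>i\<in>{..l} - {j}. smult (1 / (real j - real i)) [:- real i, 1:])"

lemma degree_lagrange_basis:
  assumes "j \<le> l"
  shows "degree (lagrange_basis l j) \<le> l"
proof -
  have "degree (lagrange_basis l j) \<le> (\<Sum>i\<in>{..l} - {j}. 1)"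
    unfolding lagrange_basis_def
    by (rule order_trans[OF degree_prod_sum_le]) (auto intro!: sum_mono order_trans[OF degree_smult_le])
  also have "\<dots> = l" using assms by simp
  finally show ?thesis .
qed

lemma poly_lagrange_basis:
  "poly (lagrange_basis l j) y = (\<Prod>i\<in>{..l} - {j}. (y - real i) / (real j - real i))"
  unfolding lagrange_basis_def poly_prod by (intro prod.cong refl) (simp add: diff_divide_distrib)

lemma lagrange_basis_node:
  assumes "i \<le> l" "j \<le> l"
  shows "poly (lagrange_basis l j) (real i) = (if i = j then 1 else 0)"
proof (cases "i = j")
  case True
  then show ?thesis unfolding poly_lagrange_basis by (auto intro!: prod.neutral)
next
  case False
  then show ?thesis using assms unfolding poly_lagrange_basis by (auto intro!: prod_zero bexI[of _ i])
qed

text \<open>Each of the l factors has a numerator of at most l + 1 and, as a distance of distinct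
  integers, a denominator of at least 1.\<close>

lemma lagrange_basis_bound:
  assumes "j \<le> l" "0 \<le> y" "y \<le> real l + 1"
  shows "\<bar>poly (lagrange_basis l j) y\<bar> \<le> (real l + 1) ^ l"
proof -
  have "\<bar>poly (lagrange_basis l j) y\<bar> = (\<Prod>i\<in>{..l} - {j}. \<bar>(y - real i) / (real j - real i)\<bar>)"
    unfolding poly_lagrange_basis abs_prod ..
  also have "\<dots> \<le> (\<Prod>i\<in>{..l} - {j}. real l + 1)"
  proof (rule prod_mono, intro conjI)
    fix i assume "i \<in> {..l} - {j}"
    then have i: "i \<in> {..l}" "i \<noteq> j" by auto
    have "1 \<le> \<bar>real j - real i\<bar>" using i by linarith
    moreover have "\<bar>y - real i\<bar> \<le> real l + 1" using assms i by auto
    ultimately have "\<bar>y - real i\<bar> / \<bar>real j - real i\<bar> \<le> (real l + 1) / 1"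
      by (intro frac_le) auto
    then show "\<bar>(y - real i) / (real j - real i)\<bar> \<le> real l + 1" by (simp add: abs_divide)
  qed simp_all
  also have "\<dots> = (real l + 1) ^ l" using assms by simp
  finally show ?thesis .
qed

text \<open>The difference of the two sides has degree at most l and the l + 1 roots 0, ...,
  l.\<close>

lemma lagrange_interpolation:
  fixes p :: "real poly"
  assumes "degree p \<le> l"
  shows "poly p y = (\<Sum>j\<le>l. poly p (real j) * poly (lagrange_basis l j) y)"
proof -
  define r where "r = p - (\<Sum>j\<le>l. smult (poly p (real j)) (lagrange_basis l j))"
  have deg: "degree r \<le> l"
    unfolding r_def using assms degree_lagrange_basis
    by (intro degree_diff_le degree_sum_le) (auto intro: order_trans[OF degree_smult_le])
  have zero: "poly r (real i) = 0" if "i \<le> l" for i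
  proof -
    have "(\<Sum>j\<le>l. poly p (real j) * poly (lagrange_basis l j) (real i)) = (\<Sum>j\<le>l. if i = j then poly p (real j) else 0)"
      using that by (intro sum.cong) (auto simp: lagrange_basis_node)
    then show ?thesis using that by (simp add: r_def poly_sum)
  qed
  have "r = 0"
  proof (rule ccontr)
    assume "r \<noteq> 0"
    have "real ` {..l} \<subseteq> {x. poly r x = 0}" using zero by auto
    then have "card (real ` {..l}) \<le> card {x. poly r x = 0}"
      by (intro card_mono poly_roots_finite \<open>r \<noteq> 0\<close>)
    also have "\<dots> \<le> degree r" using \<open>r \<noteq> 0\<close> by (rule card_poly_roots_bound)
    finally show False using deg by (simp add: card_image)
  qed
  then have "poly r y = 0" by simp
  then show ?thesis by (simp add: r_def poly_sum)
qed

lemma rescaled_range: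
  assumes "0 < h" "c \<le> v" "v \<le> c + h"
  shows "0 \<le> (v - c) / h * (real l + 1)" "(v - c) / h * (real l + 1) \<le> real l + 1"
proof -
  have q: "0 \<le> (v - c) / h" "(v - c) / h \<le> 1" using assms by auto
  show "0 \<le> (v - c) / h * (real l + 1)" using q by (intro mult_nonneg_nonneg) auto
  show "(v - c) / h * (real l + 1) \<le> real l + 1" using mult_right_mono[OF q(2), of "real l + 1"] by simp
qed

text \<open>Interpolation reproduces the Taylor polynomial of degree l, so only the Taylor error
  counts: once at v itself, and once at each of the l + 1 nodes with a weight of at most (l + 1) ^
  l.\<close>

lemma interpolation_error:
  assumes g: "bounded_derivs (Suc l) C C g" and h: "0 < h" and v: "c \<le> v" "v \<le> c + h"
  shows "\<bar>g v - (\<Sum>j\<le>l. g (c + h / (real l + 1) * real j) * poly (lagrange_basis l j) ((v - c) / h * (real l + 1)))\<bar>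
     \<le> (1 + (real l + 1) ^ (l + 1)) * C * h ^ (l + 1)"
proof -
  obtain p where p: "degree p \<le> l" "\<And>x. c \<le> x \<Longrightarrow> \<bar>g x - poly p x\<bar> \<le> C * (x - c) ^ (l + 1)"
    using taylor_poly[OF g] by blast
  define k where "k = h / (real l + 1)"
  have k: "0 < k" "k * (real l + 1) = h" unfolding k_def using h by auto
  define y where "y = (v - c) / h * (real l + 1)"
  have y: "0 \<le> y" "y \<le> real l + 1" "c + k * y = v"
  proof -
    show "0 \<le> y" "y \<le> real l + 1" unfolding y_def by (rule rescaled_range[OF h v])+
    have "k * y = (k * (real l + 1)) * ((v - c) / h)" unfolding y_def by simp
    then show "c + k * y = v" unfolding k(2) using h by simp
  qed
  have C: "0 \<le> C" using g by (auto intro: order_trans[OF abs_ge_zero])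
  have near: "\<bar>g x - poly p x\<bar> \<le> C * h ^ (l + 1)" if "c \<le> x" "x \<le> c + h" for x
    using p(2)[OF that(1)] by (rule order_trans) (use that C in \<open>auto intro!: mult_left_mono power_mono simp del: power_Suc\<close>)
  let ?q = "pcompose p [:c, k:]"
  have "degree ?q \<le> l" using p(1) degree_pcompose_le[of p "[:c, k:]"] k by (auto split: if_splits)
  from lagrange_interpolation[OF this, of y]
  have pv: "poly p v = (\<Sum>j\<le>l. poly p (c + k * real j) * poly (lagrange_basis l j) y)"
    using y(3) by (simp add: poly_pcompose mult.commute)
  have "\<bar>(\<Sum>j\<le>l. poly p (c + k * real j) * poly (lagrange_basis l j) y) - (\<Sum>j\<le>l. g (c + k * real j) * poly (lagrange_basis l j) y)\<bar>
      \<le> (\<Sum>j\<le>l. \<bar>(poly p (c + k * real j) - g (c + k * real j)) * poly (lagrange_basis l j) y\<bar>)"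
    unfolding sum_subtractf[symmetric] left_diff_distrib by (rule sum_abs)
  also have "\<dots> \<le> (\<Sum>j\<le>l. C * h ^ (l + 1) * (real l + 1) ^ l)"
  proof (rule sum_mono)
    fix j assume j: "j \<in> {..l}"
    have "k * real j \<le> k * (real l + 1)" using j k by (intro mult_left_mono) auto
    then have "\<bar>g (c + k * real j) - poly p (c + k * real j)\<bar> \<le> C * h ^ (l + 1)"
      using k by (intro near) auto
    then show "\<bar>(poly p (c + k * real j) - g (c + k * real j)) * poly (lagrange_basis l j) y\<bar> \<le> C * h ^ (l + 1) * (real l + 1) ^ l"
      unfolding abs_mult using lagrange_basis_bound[of j l y] j y
      by (intro mult_mono) (auto simp: abs_minus_commute)
  qed
  also have "\<dots> = (real l + 1) ^ (l + 1) * C * h ^ (l + 1)" by (simp add: algebra_simps)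
  finally show ?thesis
    using near[OF v] unfolding pv k_def[symmetric] y_def[symmetric]
    by (simp add: distrib_right abs_le_iff)
qed

text \<open>Interpolation in v contributes 1 + (l + 1) ^ (l + 1). The Taylor errors in x at the l +
  1 nodes, weighted by the Lagrange basis, contribute (l + 1) ^ (l + 1) once more.\<close>

definition approx_const :: "nat \<Rightarrow> real" where
  "approx_const l = 1 + 2 * (real l + 1) ^ (l + 1)"

definition line_regular :: "nat \<Rightarrow> real \<Rightarrow> phase_fun \<Rightarrow> bool" where
  "line_regular k C w \<longleftrightarrow> (\<forall>v. bounded_derivs k C C (\<lambda>x. w (x, v))) \<and> (\<forall>x. bounded_derivs k C C (\<lambda>v. w (x, v)))"

text \<open>
  Lagrange interpolation in \<open>v\<close> followed by Taylor expansion in \<open>x\<close> at the interpolation nodes, so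
  that only derivatives along the coordinate lines are needed.
\<close>

lemma tensor_polys_approximation:
  assumes w: "line_regular (Suc l) C w" and h: "0 < h"
  shows "\<exists>q\<in>tensor_polys l. \<forall>z\<in>half_open_box a (a + h) c (c + h). \<bar>w z - q z\<bar> \<le> approx_const l * C * h ^ (l + 1)"
proof -
  define k where "k = h / (real l + 1)"
  have "\<forall>j. \<exists>p. degree p \<le> l \<and> (\<forall>x\<ge>a. \<bar>w (x, c + k * real j) - poly p x\<bar> \<le> C * (x - a) ^ (l + 1))"
    using w taylor_poly unfolding line_regular_def by blast
  then obtain p where p: "\<And>j. degree (p j) \<le> l" "\<And>j x. x \<ge> a \<Longrightarrow> \<bar>w (x, c + k * real j) - poly (p j) x\<bar> \<le> C * (x - a) ^ (l + 1)"
    by metis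
  have C: "0 \<le> C" using w unfolding line_regular_def by (auto intro: order_trans[OF abs_ge_zero])
  \<comment> \<open>The Lagrange basis pulled back from [0, l + 1] to the side [c, c + h] of the
    cell.\<close>
  define s where "s j = pcompose (lagrange_basis l j) [:- c * ((real l + 1) / h), (real l + 1) / h:]" for j
  have s: "poly (s j) v = poly (lagrange_basis l j) ((v - c) / h * (real l + 1))" for j v
  proof -
    have "- c * ((real l + 1) / h) + v * ((real l + 1) / h) = (v - c) / h * (real l + 1)"
    proof -
      have "- c * ((real l + 1) / h) + v * ((real l + 1) / h) = (v - c) * ((real l + 1) / h)"
        by (simp only: left_diff_distrib)
      then show ?thesis by simp
    qed
    then show ?thesis unfolding s_def poly_pcompose by (simp add: mult.commute)
  qed
  have s_deg: "degree (s j) \<le> l" if "j \<le> l" for j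
    using degree_lagrange_basis[OF that] degree_pcompose_le[of "lagrange_basis l j" "[:- c * ((real l + 1) / h), (real l + 1) / h:]"]
    by (auto simp: s_def split: if_splits)
  define q where "q = (\<lambda>z. \<Sum>j\<le>l. (case z of (x, v) \<Rightarrow> poly (p j) x * poly (s j) v))"
  have "q \<in> tensor_polys l" unfolding q_def
    by (intro tensor_polys_sum tensor_polys_product p s_deg) auto
  moreover have "\<bar>w (x, v) - q (x, v)\<bar> \<le> approx_const l * C * h ^ (l + 1)"
    if x: "a \<le> x" "x < a + h" and v: "c \<le> v" "v < c + h" for x v
  proof -
    have 1: "\<bar>w (x, v) - (\<Sum>j\<le>l. w (x, c + k * real j) * poly (s j) v)\<bar> \<le> (1 + (real l + 1) ^ (l + 1)) * C * h ^ (l + 1)"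
      unfolding k_def s using w h v unfolding line_regular_def by (intro interpolation_error) auto
    have "\<bar>(\<Sum>j\<le>l. w (x, c + k * real j) * poly (s j) v) - q (x, v)\<bar>
       \<le> (\<Sum>j\<le>l. \<bar>(w (x, c + k * real j) - poly (p j) x) * poly (s j) v\<bar>)"
      unfolding q_def case_prod_conv sum_subtractf[symmetric] left_diff_distrib by (rule sum_abs)
    also have "\<dots> \<le> (\<Sum>j\<le>l. C * h ^ (l + 1) * (real l + 1) ^ l)"
    proof (rule sum_mono)
      fix j assume j: "j \<in> {..l}"
      have "\<bar>w (x, c + k * real j) - poly (p j) x\<bar> \<le> C * h ^ (l + 1)"
        using p(2)[OF x(1), of j] by (rule order_trans)
          (use x C h in \<open>auto intro!: mult_left_mono power_mono simp del: power_Suc\<close>)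
      moreover have "\<bar>poly (s j) v\<bar> \<le> (real l + 1) ^ l"
        unfolding s using j v h by (intro lagrange_basis_bound rescaled_range) auto
      ultimately show "\<bar>(w (x, c + k * real j) - poly (p j) x) * poly (s j) v\<bar> \<le> C * h ^ (l + 1) * (real l + 1) ^ l"
        unfolding abs_mult by (intro mult_mono) auto
    qed
    also have "\<dots> = (real l + 1) ^ (l + 1) * C * h ^ (l + 1)" by (simp add: algebra_simps)
    finally have 2: "\<bar>(\<Sum>j\<le>l. w (x, c + k * real j) * poly (s j) v) - q (x, v)\<bar> \<le> (real l + 1) ^ (l + 1) * C * h ^ (l + 1)" .
    have "approx_const l * C * h ^ (l + 1) = (1 + (real l + 1) ^ (l + 1)) * C * h ^ (l + 1) + (real l + 1) ^ (l + 1) * C * h ^ (l + 1)"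
      unfolding approx_const_def by (simp add: algebra_simps)
    then show ?thesis using 1 2 by linarith
  qed
  ultimately show ?thesis
    unfolding half_open_box_def by (intro bexI[of _ q] ballI) (auto simp del: power_Suc)
qed

section \<open>The grid and the global projection\<close>

lemma grid_cell_exists:
  assumes "0 < h" "0 \<le> x" "x < real N * h"
  shows "\<exists>i<N. real i * h \<le> x \<and> x < real (i + 1) * h"
proof -
  define i where "i = nat \<lfloor>x / h\<rfloor>"
  have i: "real i \<le> x / h" "x / h < real i + 1"
    unfolding i_def using assms by auto
  then have "real i * h \<le> x" "x < (real i + 1) * h" using assms by (auto simp: field_simps)
  moreover from this assms have "real i * h < real N * h" by linarith
  then have "real i < real N" using assms(1) by simp
  ultimately show ?thesis by (auto intro!: exI[of _ i] simp: add.commute)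
qed

lemma grid_cell_unique:
  assumes "0 < h" "real i * h \<le> x" "x < real (i + 1) * h" "real i' * h \<le> x" "x < real (i' + 1) * h"
  shows "i = i'"
proof -
  have "real i * h < real (i' + 1) * h" "real i' * h < real (i + 1) * h" using assms by linarith+
  then have "real i < real (i' + 1)" "real i' < real (i + 1)" using assms(1) by (simp_all add: mult_less_cancel_right)
  then show ?thesis by linarith
qed

text \<open>The half-open cells miss the edges x = L and v = vmax of the closed strip.\<close>

lemma AE_fst_snd_neq:
  "AE z in (lborel :: (real \<times> real) measure). fst z \<noteq> L \<and> snd z \<noteq> c"
proof -
  have "{L} \<times> UNIV \<in> null_sets (lborel :: (real \<times> real) measure)" "UNIV \<times> {c} \<in> null_sets (lborel :: (real \<times> real) measure)"
    unfolding lborel_prod[symmetric] null_sets_def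
    by (auto simp: lborel.emeasure_pair_measure_Times)
  from AE_not_in[OF this(1)] AE_not_in[OF this(2)] show ?thesis
    by eventually_elim auto
qed

locale dg_grid =
  fixes L vmax h :: real and Nx Nv l :: nat
  assumes L: "0 < L" and vmax: "0 < vmax" and h: "0 < h"
    and Nx: "real Nx * h = L" and Nv: "real Nv * h = 2 * vmax"
begin

abbreviation "cell ij \<equiv> dg_cell vmax h (fst ij) (snd ij)"
abbreviation "cells \<equiv> {..<Nx} \<times> {..<Nv}"
abbreviation "P \<equiv> dg_proj L vmax l h Nx Nv"

lemma cell_eq_box: "dg_cell vmax h i j =
   half_open_box (real i * h) (real (i + 1) * h) (real j * h - vmax) (real (j + 1) * h - vmax)"
  unfolding dg_cell_def half_open_box_def ..

lemma cell_box: "dg_box (real i * h) (real (i + 1) * h) (real j * h - vmax) (real (j + 1) * h - vmax)"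
  by unfold_locales (use h in \<open>auto simp: algebra_simps\<close>)

lemma cell_sets [measurable]: "dg_cell vmax h i j \<in> sets borel"
  unfolding cell_eq_box by simp

lemma emeasure_cell: "emeasure lborel (dg_cell vmax h i j) = ennreal (h\<^sup>2)"
  unfolding cell_eq_box using h
  by (subst emeasure_half_open_box) (auto simp: algebra_simps power2_eq_square)

lemma cell_exists:
  assumes "0 \<le> x" "x < L" "- vmax \<le> v" "v < vmax"
  obtains ij where "ij \<in> cells" "(x, v) \<in> cell ij"
proof -
  obtain i where i: "i < Nx" "real i * h \<le> x" "x < real (i + 1) * h"
    using grid_cell_exists[OF h, of x Nx] assms Nx by auto
  obtain j where j: "j < Nv" "real j * h \<le> v + vmax" "v + vmax < real (j + 1) * h"
    using grid_cell_exists[OF h, of "v + vmax" Nv] assms Nv by auto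
  show ?thesis
    by (rule that[of "(i, j)"]) (use i j in \<open>auto simp: dg_cell_def\<close>)
qed

lemma cell_unique: "z \<in> cell ij \<Longrightarrow> z \<in> cell ij' \<Longrightarrow> ij = ij'"
  unfolding dg_cell_def using h
  by (auto simp: prod_eq_iff intro: grid_cell_unique[of h _ "fst z"] grid_cell_unique[of h _ "snd z + vmax"])

lemma cell_bounds:
  assumes "(x, v) \<in> cell ij" "ij \<in> cells"
  shows "0 \<le> x" "x < L" "- vmax \<le> v" "v < vmax"
proof -
  have "real (fst ij + 1) * h \<le> real Nx * h" "real (snd ij + 1) * h \<le> real Nv * h"
    using assms h by (auto intro!: mult_right_mono)
  moreover have "0 \<le> real (fst ij) * h" "0 \<le> real (snd ij) * h" using h by auto
  ultimately show "0 \<le> x" "x < L" "- vmax \<le> v" "v < vmax"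
    using assms(1) Nx Nv unfolding dg_cell_def by auto
qed

text \<open>The value type is general because such sums occur with real and with extended
  non-negative values.\<close>

lemma sum_indicator_cells:
  assumes "z \<in> cell ij" "ij \<in> cells"
  shows "(\<Sum>p\<in>cells. indicator (cell p) z * F p) = (F ij :: 'a :: semiring_1)"
proof -
  have "(\<Sum>p\<in>cells. indicator (cell p) z * F p) = (\<Sum>p\<in>cells. if p = ij then F p else 0)"
    using assms cell_unique[of z] by (intro sum.cong) (auto simp: indicator_def)
  then show ?thesis using assms by (simp add: sum.delta)
qed

lemma sum_indicator_outside:
  assumes "\<And>p. p \<in> cells \<Longrightarrow> z \<notin> cell p"
  shows "(\<Sum>p\<in>cells. indicator (cell p) z * F p) = (0 :: 'a :: semiring_1)"
  using assms by (intro sum.neutral) (auto simp: indicator_def)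

lemma P_eq_sum: "P g (x, v) = (\<Sum>p\<in>cells. indicator (cell p) (wrap L x, v) * L2_proj l (cell p) g (wrap L x, v))"
  unfolding dg_proj_def prod.case sum.cartesian_product split_beta fst_conv snd_conv ..

lemma P_on_cell:
  assumes "z \<in> cell ij" "ij \<in> cells"
  shows "P g z = L2_proj l (cell ij) g z"
proof -
  obtain x v where z: "z = (x, v)" by (cases z)
  have "wrap L x = x" using cell_bounds[of x v ij] assms z by (intro wrap_id) auto
  then show ?thesis using sum_indicator_cells[OF assms] by (simp add: z P_eq_sum)
qed

lemma P_outside:
  assumes "v < - vmax \<or> vmax \<le> v"
  shows "P g (x, v) = 0"
  unfolding P_eq_sum
proof (rule sum_indicator_outside, rule notI)
  fix p assume "p \<in> cells" "(wrap L x, v) \<in> cell p"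
  from cell_bounds(3,4)[OF this(2,1)] assms show False by linarith
qed

lemma v_supported_P: "v_supported vmax (P g)"
  unfolding v_supported_def
proof (intro allI impI)
  fix x v assume "vmax < \<bar>v\<bar>"
  then show "P g (x, v) = 0" by (intro P_outside) linarith
qed

text \<open>Bounded because finitely many polynomials are involved, each evaluated only on its own
  cell.\<close>

lemma admissible_P:
  assumes g: "admissible L g"
  shows "admissible L (P g)"
proof -
  have T: "L2_proj l (cell p) g \<in> tensor_polys l" for p
    unfolding cell_eq_box by (rule dg_box.L2_proj_orthogonal(1)[OF cell_box admissible_cell_bounded[OF g]])
  then have "L2_proj l (cell p) g \<in> cell_bounded (cell p)" for p
    unfolding cell_eq_box by (rule dg_box.tensor_polys_cell_bounded[OF cell_box])
  then have "\<forall>p. \<exists>B. \<forall>z\<in>cell p. \<bar>L2_proj l (cell p) g z\<bar> \<le> B"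
    unfolding cell_bounded_def by blast
  then obtain B where B: "\<And>p z. z \<in> cell p \<Longrightarrow> \<bar>L2_proj l (cell p) g z\<bar> \<le> B p" by metis
  have [measurable]: "L2_proj l (cell p) g \<in> borel_measurable borel" for p
    using tensor_polys_continuous[OF T] by (rule borel_measurable_continuous_onI)
  have "(\<lambda>z. P g (fst z, snd z)) \<in> borel_measurable borel"
    unfolding P_eq_sum by measurable
  moreover have "x_periodic L (P g)"
    unfolding x_periodic_def P_eq_sum using L by (simp add: wrap_periodic)
  moreover have "\<bar>P g z\<bar> \<le> (\<Sum>p\<in>cells. \<bar>B p\<bar>)" for z
  proof -
    obtain x v where z: "z = (x, v)" by (cases z)
    show ?thesis unfolding z P_eq_sum
    proof (intro order_trans[OF sum_abs] sum_mono)
      fix p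
      show "\<bar>indicator (cell p) (wrap L x, v) * L2_proj l (cell p) g (wrap L x, v)\<bar> \<le> \<bar>B p\<bar>"
        using B[of "(wrap L x, v)" p] by (auto simp: indicator_def)
    qed
  qed
  ultimately show ?thesis unfolding admissible_def using v_supported_P[of g] by auto
qed

lemma cell_integral_nonneg: "0 \<le> (LINT z:cell p|lborel. (u z :: real)\<^sup>2)"
  unfolding cell_eq_box by (rule dg_box.integral_square_nonneg[OF cell_box])

lemma sum_cell_integrals:
  assumes u: "admissible L u"
  shows "ennreal (\<Sum>p\<in>cells. LINT z:cell p|lborel. (u z)\<^sup>2)
     = (\<integral>\<^sup>+z. ennreal ((u z)\<^sup>2) * indicator ({0..<L} \<times> {-vmax..<vmax}) z \<partial>lborel)"
proof -
  have [measurable]: "u \<in> borel_measurable borel" using u by (rule admissible_measurable)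
  have cb: "(\<lambda>z. (u z)\<^sup>2) \<in> cell_bounded Q" for Q
    using cell_bounded_mult[OF admissible_cell_bounded[OF u] admissible_cell_bounded[OF u]]
    by (simp add: power2_eq_square)
  have "ennreal (\<Sum>p\<in>cells. LINT z:cell p|lborel. (u z)\<^sup>2) = (\<Sum>p\<in>cells. ennreal (LINT z:cell p|lborel. (u z)\<^sup>2))"
    by (subst sum_ennreal) (rule cell_integral_nonneg, rule refl)
  also have "\<dots> = (\<Sum>p\<in>cells. \<integral>\<^sup>+z. ennreal ((u z)\<^sup>2) * indicator (cell p) z \<partial>lborel)"
  proof (rule sum.cong[OF refl])
    fix p
    have "set_integrable lborel (cell p) (\<lambda>z. (u z)\<^sup>2)"
      unfolding cell_eq_box by (rule dg_box.set_integrable_Q[OF cell_box cb])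
    then have "ennreal (LINT z:cell p|lborel. (u z)\<^sup>2) = (\<integral>\<^sup>+z. ennreal (indicator (cell p) z *\<^sub>R (u z)\<^sup>2) \<partial>lborel)"
      unfolding set_integrable_def set_lebesgue_integral_def by (subst nn_integral_eq_integral) auto
    then show "ennreal (LINT z:cell p|lborel. (u z)\<^sup>2) = (\<integral>\<^sup>+z. ennreal ((u z)\<^sup>2) * indicator (cell p) z \<partial>lborel)"
      by (simp add: ennreal_mult ennreal_indicator mult.commute)
  qed
  also have "\<dots> = (\<integral>\<^sup>+z. (\<Sum>p\<in>cells. ennreal ((u z)\<^sup>2) * indicator (cell p) z) \<partial>lborel)"
    by (subst nn_integral_sum) auto
  also have "\<dots> = (\<integral>\<^sup>+z. ennreal ((u z)\<^sup>2) * indicator ({0..<L} \<times> {-vmax..<vmax}) z \<partial>lborel)"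
  proof (rule nn_integral_cong)
    fix z :: "real \<times> real"
    obtain x v where z: "z = (x, v)" by (cases z)
    show "(\<Sum>p\<in>cells. ennreal ((u z)\<^sup>2) * indicator (cell p) z) = ennreal ((u z)\<^sup>2) * indicator ({0..<L} \<times> {-vmax..<vmax}) z"
    proof (cases "z \<in> {0..<L} \<times> {-vmax..<vmax}")
      case True
      then obtain ij where "ij \<in> cells" "z \<in> cell ij" using cell_exists[of x v] z by auto
      then show ?thesis using True sum_indicator_cells[of z ij "\<lambda>_. ennreal ((u z)\<^sup>2)"] by (simp add: mult.commute)
    next
      case False
      have "z \<in> {0..<L} \<times> {-vmax..<vmax}" if "p \<in> cells" "z \<in> cell p" for p
        using cell_bounds[of x v p] that unfolding z by auto
      with False have "\<And>p. p \<in> cells \<Longrightarrow> z \<notin> cell p" by blast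
      then show ?thesis using False sum_indicator_outside[of z "\<lambda>_. ennreal ((u z)\<^sup>2)"] by (simp add: mult.commute)
    qed
  qed
  finally show ?thesis .
qed

lemma sum_cell_integrals_nonneg: "0 \<le> (\<Sum>p\<in>cells. LINT z:cell p|lborel. (u z :: real)\<^sup>2)"
  by (intro sum_nonneg cell_integral_nonneg)

lemma sum_cell_integrals_le:
  assumes u: "admissible L u"
  shows "(\<Sum>p\<in>cells. LINT z:cell p|lborel. (u z)\<^sup>2) \<le> (l2_norm L u)\<^sup>2"
proof -
  have "ennreal (\<Sum>p\<in>cells. LINT z:cell p|lborel. (u z)\<^sup>2) \<le> ennreal ((l2_norm L u)\<^sup>2)"
    unfolding sum_cell_integrals[OF u] ennreal_l2_norm_sq[OF u L]
    by (intro nn_integral_mono) (auto simp: torus_def split: split_indicator)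
  then show ?thesis by simp
qed

lemma sum_cell_integrals_eq:
  assumes u: "admissible L u" and supp: "v_supported vmax u"
  shows "(\<Sum>p\<in>cells. LINT z:cell p|lborel. (u z)\<^sup>2) = (l2_norm L u)\<^sup>2"
proof -
  have "ennreal (\<Sum>p\<in>cells. LINT z:cell p|lborel. (u z)\<^sup>2) = ennreal ((l2_norm L u)\<^sup>2)"
    unfolding sum_cell_integrals[OF u] ennreal_l2_norm_sq[OF u L]
  proof (rule nn_integral_cong_AE)
    show "AE z in lborel. ennreal ((u z)\<^sup>2) * indicator ({0..<L} \<times> {-vmax..<vmax}) z = ennreal ((u z)\<^sup>2) * indicator (torus L) z"
      using AE_fst_snd_neq[of L vmax]
    proof eventually_elim
      case (elim z)
      have "u z = 0" if "\<not> (- vmax \<le> snd z \<and> snd z \<le> vmax)"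
        using supp that unfolding v_supported_def by (cases z) (auto simp: abs_le_iff abs_less_iff not_le)
      with elim show ?case by (cases z) (auto simp: torus_def split: split_indicator)
    qed
  qed
  then show ?thesis using sum_cell_integrals_nonneg[of u] by simp
qed

text \<open>Cellwise contraction, summed. The projected difference is supported in the strip, so its
  cell integrals add up exactly to its squared norm; \<open>u - w\<close> may leave the strip, and
  its cell integrals give a lower bound.\<close>

lemma P_contraction:
  assumes u: "admissible L u" and w: "admissible L w"
  shows "l2_norm L (\<lambda>z. P u z - P w z) \<le> l2_norm L (\<lambda>z. u z - w z)"
proof -
  have "(l2_norm L (\<lambda>z. P u z - P w z))\<^sup>2 = (\<Sum>p\<in>cells. LINT z:cell p|lborel. (P u z - P w z)\<^sup>2)"
    by (rule sum_cell_integrals_eq[symmetric])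
       (use v_supported_P in \<open>auto intro!: admissible_diff admissible_P u w simp: v_supported_def\<close>)
  also have "\<dots> = (\<Sum>p\<in>cells. LINT z:cell p|lborel. (L2_proj l (cell p) u z - L2_proj l (cell p) w z)\<^sup>2)"
    by (intro sum.cong refl set_lebesgue_integral_cong) (auto simp: P_on_cell)
  also have "\<dots> \<le> (\<Sum>p\<in>cells. LINT z:cell p|lborel. (u z - w z)\<^sup>2)"
    unfolding cell_eq_box
    by (intro sum_mono dg_box.L2_proj_contraction[OF cell_box] admissible_cell_bounded[OF u] admissible_cell_bounded[OF w])
  also have "\<dots> \<le> (l2_norm L (\<lambda>z. u z - w z))\<^sup>2"
    by (intro sum_cell_integrals_le admissible_diff u w)
  finally show ?thesis by (rule power2_le_imp_le) (rule l2_norm_nonneg)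
qed

text \<open>Smoothness is asked of \<open>w'\<close>, which has to be close to \<open>w\<close>
  merely in the norm: with q approximating \<open>w'\<close> on a cell, the square of w - q is at
  most twice that of w - w' plus twice that of w' - q. This form survives passage to a limit. The
  factor 4 * vmax * L is twice the area of the strip.\<close>

lemma P_approximation:
  assumes w: "admissible L w" "v_supported vmax w" and w': "admissible L w'" "line_regular (Suc l) C w'"
  shows "(l2_norm L (\<lambda>z. P w z - w z))\<^sup>2
     \<le> 2 * (l2_norm L (\<lambda>z. w z - w' z))\<^sup>2 + 4 * vmax * L * (approx_const l * C * h ^ (l + 1))\<^sup>2"
proof -
  define \<epsilon> where "\<epsilon> = approx_const l * C * h ^ (l + 1)"
  have sw: "L2_proj l (cell p) w \<in> tensor_polys l" for p
    unfolding cell_eq_box by (rule dg_box.L2_proj_orthogonal(1)[OF cell_box admissible_cell_bounded[OF w(1)]])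
  have one: "(LINT z:cell p|lborel. (P w z - w z)\<^sup>2) \<le> 2 * (LINT z:cell p|lborel. (w z - w' z)\<^sup>2) + 2 * \<epsilon>\<^sup>2 * h\<^sup>2"
    if p: "p \<in> cells" for p
  proof -
    have e: "real (fst p + 1) * h = real (fst p) * h + h" "real (snd p + 1) * h - vmax = real (snd p) * h - vmax + h"
      by (auto simp: algebra_simps)
    have "\<exists>q\<in>tensor_polys l. \<forall>z\<in>cell p. \<bar>w' z - q z\<bar> \<le> \<epsilon>"
      unfolding cell_eq_box e \<epsilon>_def by (rule tensor_polys_approximation[OF w'(2) h])
    then obtain q where q: "q \<in> tensor_polys l" "\<And>z. z \<in> cell p \<Longrightarrow> \<bar>w' z - q z\<bar> \<le> \<epsilon>"
      by blast
    have qb: "q \<in> cell_bounded (cell p)"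
      unfolding cell_eq_box by (rule dg_box.tensor_polys_cell_bounded[OF cell_box q(1)])
    have sq: "(\<lambda>z. (f z)\<^sup>2) \<in> cell_bounded Q" if "f \<in> cell_bounded Q" for f Q
      using cell_bounded_mult[OF that that] by (simp add: power2_eq_square)
    have si: "set_integrable lborel (cell p) f" if "f \<in> cell_bounded (cell p)" for f
      using that unfolding cell_eq_box by (rule dg_box.set_integrable_Q[OF cell_box])
    have cst: "set_integrable lborel (cell p) (\<lambda>z. c)" for c :: real
      by (rule si) (auto simp: cell_bounded_def)
    note wb = admissible_cell_bounded[OF w(1)] admissible_cell_bounded[OF w'(1)]
    have "(LINT z:cell p|lborel. (P w z - w z)\<^sup>2) = (LINT z:cell p|lborel. (w z - L2_proj l (cell p) w z)\<^sup>2)"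
      using p by (intro set_lebesgue_integral_cong) (auto simp: P_on_cell power2_commute)
    also have "\<dots> \<le> (LINT z:cell p|lborel. (w z - q z)\<^sup>2)"
      using wb(1)[of "cell p"] q(1) unfolding cell_eq_box by (rule dg_box.L2_proj_best[OF cell_box])
    also have "\<dots> \<le> (LINT z:cell p|lborel. 2 * (w z - w' z)\<^sup>2 + 2 * \<epsilon>\<^sup>2)"
    proof (rule set_integral_mono)
      show "set_integrable lborel (cell p) (\<lambda>z. (w z - q z)\<^sup>2)"
        by (intro si sq cell_bounded_diff wb qb)
      show "set_integrable lborel (cell p) (\<lambda>z. 2 * (w z - w' z)\<^sup>2 + 2 * \<epsilon>\<^sup>2)"
        by (intro set_integral_add(1) set_integrable_mult_right si sq cell_bounded_diff wb cst)
      fix z assume z: "z \<in> cell p"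
      have "(w' z - q z)\<^sup>2 \<le> \<epsilon>\<^sup>2"
        using q(2)[OF z] by (rule abs_le_square_iff[THEN iffD1, OF order_trans]) simp
      moreover have "(w z - q z)\<^sup>2 \<le> 2 * (w z - w' z)\<^sup>2 + 2 * (w' z - q z)\<^sup>2"
        using zero_le_power2[of "(w z - w' z) - (w' z - q z)"] by (simp add: power2_eq_square algebra_simps)
      ultimately show "(w z - q z)\<^sup>2 \<le> 2 * (w z - w' z)\<^sup>2 + 2 * \<epsilon>\<^sup>2" by linarith
    qed
    also have "\<dots> = 2 * (LINT z:cell p|lborel. (w z - w' z)\<^sup>2) + (LINT z:cell p|lborel. 2 * \<epsilon>\<^sup>2)"
      by (subst set_integral_add(2)) (auto intro!: set_integrable_mult_right si sq cell_bounded_diff wb cst)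
    also have "(LINT z:cell p|lborel. 2 * \<epsilon>\<^sup>2) = 2 * \<epsilon>\<^sup>2 * h\<^sup>2"
      unfolding set_lebesgue_integral_def by (simp add: measure_def emeasure_cell)
    finally show ?thesis .
  qed
  have "(l2_norm L (\<lambda>z. P w z - w z))\<^sup>2 = (\<Sum>p\<in>cells. LINT z:cell p|lborel. (P w z - w z)\<^sup>2)"
    by (rule sum_cell_integrals_eq[symmetric])
       (use v_supported_P[of w] w in \<open>auto intro!: admissible_diff admissible_P simp: v_supported_def\<close>)
  also have "\<dots> \<le> (\<Sum>p\<in>cells. 2 * (LINT z:cell p|lborel. (w z - w' z)\<^sup>2) + 2 * \<epsilon>\<^sup>2 * h\<^sup>2)"
    by (intro sum_mono one)
  also have "\<dots> = 2 * (\<Sum>p\<in>cells. LINT z:cell p|lborel. (w z - w' z)\<^sup>2) + real (Nx * Nv) * (2 * \<epsilon>\<^sup>2 * h\<^sup>2)"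
    by (simp add: sum.distrib sum_distrib_left card_cartesian_product)
  also have "real (Nx * Nv) * (2 * \<epsilon>\<^sup>2 * h\<^sup>2) = 2 * \<epsilon>\<^sup>2 * (real Nx * h) * (real Nv * h)"
    by (simp add: power2_eq_square)
  also have "\<dots> = 4 * vmax * L * \<epsilon>\<^sup>2" unfolding Nx Nv by simp
  also have "(\<Sum>p\<in>cells. LINT z:cell p|lborel. (w z - w' z)\<^sup>2) \<le> (l2_norm L (\<lambda>z. w z - w' z))\<^sup>2"
    by (intro sum_cell_integrals_le admissible_diff w w')
  finally show ?thesis unfolding \<epsilon>_def by simp
qed

end

section \<open>The electric field and the stability of one splitting step\<close>

lemma admissible_zero: "admissible L (\<lambda>z. 0)"
  unfolding admissible_def x_periodic_def v_supported_def by auto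

lemma density_integrable:
  assumes "admissible L g"
  shows "integrable lborel (\<lambda>v. g (x, v))"
proof -
  note [measurable] = admissible_measurable[OF assms]
  obtain B R where B: "\<And>z. \<bar>g z\<bar> \<le> B" and R: "v_supported R g"
    using assms unfolding admissible_def by blast
  have "integrable lborel (\<lambda>v. indicator {- \<bar>R\<bar>..\<bar>R\<bar>} v *\<^sub>R B)"
    by (simp add: integrable_mult_left)
  then show ?thesis
  proof (rule Bochner_Integration.integrable_bound)
    show "AE v in lborel. norm (g (x, v)) \<le> norm (indicator {- \<bar>R\<bar>..\<bar>R\<bar>} v *\<^sub>R B)"
    proof (intro AE_I2)
      fix v
      have "\<bar>v\<bar> > \<bar>R\<bar> \<Longrightarrow> g (x, v) = 0" using R unfolding v_supported_def by auto
      then show "norm (g (x, v)) \<le> norm (indicator {- \<bar>R\<bar>..\<bar>R\<bar>} v *\<^sub>R B)"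
        using B[of "(x, v)"] by (auto split: split_indicator)
    qed
  qed measurable
qed

lemma density_bound:
  assumes g: "admissible L g" and R: "v_supported R g" "0 \<le> R" and B: "\<And>v. \<bar>g (x, v)\<bar> \<le> B"
  shows "\<bar>LINT v|lborel. g (x, v)\<bar> \<le> 2 * R * B"
proof -
  have B0: "0 \<le> B" using B[of 0] by linarith
  have "norm (LINT v|lborel. g (x, v)) \<le> (LINT v|lborel. B * indicator {- R..R} v)"
  proof (rule Bochner_Integration.integral_norm_bound_integral[OF density_integrable[OF g]])
    show "norm (g (x, v)) \<le> B * indicator {- R..R} v" for v
      using B[of v] R unfolding v_supported_def by (auto split: split_indicator)
  next
    show "integrable lborel (\<lambda>v. B * indicat_real {- R..R} v)"
      by (intro integrable_mult_right integrable_real_indicator) (auto simp: emeasure_lborel_Icc_eq)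
  qed
  also have "\<dots> = 2 * R * B" using R by simp
  finally show ?thesis by simp
qed

lemma poisson_kernel_bound:
  assumes "0 < L" "0 \<le> y" "y \<le> L"
  shows "\<bar>poisson_kernel L x y\<bar> \<le> 1"
  using assms unfolding poisson_kernel_def by (auto simp: abs_if field_simps)

lemma poisson_kernel_measurable [measurable]:
  "(\<lambda>y. poisson_kernel L x y) \<in> borel_measurable borel"
  unfolding poisson_kernel_def by measurable

lemma E_field_integrable:
  assumes g: "admissible L g" and L: "0 < L"
  shows "set_integrable lborel {0..L} (\<lambda>y. poisson_kernel L x y * ((LINT v|lborel. g (y, v)) - 1))"
proof -
  note [measurable] = admissible_measurable[OF g]
  have [measurable]: "g \<in> borel_measurable (lborel \<Otimes>\<^sub>M lborel)"
    using admissible_measurable[OF g] by (simp add: lborel_prod)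
  obtain B R where B: "\<And>z. \<bar>g z\<bar> \<le> B" and R: "v_supported R g"
    using g unfolding admissible_def by blast
  have R': "v_supported \<bar>R\<bar> g" using R by (rule v_supported_mono) simp
  have b: "\<bar>LINT v|lborel. g (y, v)\<bar> \<le> 2 * \<bar>R\<bar> * B" for y
    by (rule density_bound[OF g R' _ B]) simp
  have "set_integrable lborel {0..L} (\<lambda>y. 2 * \<bar>R\<bar> * B + 1)"
    using L by (simp add: set_integrable_def integrable_mult_left)
  then show ?thesis
  proof (rule set_integrable_bound)
    show "set_borel_measurable lborel {0..L} (\<lambda>y. poisson_kernel L x y * ((LINT v|lborel. g (y, v)) - 1))"
      unfolding set_borel_measurable_def by measurable
    show "AE y in lborel. y \<in> {0..L} \<longrightarrow> norm (poisson_kernel L x y * ((LINT v|lborel. g (y, v)) - 1)) \<le> norm (2 * \<bar>R\<bar> * B + 1)"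
    proof (intro AE_I2 impI)
      fix y assume "y \<in> {0..L}"
      then have "\<bar>poisson_kernel L x y\<bar> * \<bar>(LINT v|lborel. g (y, v)) - 1\<bar> \<le> 1 * (2 * \<bar>R\<bar> * B + 1)"
        using b[of y] L by (intro mult_mono poisson_kernel_bound) auto
      then show "norm (poisson_kernel L x y * ((LINT v|lborel. g (y, v)) - 1)) \<le> norm (2 * \<bar>R\<bar> * B + 1)"
        by (simp add: abs_mult)
    qed
  qed
qed

lemma E_field_diff:
  assumes a: "admissible L a" and b: "admissible L b" and L: "0 < L"
  shows "E_field L a x - E_field L b x =
    (LINT y:{0..L}|lborel. poisson_kernel L (wrap L x) y * (LINT v|lborel. a (y, v) - b (y, v)))"
    and "set_integrable lborel {0..L} (\<lambda>y. poisson_kernel L (wrap L x) y * (LINT v|lborel. a (y, v) - b (y, v)))"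
proof -
  have e: "(LINT v|lborel. a (y, v) - b (y, v)) = (LINT v|lborel. a (y, v)) - (LINT v|lborel. b (y, v))" for y
    by (rule Bochner_Integration.integral_diff[OF density_integrable[OF a] density_integrable[OF b]])
  have e': "poisson_kernel L (wrap L x) y * (LINT v|lborel. a (y, v) - b (y, v)) =
    poisson_kernel L (wrap L x) y * ((LINT v|lborel. a (y, v)) - 1) - poisson_kernel L (wrap L x) y * ((LINT v|lborel. b (y, v)) - 1)" for y
    unfolding e by (simp add: algebra_simps)
  note i = E_field_integrable[OF a L, of "wrap L x"] E_field_integrable[OF b L, of "wrap L x"]
  show "E_field L a x - E_field L b x =
    (LINT y:{0..L}|lborel. poisson_kernel L (wrap L x) y * (LINT v|lborel. a (y, v) - b (y, v)))"
    unfolding E_field_def e' by (rule set_integral_diff(2)[OF i, symmetric])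
  show "set_integrable lborel {0..L} (\<lambda>y. poisson_kernel L (wrap L x) y * (LINT v|lborel. a (y, v) - b (y, v)))"
    unfolding e' by (rule set_integral_diff(1)[OF i])
qed

lemma E_field_diff_density:
  assumes a: "admissible L a" and b: "admissible L b" and L: "0 < L"
    and d: "\<And>y. \<bar>(LINT v|lborel. a (y, v)) - (LINT v|lborel. b (y, v))\<bar> \<le> d"
  shows "\<bar>E_field L a x - E_field L b x\<bar> \<le> L * d"
proof -
  have d0: "0 \<le> d" using d[of 0] by linarith
  have e: "(LINT v|lborel. a (y, v) - b (y, v)) = (LINT v|lborel. a (y, v)) - (LINT v|lborel. b (y, v))" for y
    by (rule Bochner_Integration.integral_diff[OF density_integrable[OF a] density_integrable[OF b]])
  have "norm (LINT y:{0..L}|lborel. poisson_kernel L (wrap L x) y * (LINT v|lborel. a (y, v) - b (y, v)))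
     \<le> (LINT y:{0..L}|lborel. d)"
    unfolding set_lebesgue_integral_def
  proof (rule Bochner_Integration.integral_norm_bound_integral)
    show "integrable lborel (\<lambda>y. indicat_real {0..L} y *\<^sub>R (poisson_kernel L (wrap L x) y * (LINT v|lborel. a (y, v) - b (y, v))))"
      using E_field_diff(2)[OF a b L, of x] unfolding set_integrable_def .
    fix y
    show "norm (indicat_real {0..L} y *\<^sub>R (poisson_kernel L (wrap L x) y * (LINT v|lborel. a (y, v) - b (y, v))))
         \<le> indicat_real {0..L} y *\<^sub>R d"
    proof (cases "y \<in> {0..L}")
      case True
      then have "\<bar>poisson_kernel L (wrap L x) y\<bar> * \<bar>LINT v|lborel. a (y, v) - b (y, v)\<bar> \<le> 1 * d"
        using d[of y] L unfolding e by (intro mult_mono poisson_kernel_bound) auto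
      then show ?thesis using True by (simp add: abs_mult)
    qed simp
  qed (use L in \<open>simp add: integrable_mult_left\<close>)
  also have "\<dots> = L * d" unfolding set_lebesgue_integral_def using L by simp
  finally show ?thesis unfolding E_field_diff(1)[OF a b L] by simp
qed

text \<open>The kernel is bounded by 1, so the field is controlled uniformly in x by the L1 distance
  in phase space.\<close>

lemma ennreal_E_field_diff_L1:
  assumes a: "admissible L a" and b: "admissible L b" and L: "0 < L"
  shows "ennreal \<bar>E_field L a x - E_field L b x\<bar> \<le> (\<integral>\<^sup>+z. ennreal \<bar>a z - b z\<bar> * indicator (torus L) z \<partial>lborel)"
proof -
  note [measurable] = admissible_measurable[OF a] admissible_measurable[OF b]
  have "ennreal (norm (LINT y:{0..L}|lborel. poisson_kernel L (wrap L x) y * (LINT v|lborel. a (y, v) - b (y, v))))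
    \<le> (\<integral>\<^sup>+y. ennreal (norm (indicat_real {0..L} y *\<^sub>R (poisson_kernel L (wrap L x) y * (LINT v|lborel. a (y, v) - b (y, v))))) \<partial>lborel)"
    unfolding set_lebesgue_integral_def
    by (rule integral_norm_bound_ennreal) (use E_field_diff(2)[OF a b L, of x] in \<open>simp add: set_integrable_def\<close>)
  also have "\<dots> \<le> (\<integral>\<^sup>+y. (\<integral>\<^sup>+v. ennreal \<bar>a (y, v) - b (y, v)\<bar> * indicator {0..L} y \<partial>lborel) \<partial>lborel)"
  proof (rule nn_integral_mono)
    fix y
    show "ennreal (norm (indicat_real {0..L} y *\<^sub>R (poisson_kernel L (wrap L x) y * (LINT v|lborel. a (y, v) - b (y, v)))))
      \<le> (\<integral>\<^sup>+v. ennreal \<bar>a (y, v) - b (y, v)\<bar> * indicator {0..L} y \<partial>lborel)"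
    proof (cases "y \<in> {0..L}")
      case True
      have "\<bar>poisson_kernel L (wrap L x) y\<bar> * \<bar>LINT v|lborel. a (y, v) - b (y, v)\<bar> \<le> 1 * \<bar>LINT v|lborel. a (y, v) - b (y, v)\<bar>"
        using True L by (intro mult_right_mono poisson_kernel_bound) auto
      then have "ennreal (\<bar>poisson_kernel L (wrap L x) y\<bar> * \<bar>LINT v|lborel. a (y, v) - b (y, v)\<bar>) \<le> ennreal (norm (LINT v|lborel. a (y, v) - b (y, v)))"
        by (intro ennreal_leI) simp
      also have "\<dots> \<le> (\<integral>\<^sup>+v. ennreal (norm (a (y, v) - b (y, v))) \<partial>lborel)"
        by (intro integral_norm_bound_ennreal Bochner_Integration.integrable_diff density_integrable[OF a] density_integrable[OF b])
      finally show ?thesis using True by (simp add: abs_mult)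
    qed simp
  qed
  also have "\<dots> = (\<integral>\<^sup>+z. ennreal \<bar>a z - b z\<bar> * indicator (torus L) z \<partial>lborel)"
    by (subst nn_integral_lborel_fst) (auto simp: torus_def indicator_times)
  finally show ?thesis unfolding E_field_diff(1)[OF a b L] by simp
qed

text \<open>Cauchy-Schwarz against the indicator of the strip of measure 2RL.\<close>

lemma L1_le_l2_norm:
  assumes d: "admissible L d" and R: "v_supported R d" "0 \<le> R" and L: "0 < L"
  shows "(\<integral>\<^sup>+z. ennreal \<bar>d z\<bar> * indicator (torus L) z \<partial>lborel) \<le> ennreal (sqrt (2 * R * L) * l2_norm L d)"
    (is "?I \<le> ennreal ?c")
proof -
  note [measurable] = admissible_measurable[OF d]
  have [measurable]: "{z::real\<times>real. \<bar>snd z\<bar> \<le> R} \<in> sets borel" by measurable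
  have "?I\<^sup>2 = (\<integral>\<^sup>+z. (ennreal \<bar>d z\<bar> * indicator (torus L) z) * (indicator {z. \<bar>snd z\<bar> \<le> R} z * indicator (torus L) z) \<partial>lborel)\<^sup>2"
  proof (intro arg_cong[where f="\<lambda>x. x\<^sup>2"] nn_integral_cong)
    fix z
    have "\<bar>snd z\<bar> > R \<Longrightarrow> d z = 0" using R unfolding v_supported_def by (cases z) auto
    then show "ennreal \<bar>d z\<bar> * indicator (torus L) z =
       (ennreal \<bar>d z\<bar> * indicator (torus L) z) * (indicator {z. \<bar>snd z\<bar> \<le> R} z * indicator (torus L) z)"
      by (auto split: split_indicator)
  qed
  also have "\<dots> \<le> (\<integral>\<^sup>+z. (ennreal \<bar>d z\<bar> * indicator (torus L) z)\<^sup>2 \<partial>lborel) *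
      (\<integral>\<^sup>+z. (indicator {z. \<bar>snd z\<bar> \<le> R} z * indicator (torus L) z)\<^sup>2 \<partial>lborel)"
    by (rule Cauchy_Schwarz_nn_integral) auto
  also have "(\<integral>\<^sup>+z. (ennreal \<bar>d z\<bar> * indicator (torus L) z)\<^sup>2 \<partial>lborel) = ennreal ((l2_norm L d)\<^sup>2)"
    unfolding ennreal_l2_norm_sq[OF d L]
    by (rule nn_integral_cong) (auto simp: ennreal_power split: split_indicator)
  also have "(\<integral>\<^sup>+z. (indicator {z. \<bar>snd z\<bar> \<le> R} z * indicator (torus L) z)\<^sup>2 \<partial>lborel) = ennreal (2 * R * L)"
    using L R by (subst nn_integral_strip[of L R, symmetric]) (auto intro!: nn_integral_cong split: split_indicator)
  finally have sq: "?I\<^sup>2 \<le> ennreal (?c\<^sup>2)"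
    using L R by (simp add: ennreal_mult[symmetric] power_mult_distrib mult.commute)
  have c: "0 \<le> ?c" using L R l2_norm_nonneg by simp
  show ?thesis
  proof (cases ?I)
    case (real r)
    then have "r\<^sup>2 \<le> ?c\<^sup>2" using sq by (simp add: ennreal_power)
    then have "r \<le> ?c" using c by (rule power2_le_imp_le)
    then show ?thesis using real by (simp add: ennreal_leI)
  next
    case top
    then show ?thesis using sq by (simp add: ennreal_power top_unique)
  qed
qed

lemma v_supported_diff: "v_supported R a \<Longrightarrow> v_supported R b \<Longrightarrow> v_supported R (\<lambda>z. a z - b z)"
  unfolding v_supported_def by auto

lemma E_field_diff_l2:
  assumes a: "admissible L a" "v_supported R a" and b: "admissible L b" "v_supported R b"
    and L: "0 < L" and R: "0 \<le> R"
  shows "\<bar>E_field L a x - E_field L b x\<bar> \<le> sqrt (2 * R * L) * l2_norm L (\<lambda>z. a z - b z)"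
proof -
  have "ennreal \<bar>E_field L a x - E_field L b x\<bar> \<le> ennreal (sqrt (2 * R * L) * l2_norm L (\<lambda>z. a z - b z))"
    by (rule order_trans[OF ennreal_E_field_diff_L1 L1_le_l2_norm])
       (use assms in \<open>auto intro: admissible_diff v_supported_diff\<close>)
  then show ?thesis using L R by (simp add: l2_norm_nonneg)
qed

text \<open>\<open>E_field\<close> is affine rather than linear in the density; its value at 0 is
  the field of the neutralizing background, and other fields are bounded by comparison with
  it.\<close>

lemma E_field_zero_bound:
  assumes L: "0 < L"
  shows "\<bar>E_field L (\<lambda>z. 0) x\<bar> \<le> L"
proof -
  have "norm (LINT y:{0..L}|lborel. poisson_kernel L (wrap L x) y * ((LINT v|(lborel :: real measure). (0::real)) - 1))
      \<le> (LINT y:{0..L}|lborel. 1)"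
    unfolding set_lebesgue_integral_def
  proof (rule Bochner_Integration.integral_norm_bound_integral)
    show "integrable lborel (\<lambda>y. indicat_real {0..L} y *\<^sub>R (poisson_kernel L (wrap L x) y * ((LINT v|(lborel :: real measure). (0::real)) - 1)))"
      using E_field_integrable[OF admissible_zero L, of "wrap L x"] unfolding set_integrable_def .
    show "norm (indicat_real {0..L} y *\<^sub>R (poisson_kernel L (wrap L x) y * ((LINT v|(lborel :: real measure). (0::real)) - 1)))
      \<le> indicat_real {0..L} y *\<^sub>R 1" for y
      using L poisson_kernel_bound[of L y "wrap L x"] by (auto split: split_indicator)
  qed (use L in simp)
  also have "\<dots> = L" unfolding set_lebesgue_integral_def using L by simp
  finally show ?thesis unfolding E_field_def by simp
qed

lemma E_field_L1_bound:
  assumes a: "admissible L a" and L: "0 < L" and "0 \<le> m"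
    and m: "(\<integral>\<^sup>+z. ennreal \<bar>a z\<bar> * indicator (torus L) z \<partial>lborel) \<le> ennreal m"
  shows "\<bar>E_field L a x\<bar> \<le> m + L"
proof -
  have "ennreal \<bar>E_field L a x - E_field L (\<lambda>z. 0) x\<bar> \<le> ennreal m"
    using order_trans[OF ennreal_E_field_diff_L1[OF a admissible_zero L, of x]] m by simp
  then have "\<bar>E_field L a x - E_field L (\<lambda>z. 0) x\<bar> \<le> m" using \<open>0 \<le> m\<close> by simp
  then show ?thesis using E_field_zero_bound[OF L, of x] by linarith
qed

lemma E_field_bounded:
  assumes a: "admissible L a" and L: "0 < L"
  shows "\<exists>m. \<forall>x. \<bar>E_field L a x\<bar> \<le> m"
proof -
  obtain R where R: "v_supported R a" using a unfolding admissible_def by blast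
  have "v_supported \<bar>R\<bar> a" using R by (rule v_supported_mono) simp
  from E_field_L1_bound[OF a L _ L1_le_l2_norm[OF a this _ L]] show ?thesis
    using L l2_norm_nonneg by (intro exI allI) auto
qed

lemma v_supported_exp_B:
  assumes "v_supported R g" "\<And>x. \<bar>s * E_field L g0 x\<bar> \<le> m"
  shows "v_supported (R + m) (exp_B L s g0 g)"
  unfolding v_supported_def exp_B_def
proof (intro allI impI, simp)
  fix x v assume "R + m < \<bar>v\<bar>"
  then have "R < \<bar>v - s * E_field L g0 x\<bar>" using assms(2)[of x] by linarith
  then show "g (x, v - s * E_field L g0 x) = 0" using assms(1) unfolding v_supported_def by blast
qed

lemma admissible_exp_B:
  assumes g0: "admissible L g0" and g: "admissible L g" and L: "0 < L"
  shows "admissible L (exp_B L s g0 g)"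
proof -
  note [measurable] = admissible_measurable[OF g0] admissible_measurable[OF g]
  obtain B R where B: "\<And>z. \<bar>g z\<bar> \<le> B" and R: "v_supported R g"
    using g unfolding admissible_def by blast
  obtain m where m: "\<And>x. \<bar>E_field L g0 x\<bar> \<le> m" using E_field_bounded[OF g0 L] by blast
  have "v_supported (R + \<bar>s\<bar> * m) (exp_B L s g0 g)"
    by (rule v_supported_exp_B[OF R]) (simp add: abs_mult mult_left_mono m)
  moreover have "\<forall>z. \<bar>exp_B L s g0 g z\<bar> \<le> B" using B unfolding exp_B_def by auto
  moreover have "x_periodic L (exp_B L s g0 g)"
    using x_periodic_exp_B[OF L] g unfolding admissible_def by blast
  ultimately show ?thesis unfolding admissible_def by auto
qed

section \<open>Stability of one step\<close>

text \<open>The first root converts an L2 distance into a field difference. The second is the root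
  of the total measure of two sheared strips, each of measure 2RL, that carry the effect of a change
  of field.\<close>

definition stability_const :: "real \<Rightarrow> real \<Rightarrow> real" where
  "stability_const L R = sqrt (2 * R * L) * sqrt (4 * R * L)"

text \<open>\<open>d1\<close> transports \<open>a - b\<close> and keeps its norm. \<open>d2\<close>
  compares values of \<open>b\<close> at two velocities that differ by \<tau> times the field
  difference, so its size is controlled by K.\<close>

lemma exp_B_stability:
  assumes a: "admissible L a" "v_supported R a" and b: "admissible L b" "v_supported R b"
    and L: "0 < L" and R: "0 \<le> R" and \<tau>: "0 \<le> \<tau>" and K: "0 \<le> K"
    and lip: "\<And>x v w. \<bar>b (x, v) - b (x, w)\<bar> \<le> K * \<bar>v - w\<bar>"
  shows "l2_norm L (\<lambda>z. exp_B L \<tau> a a z - exp_B L \<tau> b b z)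
      \<le> (1 + \<tau> * (K * stability_const L R)) * l2_norm L (\<lambda>z. a z - b z)"
proof -
  note [measurable] = admissible_measurable[OF a(1)] admissible_measurable[OF b(1)]
  let ?\<delta> = "l2_norm L (\<lambda>z. a z - b z)"
  define \<Delta> where "\<Delta> = sqrt (2 * R * L) * ?\<delta>"
  have \<Delta>: "\<bar>E_field L a x - E_field L b x\<bar> \<le> \<Delta>" for x
    unfolding \<Delta>_def by (rule E_field_diff_l2[OF a b L R])
  have \<Delta>0: "0 \<le> \<Delta>" using order_trans[OF abs_ge_zero \<Delta>] .
  define d1 where "d1 = exp_B L \<tau> a (\<lambda>z. a z - b z)"
  define d2 where "d2 = (\<lambda>z. exp_B L \<tau> a b z - exp_B L \<tau> b b z)"
  have ad1: "admissible L d1" unfolding d1_def by (intro admissible_exp_B a admissible_diff b L)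
  have ad2: "admissible L d2" unfolding d2_def by (intro admissible_exp_B a admissible_diff b L)
  have n1: "l2_norm L d1 = ?\<delta>" unfolding d1_def by (rule l2_norm_exp_B) measurable
  have "l2_norm L d2 \<le> (K * \<tau> * \<Delta>) * sqrt (4 * R * L)"
  proof (rule l2_norm_le_nn_integral)
    show "0 \<le> (K * \<tau> * \<Delta>) * sqrt (4 * R * L)" using K \<tau> \<Delta>0 L R by simp
    show [measurable]: "d2 \<in> borel_measurable borel" by (rule admissible_measurable[OF ad2])
    have [measurable]: "{z::real\<times>real. \<bar>snd z\<bar> \<le> R} \<in> sets borel" by measurable
    \<comment> \<open>Indicator of the strip sheared by the field of \<open>g\<close>.
      \<open>d2\<close> vanishes outside the union of the two sheared strips, and shears preserve
      area.\<close>
    define s where "s g z = (indicator {z. \<bar>snd z\<bar> \<le> R} (fst z, snd z - \<tau> * E_field L g (fst z)) :: ennreal)" for g and z :: "real \<times> real"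
    have [measurable]: "s a \<in> borel_measurable borel" "s b \<in> borel_measurable borel"
      unfolding s_def by measurable
    have s_int: "(\<integral>\<^sup>+z. s g z * indicator (torus L) z \<partial>lborel) = ennreal (2 * R * L)" if "admissible L g" for g
    proof -
      note [measurable] = admissible_measurable[OF that]
      show ?thesis
        unfolding s_def using L R
        by (subst nn_integral_exp_B[where e="\<lambda>x. \<tau> * E_field L g x"]) (simp_all add: nn_integral_strip)
    qed
    have "ennreal ((d2 z)\<^sup>2) * indicator (torus L) z
      \<le> ennreal ((K * \<tau> * \<Delta>)\<^sup>2) * (s a z * indicator (torus L) z + s b z * indicator (torus L) z)" for z
    proof -
      obtain x v where z: "z = (x, v)" by (cases z)
      have "\<bar>d2 z\<bar> \<le> K * \<bar>(v - \<tau> * E_field L a x) - (v - \<tau> * E_field L b x)\<bar>"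
        unfolding d2_def exp_B_def z prod.case by (rule lip)
      also have "\<bar>(v - \<tau> * E_field L a x) - (v - \<tau> * E_field L b x)\<bar> = \<tau> * \<bar>E_field L a x - E_field L b x\<bar>"
      proof -
        have "(v - \<tau> * E_field L a x) - (v - \<tau> * E_field L b x) = \<tau> * (E_field L b x - E_field L a x)"
          by (simp add: algebra_simps)
        then show ?thesis using \<tau> by (simp add: abs_mult abs_minus_commute)
      qed
      also have "K * (\<tau> * \<bar>E_field L a x - E_field L b x\<bar>) \<le> K * (\<tau> * \<Delta>)"
        by (intro mult_left_mono \<Delta> \<tau> K)
      finally have "\<bar>d2 z\<bar> \<le> K * \<tau> * \<Delta>" by (simp add: mult.assoc)
      then have le: "(d2 z)\<^sup>2 \<le> (K * \<tau> * \<Delta>)\<^sup>2"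
        by (rule abs_le_square_iff[THEN iffD1, OF order_trans]) simp
      have "d2 z = 0" if "\<not> \<bar>v - \<tau> * E_field L a x\<bar> \<le> R" "\<not> \<bar>v - \<tau> * E_field L b x\<bar> \<le> R"
        using that b(2) unfolding d2_def exp_B_def z v_supported_def by simp
      then show ?thesis
        using le ennreal_leI[OF le] by (auto simp: s_def z distrib_left split: split_indicator intro: add_increasing2)
    qed
    then have "(\<integral>\<^sup>+z. ennreal ((d2 z)\<^sup>2) * indicator (torus L) z \<partial>lborel) \<le>
      (\<integral>\<^sup>+z. ennreal ((K * \<tau> * \<Delta>)\<^sup>2) * (s a z * indicator (torus L) z + s b z * indicator (torus L) z) \<partial>lborel)"
      by (rule nn_integral_mono)
    also have "\<dots> = ennreal ((K * \<tau> * \<Delta>)\<^sup>2) * (ennreal (2 * R * L) + ennreal (2 * R * L))"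
      by (subst nn_integral_cmult, simp, subst nn_integral_add) (simp_all add: s_int a b)
    also have "\<dots> = ennreal (((K * \<tau> * \<Delta>) * sqrt (4 * R * L))\<^sup>2)"
    proof -
      have "ennreal (2 * R * L) + ennreal (2 * R * L) = ennreal (4 * R * L)"
        using L R by (subst ennreal_plus[symmetric]) simp_all
      moreover have "((K * \<tau> * \<Delta>) * sqrt (4 * R * L))\<^sup>2 = (K * \<tau> * \<Delta>)\<^sup>2 * (4 * R * L)"
        using L R by (simp only: power_mult_distrib[of _ "sqrt (4 * R * L)"]) simp
      ultimately show ?thesis using L R by (simp only: ennreal_mult[symmetric] zero_le_power2) (simp add: ennreal_mult)
    qed
    finally show "(\<integral>\<^sup>+z. ennreal ((d2 z)\<^sup>2) * indicator (torus L) z \<partial>lborel) \<le> ennreal (((K * \<tau> * \<Delta>) * sqrt (4 * R * L))\<^sup>2)" .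
  qed
  also have "(K * \<tau> * \<Delta>) * sqrt (4 * R * L) = \<tau> * (K * stability_const L R) * ?\<delta>"
    unfolding \<Delta>_def stability_const_def by simp
  finally have n2: "l2_norm L d2 \<le> \<tau> * (K * stability_const L R) * ?\<delta>" .
  have "l2_norm L (\<lambda>z. exp_B L \<tau> a a z - exp_B L \<tau> b b z) \<le> l2_norm L d1 + l2_norm L d2"
  proof (rule l2_norm_triangle[OF ad1 ad2 L])
    fix z
    have "exp_B L \<tau> a a z - exp_B L \<tau> b b z = d1 z + d2 z"
      unfolding d1_def d2_def exp_B_def by (simp add: split_beta)
    then show "\<bar>exp_B L \<tau> a a z - exp_B L \<tau> b b z\<bar> \<le> \<bar>d1 z\<bar> + \<bar>d2 z\<bar>" by linarith
  qed measurable
  also have "\<dots> \<le> (1 + \<tau> * (K * stability_const L R)) * ?\<delta>"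
    using n1 n2 by (simp add: distrib_right)
  finally show ?thesis .
qed

lemma l2_norm_exp_A_diff:
  assumes a: "admissible L a" and b: "admissible L b" and L: "0 < L"
  shows "l2_norm L (\<lambda>z. exp_A s a z - exp_A s b z) = l2_norm L (\<lambda>z. a z - b z)"
proof -
  have "(\<lambda>z. exp_A s a z - exp_A s b z) = exp_A s (\<lambda>z. a z - b z)"
    unfolding exp_A_def by (simp add: fun_eq_iff)
  then show ?thesis
    using l2_norm_exp_A[OF L, of "\<lambda>z. a z - b z"] admissible_diff[OF a b] unfolding admissible_def by simp
qed

lemma l2_norm_diff_triangle:
  assumes "admissible L a" "admissible L b" "admissible L c" "0 < L"
  shows "l2_norm L (\<lambda>z. a z - c z) \<le> l2_norm L (\<lambda>z. a z - b z) + l2_norm L (\<lambda>z. b z - c z)"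
proof (rule l2_norm_triangle)
  show "\<bar>a z - c z\<bar> \<le> \<bar>a z - b z\<bar> + \<bar>b z - c z\<bar>" for z by linarith
qed (use assms in \<open>auto intro!: admissible_diff admissible_measurable[of L]\<close>)

text \<open>Every projection is moved to the exact side by P w - w' = (P w - P w') + (P w' - w').
  The first of the three errors precedes the nonlinear substep and is amplified together with the
  old error; the other two enter with factor 1.\<close>

lemma strang_step_error:
  fixes P :: "phase_fun \<Rightarrow> phase_fun"
  assumes L: "0 < L" and R: "0 \<le> R" and \<tau>: "0 \<le> \<tau>" and K: "0 \<le> K"
    and P: "\<And>u. admissible L u \<Longrightarrow> admissible L (P u)"
    and contr: "\<And>u w. admissible L u \<Longrightarrow> admissible L w \<Longrightarrow>
        l2_norm L (\<lambda>z. P u z - P w z) \<le> l2_norm L (\<lambda>z. u z - w z)"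
    and g: "admissible L g" "v_supported R (S_A P \<tau> g)"
    and f: "admissible L f" "v_supported R f"
    and lip: "\<And>x v w. \<bar>exp_A (\<tau> / 2) f (x, v) - exp_A (\<tau> / 2) f (x, w)\<bar> \<le> K * \<bar>v - w\<bar>"
    and b_def: "b = exp_B L \<tau> (exp_A (\<tau> / 2) f) (exp_A (\<tau> / 2) f)" and c_def: "c = exp_A (\<tau> / 2) b"
    and \<epsilon>: "l2_norm L (\<lambda>z. P (exp_A (\<tau> / 2) f) z - exp_A (\<tau> / 2) f z) \<le> \<epsilon>"
      "l2_norm L (\<lambda>z. P b z - b z) \<le> \<epsilon>" "l2_norm L (\<lambda>z. P c z - c z) \<le> \<epsilon>"
  shows "admissible L (S_strang P L \<tau> g g)"
    and "l2_norm L (\<lambda>z. S_strang P L \<tau> g g z - c z)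
      \<le> (1 + \<tau> * (K * stability_const L R)) * (l2_norm L (\<lambda>z. g z - f z) + \<epsilon>) + 2 * \<epsilon>"
proof -
  define a where "a = exp_A (\<tau> / 2) f"
  define a' where "a' = S_A P \<tau> g"
  define u where "u = exp_B L \<tau> a' a'"
  have a: "admissible L a" "v_supported R a" unfolding a_def
    using f by (auto intro: admissible_exp_A v_supported_exp_A)
  have a': "admissible L a'" unfolding a'_def S_A_def by (intro P admissible_exp_A g)
  have b: "admissible L b" unfolding b_def a_def[symmetric] by (intro admissible_exp_B a L)
  have c: "admissible L c" unfolding c_def by (intro admissible_exp_A b)
  have u: "admissible L u" unfolding u_def by (intro admissible_exp_B a' L)
  have S: "S_strang P L \<tau> g g = P (exp_A (\<tau> / 2) (P u))"
    unfolding S_strang_def S_B_def u_def a'_def S_A_def ..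
  show "admissible L (S_strang P L \<tau> g g)" unfolding S by (intro P admissible_exp_A u)
  have triangle: "l2_norm L (\<lambda>z. P w z - w' z) \<le> l2_norm L (\<lambda>z. w z - w' z) + \<epsilon>"
    if w: "admissible L w" "admissible L w'" and e: "l2_norm L (\<lambda>z. P w' z - w' z) \<le> \<epsilon>" for w w'
    using l2_norm_diff_triangle[OF P[OF w(1)] P[OF w(2)] w(2) L] contr[OF w] e by linarith
  have 1: "l2_norm L (\<lambda>z. a' z - a z) \<le> l2_norm L (\<lambda>z. g z - f z) + \<epsilon>"
    using triangle[OF admissible_exp_A[OF g(1), of "\<tau> / 2"] a(1)] \<epsilon>(1) l2_norm_exp_A_diff[OF g(1) f(1) L, of "\<tau> / 2"]
    by (simp add: a'_def a_def S_A_def)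
  have 2: "l2_norm L (\<lambda>z. u z - b z) \<le> (1 + \<tau> * (K * stability_const L R)) * l2_norm L (\<lambda>z. a' z - a z)"
    unfolding u_def b_def a_def[symmetric]
    by (rule exp_B_stability[OF a' _ a L R \<tau> K]) (use g(2) lip in \<open>auto simp: a'_def a_def\<close>)
  have 3: "l2_norm L (\<lambda>z. P u z - b z) \<le> l2_norm L (\<lambda>z. u z - b z) + \<epsilon>"
    by (rule triangle[OF u b \<epsilon>(2)])
  have 4: "l2_norm L (\<lambda>z. S_strang P L \<tau> g g z - c z) \<le> l2_norm L (\<lambda>z. P u z - b z) + \<epsilon>"
    using triangle[OF admissible_exp_A[OF P[OF u], of "\<tau> / 2"] c \<epsilon>(3)] l2_norm_exp_A_diff[OF P[OF u] b L, of "\<tau> / 2"]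
    unfolding S c_def by simp
  have "0 \<le> stability_const L R" using L R unfolding stability_const_def by simp
  then have "(1 + \<tau> * (K * stability_const L R)) * l2_norm L (\<lambda>z. a' z - a z)
     \<le> (1 + \<tau> * (K * stability_const L R)) * (l2_norm L (\<lambda>z. g z - f z) + \<epsilon>)"
    using \<tau> K by (intro mult_left_mono 1) simp
  with 2 3 4 show "l2_norm L (\<lambda>z. S_strang P L \<tau> g g z - c z)
      \<le> (1 + \<tau> * (K * stability_const L R)) * (l2_norm L (\<lambda>z. g z - f z) + \<epsilon>) + 2 * \<epsilon>" by linarith
qed

text \<open>Rests on 1 + k <= exp k; the increment d is put under the exponential, which is at least
  1.\<close>

lemma discrete_gronwall:
  fixes e :: "nat \<Rightarrow> real"
  assumes "0 \<le> k" "0 \<le> d" and step: "\<And>n. n < N \<Longrightarrow> e (Suc n) \<le> (1 + k) * e n + d" and "n \<le> N" "0 \<le> e 0"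
  shows "e n \<le> exp (k * real n) * (e 0 + real n * d)"
  using \<open>n \<le> N\<close>
proof (induction n)
  case (Suc n)
  have "e (Suc n) \<le> (1 + k) * e n + d" using Suc by (intro step) simp
  also have "(1 + k) * e n \<le> exp k * (exp (k * real n) * (e 0 + real n * d))"
  proof -
    have "(1 + k) * e n \<le> (1 + k) * (exp (k * real n) * (e 0 + real n * d))"
      using Suc assms(1) by (intro mult_left_mono) auto
    also have "\<dots> \<le> exp k * (exp (k * real n) * (e 0 + real n * d))"
      using assms exp_ge_add_one_self[of k] by (intro mult_right_mono) auto
    finally show ?thesis .
  qed
  finally have "e (Suc n) \<le> exp k * (exp (k * real n) * (e 0 + real n * d)) + d" by simp
  moreover have "exp k * exp (k * real n) = exp (k * real (Suc n))"
    by (simp add: exp_add[symmetric] algebra_simps)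
  moreover have "1 * d \<le> exp (k * real (Suc n)) * d"
    using assms by (intro mult_right_mono) auto
  ultimately have "e (Suc n) \<le> exp (k * real (Suc n)) * (e 0 + real n * d) + exp (k * real (Suc n)) * d"
    by (simp only: mult.assoc[symmetric])
  also have "\<dots> = exp (k * real (Suc n)) * (e 0 + real (Suc n) * d)"
    by (simp only: distrib_left[symmetric] of_nat_Suc distrib_right mult_1_left add.assoc add.commute[of d])
  finally show ?case .
qed simp

section \<open>The local error of the splitting\<close>

text \<open>Mean value inequality after subtraction of a linear function: c = 0 gives Lipschitz
  bounds, a reference slope c gives second order expansions.\<close>

lemma derivative_approx:
  fixes g g' :: "real \<Rightarrow> real"
  assumes "convex S" "\<And>s. s \<in> S \<Longrightarrow> (g has_real_derivative g' s) (at s within S)"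
    and "\<And>s. s \<in> S \<Longrightarrow> \<bar>g' s - c\<bar> \<le> k" and "a \<in> S" "b \<in> S"
  shows "\<bar>g b - g a - c * (b - a)\<bar> \<le> k * \<bar>b - a\<bar>"
proof -
  have "norm ((g b - c * b) - (g a - c * a)) \<le> k * norm (b - a)"
    using assms by (intro field_differentiable_bound[of S "\<lambda>s. g s - c * s" "\<lambda>s. g' s - c"])
      (auto intro!: derivative_eq_intros)
  then show ?thesis by (simp add: algebra_simps)
qed

text \<open>The kernel is y / L - 1 plus the indicator of y < x. Hence the dependence on x sits in a
  single primitive.\<close>

lemma E_field_eq_integrals:
  assumes g: "admissible L g" and L: "0 < L"
    and r: "\<And>y. r y = (LINT v|lborel. g (y, v)) - 1" and cont: "continuous_on UNIV r"
    and x: "0 \<le> x" "x < L"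
  shows "E_field L g x = integral {0..x} r + integral {0..L} (\<lambda>y. (y / L - 1) * r y)"
proof -
  have c1: "continuous_on {0..L} (\<lambda>y. (y / L - 1) * r y)"
    using continuous_on_subset[OF cont, of "{0..L}"] L by (intro continuous_intros) auto
  have c2: "continuous_on {0..x} r" using cont by (rule continuous_on_subset) simp
  have s1: "set_integrable lborel {0..L} (\<lambda>y. (y / L - 1) * r y)" by (rule borel_integrable_atLeastAtMost'[OF c1])
  have s2: "set_integrable lborel {0..x} r" by (rule borel_integrable_atLeastAtMost'[OF c2])
  have "E_field L g x = (LINT y|lborel. indicator {0..L} y *\<^sub>R ((y / L - 1) * r y) + indicator {0..x} y *\<^sub>R r y)"
    unfolding E_field_def set_lebesgue_integral_def
  proof (rule integral_cong_AE)
    have [measurable]: "r \<in> borel_measurable borel" using cont by (rule borel_measurable_continuous_onI)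
    show "(\<lambda>y. indicator {0..L} y *\<^sub>R ((y / L - 1) * r y) + indicator {0..x} y *\<^sub>R r y) \<in> borel_measurable lborel"
      by measurable
    show "(\<lambda>y. indicator {0..L} y *\<^sub>R (poisson_kernel L (wrap L x) y * ((LINT v|lborel. g (y, v)) - 1))) \<in> borel_measurable lborel"
      unfolding r[symmetric] by measurable
    show "AE y in lborel. indicator {0..L} y *\<^sub>R (poisson_kernel L (wrap L x) y * ((LINT v|lborel. g (y, v)) - 1))
        = indicator {0..L} y *\<^sub>R ((y / L - 1) * r y) + indicator {0..x} y *\<^sub>R r y"
      using AE_lborel_singleton[of x]
      by eventually_elim
        (use x in \<open>auto simp: r[symmetric] poisson_kernel_def wrap_id algebra_simps split: split_indicator\<close>)
  qed
  also have "\<dots> = integral {0..L} (\<lambda>y. (y / L - 1) * r y) + integral {0..x} r"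
    using set_borel_integral_eq_integral(2)[OF s1] set_borel_integral_eq_integral(2)[OF s2] s1 s2
    unfolding set_lebesgue_integral_def set_integrable_def by (subst Bochner_Integration.integral_add) auto
  finally show ?thesis by simp
qed

text \<open>Passage from the Lebesgue integral over the line to the gauge integral over an interval,
  to which the fundamental theorem and the Leibniz rule apply.\<close>

lemma density_eq_integral:
  fixes g :: phase_fun
  assumes "continuous_on UNIV (\<lambda>v. g (y, v))" and supp: "\<And>v. R \<le> \<bar>v\<bar> \<Longrightarrow> g (y, v) = (0::real)" and "0 \<le> R"
  shows "(LINT v|lborel. g (y, v)) = integral {-R..R} (\<lambda>v. g (y, v))"
proof -
  have "continuous_on {-R..R} (\<lambda>v. g (y, v))" using assms(1) by (rule continuous_on_subset) simp
  note s = borel_integrable_atLeastAtMost'[OF this]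
  have "(LINT v|lborel. g (y, v)) = (LINT v:{-R..R}|lborel. g (y, v))"
    unfolding set_lebesgue_integral_def
  proof (rule Bochner_Integration.integral_cong[OF refl])
    fix v show "g (y, v) = indicator {-R..R} v *\<^sub>R g (y, v)"
      using supp[of v] by (cases "v \<in> {-R..R}") auto
  qed
  then show ?thesis using set_borel_integral_eq_integral(2)[OF s] by simp
qed

lemma continuous_on_Pair_left: "continuous_on S (Pair t)"
  using continuous_on_Pair[OF continuous_on_const[of S t] continuous_on_id[of S]] by simp

lemma integral_bound_interval:
  fixes g :: "real \<Rightarrow> real"
  assumes "(g has_integral i) {a..b}" "\<And>v. v \<in> {a..b} \<Longrightarrow> \<bar>g v\<bar> \<le> B" "a \<le> b"
  shows "\<bar>i\<bar> \<le> (b - a) * B"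
proof -
  have "0 \<le> B" using assms(2)[of a] assms(3) by auto
  from has_integral_bound_real[OF this finite.emptyI assms(1)] assms(2,3) show ?thesis
    by (simp add: mult.commute)
qed

section \<open>Regularity of the exact density, current and field\<close>

text \<open>Vanishing is required already at |v| = R, so that the boundary terms at v = R and v = -
  R disappear in integrations over v. This is why \<open>vmax + 1\<close> takes the place of R
  later.\<close>

locale vp_data =
  fixes L T R M :: real and f ft fx fv :: "real \<Rightarrow> phase_fun"
  assumes L: "0 < L" and T: "0 < T" and R: "0 < R"
    and periodic: "t \<in> {0..T} \<Longrightarrow> x_periodic L (f t)"
    and supp: "t \<in> {0..T} \<Longrightarrow> R \<le> \<bar>v\<bar> \<Longrightarrow> f t (x, v) = 0"
    and cont_t: "continuous_on ({0..T} \<times> UNIV) (\<lambda>(t, z). ft t z)"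
    and cont_x: "continuous_on ({0..T} \<times> UNIV) (\<lambda>(t, z). fx t z)"
    and cont_v: "continuous_on ({0..T} \<times> UNIV) (\<lambda>(t, z). fv t z)"
    and deriv_t: "t \<in> {0..T} \<Longrightarrow> ((\<lambda>s. f s (x, v)) has_real_derivative ft t (x, v)) (at t within {0..T})"
    and deriv_x: "t \<in> {0..T} \<Longrightarrow> ((\<lambda>y. f t (y, v)) has_real_derivative fx t (x, v)) (at x)"
    and deriv_v: "t \<in> {0..T} \<Longrightarrow> ((\<lambda>w. f t (x, w)) has_real_derivative fv t (x, v)) (at v)"
    and vlasov: "t \<in> {0..T} \<Longrightarrow> ft t (x, v) = - v * fx t (x, v) - E_field L (f t) x * fv t (x, v)"
    and field: "t \<in> {0..T} \<Longrightarrow> (E_field L (f t) has_real_derivative (LINT v|lborel. f t (x, v)) - 1) (at x)"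
    and bound: "t \<in> {0..T} \<Longrightarrow> \<bar>f t z\<bar> \<le> M" "t \<in> {0..T} \<Longrightarrow> \<bar>ft t z\<bar> \<le> M"
      "t \<in> {0..T} \<Longrightarrow> \<bar>fx t z\<bar> \<le> M" "t \<in> {0..T} \<Longrightarrow> \<bar>fv t z\<bar> \<le> M"
begin

abbreviation "E t x \<equiv> E_field L (f t) x"

lemma M0: "0 \<le> M"
  using bound(1)[of 0 "(0, 0)"] T by (auto intro: order_trans[OF abs_ge_zero])

text \<open>Joint differentiability from continuous partial derivatives, in two rounds: x and v at
  fixed time, then time, one-sided at the ends of {0..T}.\<close>

lemma f_has_derivative:
  assumes t: "t \<in> {0..T}"
  shows "((\<lambda>(t, z). f t z) has_derivative
      (\<lambda>(s, z). ft t (x, v) * s + (fx t (x, v) * fst z + fv t (x, v) * snd z))) (at (t, (x, v)) within {0..T} \<times> UNIV)"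
proof -
  define D where "D t z = (blinfun_mult_right (fx t z) o\<^sub>L fst_blinfun) + (blinfun_mult_right (fv t z) o\<^sub>L snd_blinfun)" for t z
  have D: "blinfun_apply (D t z) = (\<lambda>w. fx t z * fst w + fv t z * snd w)" for t z
    by (auto simp: D_def fun_eq_iff blinfun.bilinear_simps)
  have inner: "((\<lambda>z. f s z) has_derivative blinfun_apply (D s z)) (at z within UNIV)" if s: "s \<in> {0..T}" for s z
  proof -
    obtain x v where z: "z = (x, v)" by (cases z)
    have "continuous_on UNIV (fv s)"
      using continuous_on_compose2[OF cont_v continuous_on_Pair_left[of UNIV s]] s by (auto simp: image_subset_iff)
    then have "continuous_on (UNIV \<times> UNIV) (\<lambda>(x, v). blinfun_mult_right (fv s (x, v)))"
      unfolding split_beta prod.collapse by (intro continuous_intros) simp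
    then have "continuous (at (x, v) within UNIV \<times> UNIV) (\<lambda>(x, v). blinfun_mult_right (fv s (x, v)))"
      unfolding continuous_on_eq_continuous_within by (rule bspec) simp
    from has_derivative_partialsI[where f="\<lambda>x v. f s (x, v)" and fx="(*) (fx s (x, v))", OF _ _ this]
    have "((\<lambda>(x, v). f s (x, v)) has_derivative (\<lambda>(tx, ty). fx s (x, v) * tx + blinfun_mult_right (fv s (x, v)) ty)) (at (x, v) within UNIV \<times> UNIV)"
      using deriv_x[OF s] deriv_v[OF s] by (auto simp: has_field_derivative_def)
    then have "(f s has_derivative (\<lambda>(tx, ty). fx s (x, v) * tx + fv s (x, v) * ty)) (at (x, v))" by simp
    then show ?thesis unfolding z by (rule has_derivative_eq_rhs) (auto simp: fun_eq_iff D)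
  qed
  have "continuous_on ({0..T} \<times> UNIV) (\<lambda>(t, z). D t z)"
    using cont_x cont_v unfolding D_def split_beta by (intro continuous_intros) auto
  then have "continuous (at (t, (x, v)) within {0..T} \<times> UNIV) (\<lambda>(t, z). D t z)"
    using t by (auto simp: continuous_on_eq_continuous_within)
  from has_derivative_partialsI[where f=f and fx="(*) (ft t (x, v))" and x=t and y="(x, v)", OF _ inner this]
  show ?thesis
    using deriv_t[OF t, of x v] by (auto simp: has_field_derivative_def D split_beta)
qed

lemma f_continuous: "continuous_on ({0..T} \<times> UNIV) (\<lambda>(t, z). f t z)"
  unfolding continuous_on_eq_continuous_within
proof
  fix p :: "real \<times> real \<times> real" assume p: "p \<in> {0..T} \<times> UNIV"
  obtain t x v where e: "p = (t, (x, v))" by (cases p) auto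
  show "continuous (at p within {0..T} \<times> UNIV) (\<lambda>(t, z). f t z)"
    unfolding e by (rule has_derivative_continuous[OF f_has_derivative]) (use p e in auto)
qed

lemma continuous_compose:
  assumes "continuous_on ({0..T} \<times> UNIV) (\<lambda>(t, z). g t z)" "continuous_on S \<theta>" "continuous_on S X" "continuous_on S V"
    and "\<And>s. s \<in> S \<Longrightarrow> \<theta> s \<in> {0..T}"
  shows "continuous_on S (\<lambda>s. g (\<theta> s) (X s, V s) :: real)"
proof -
  have "continuous_on S (\<lambda>s. (\<theta> s, (X s, V s)))" by (intro continuous_intros assms)
  from continuous_on_compose2[OF assms(1) this] assms(5) show ?thesis by (auto simp: image_subset_iff)
qed

lemma f_chain:
  assumes "(\<theta> has_real_derivative \<theta>') (at s within S)" "(X has_real_derivative X') (at s within S)"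
    "(V has_real_derivative V') (at s within S)" "s \<in> S" "\<And>s. s \<in> S \<Longrightarrow> \<theta> s \<in> {0..T}"
  shows "((\<lambda>s. f (\<theta> s) (X s, V s)) has_real_derivative
     ft (\<theta> s) (X s, V s) * \<theta>' + fx (\<theta> s) (X s, V s) * X' + fv (\<theta> s) (X s, V s) * V') (at s within S)"
proof -
  have "((\<lambda>s. (\<theta> s, (X s, V s))) has_derivative (\<lambda>h. (\<theta>' * h, (X' * h, V' * h)))) (at s within S)"
    using assms(1-3) by (intro has_derivative_Pair) (auto simp: has_field_derivative_def)
  moreover have "((\<lambda>(t, z). f t z) has_derivative
      (\<lambda>(h, z). ft (\<theta> s) (X s, V s) * h + (fx (\<theta> s) (X s, V s) * fst z + fv (\<theta> s) (X s, V s) * snd z)))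
      (at (\<theta> s, (X s, V s)) within (\<lambda>s. (\<theta> s, (X s, V s))) ` S)"
    using f_has_derivative[OF assms(5)[OF assms(4)]]
    by (rule has_derivative_subset) (use assms(5) in auto)
  ultimately have "((\<lambda>s. f (\<theta> s) (X s, V s)) has_derivative
      (\<lambda>h. ft (\<theta> s) (X s, V s) * (\<theta>' * h) + (fx (\<theta> s) (X s, V s) * (X' * h) + fv (\<theta> s) (X s, V s) * (V' * h)))) (at s within S)"
    using has_derivative_in_compose by fastforce
  then show ?thesis
    unfolding has_field_derivative_def by (rule has_derivative_eq_rhs) (auto simp: fun_eq_iff algebra_simps)
qed

lemma f_lipschitz:
  assumes "t \<in> {0..T}" "s \<in> {0..T}"
  shows "\<bar>f t (x, v) - f s (y, w)\<bar> \<le> M * (\<bar>t - s\<bar> + \<bar>x - y\<bar> + \<bar>v - w\<bar>)"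
proof -
  have "\<bar>f t (x, v) - f s (x, v) - 0 * (t - s)\<bar> \<le> M * \<bar>t - s\<bar>"
    by (rule derivative_approx[where S="{0..T}", OF _ deriv_t]) (use assms bound(2) in auto)
  moreover have "\<bar>f s (x, v) - f s (y, v) - 0 * (x - y)\<bar> \<le> M * \<bar>x - y\<bar>"
    by (rule derivative_approx[where S=UNIV, OF _ deriv_x]) (use assms bound(3) in auto)
  moreover have "\<bar>f s (y, v) - f s (y, w) - 0 * (v - w)\<bar> \<le> M * \<bar>v - w\<bar>"
    by (rule derivative_approx[where S=UNIV, OF _ deriv_v]) (use assms bound(4) in auto)
  ultimately show ?thesis unfolding distrib_left by linarith
qed

lemma v_supported_f: "t \<in> {0..T} \<Longrightarrow> v_supported R (f t)"
  unfolding v_supported_def using supp by auto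

lemma f_continuous_space: "t \<in> {0..T} \<Longrightarrow> continuous_on UNIV (f t)"
  using continuous_on_compose2[OF f_continuous continuous_on_Pair_left[of UNIV t]] by (auto simp: image_subset_iff)

lemma admissible_f: "t \<in> {0..T} \<Longrightarrow> admissible L (f t)"
  unfolding admissible_def using periodic v_supported_f bound(1) f_continuous_space
  by (blast intro: borel_measurable_continuous_onI)

definition \<rho> :: "real \<Rightarrow> real \<Rightarrow> real" where "\<rho> t x = integral {-R..R} (\<lambda>v. f t (x, v))"
definition J :: "real \<Rightarrow> real \<Rightarrow> real" where "J t x = integral {-R..R} (\<lambda>v. v * f t (x, v))"
definition D :: "real \<Rightarrow> real \<Rightarrow> real" where "D t x = - J t x + integral {0..L} (J t) / L"

text \<open>\<open>E0\<close> bounds the field (density plus background), \<open>E1\<close> its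
  derivative in x, and \<open>CJ\<close> both the size and the Lipschitz constant of
  \<open>J\<close>.\<close>

definition "E0 = L * (2 * R * M) + L"
definition "E1 = 2 * R * M + 1"
definition "CJ = 2 * R * R * M"

lemma const_nonneg: "0 \<le> E0" "0 \<le> E1" "0 \<le> CJ"
  unfolding E0_def E1_def CJ_def using L R M0 by auto

lemma integral_bound:
  assumes "(g has_integral i) {-R..R}" "\<And>v. v \<in> {-R..R} \<Longrightarrow> \<bar>g v\<bar> \<le> B"
  shows "\<bar>i\<bar> \<le> 2 * R * (B::real)"
  using integral_bound_interval[OF assms] R by simp

lemma integrable_v:
  assumes "t \<in> {0..T}" "continuous_on {-R..R} k"
  shows "(\<lambda>v. k v * f t (x, v)) integrable_on {-R..R}"
  using assms by (intro integrable_continuous_real continuous_intros continuous_compose[OF f_continuous]) auto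

lemma density_f: "t \<in> {0..T} \<Longrightarrow> (LINT v|lborel. f t (x, v)) = \<rho> t x"
  unfolding \<rho>_def
  by (rule density_eq_integral)
     (use supp R in \<open>auto intro!: continuous_compose[OF f_continuous] continuous_intros\<close>)

lemma \<rho>_lipschitz:
  assumes "t \<in> {0..T}" "s \<in> {0..T}"
  shows "\<bar>\<rho> t x - \<rho> s y\<bar> \<le> 2 * R * M * (\<bar>t - s\<bar> + \<bar>x - y\<bar>)"
proof -
  have i: "(\<lambda>v. f t (x, v)) integrable_on {-R..R}" if "t \<in> {0..T}" for t x
    using integrable_v[OF that, of "\<lambda>v. 1"] by simp
  have "\<bar>\<rho> t x - \<rho> s y\<bar> \<le> 2 * R * (M * (\<bar>t - s\<bar> + \<bar>x - y\<bar>))"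
    unfolding \<rho>_def
  proof (rule integral_bound[OF has_integral_diff[OF integrable_integral[OF i] integrable_integral[OF i]]])
    show "\<bar>f t (x, v) - f s (y, v)\<bar> \<le> M * (\<bar>t - s\<bar> + \<bar>x - y\<bar>)" for v
      using f_lipschitz[OF assms, of x v y v] by simp
  qed (use assms in auto)
  then show ?thesis by (simp add: mult.assoc)
qed

lemma J_lipschitz:
  assumes "t \<in> {0..T}" "s \<in> {0..T}"
  shows "\<bar>J t x - J s y\<bar> \<le> CJ * (\<bar>t - s\<bar> + \<bar>x - y\<bar>)"
proof -
  have i: "(\<lambda>v. v * f t (x, v)) integrable_on {-R..R}" if "t \<in> {0..T}" for t x
    using integrable_v[OF that, of "\<lambda>v. v"] by simp
  have "\<bar>J t x - J s y\<bar> \<le> 2 * R * (R * (M * (\<bar>t - s\<bar> + \<bar>x - y\<bar>)))"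
    unfolding J_def
  proof (rule integral_bound[OF has_integral_diff[OF integrable_integral[OF i] integrable_integral[OF i]]])
    fix v assume v: "v \<in> {-R..R}"
    have "\<bar>v\<bar> * \<bar>f t (x, v) - f s (y, v)\<bar> \<le> R * (M * (\<bar>t - s\<bar> + \<bar>x - y\<bar>))"
      using v R f_lipschitz[OF assms, of x v y v] by (intro mult_mono) auto
    then show "\<bar>v * f t (x, v) - v * f s (y, v)\<bar> \<le> R * (M * (\<bar>t - s\<bar> + \<bar>x - y\<bar>))"
      by (simp add: right_diff_distrib[symmetric] abs_mult)
  qed (use assms in auto)
  then show ?thesis by (simp add: CJ_def mult.assoc)
qed

lemma J_bound: "t \<in> {0..T} \<Longrightarrow> \<bar>J t x\<bar> \<le> CJ"
proof -
  assume t: "t \<in> {0..T}"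
  have i: "(\<lambda>v. v * f t (x, v)) integrable_on {-R..R}"
    using integrable_v[OF t, of "\<lambda>v. v"] by simp
  have "\<bar>J t x\<bar> \<le> 2 * R * (R * M)"
    unfolding J_def
  proof (rule integral_bound[OF integrable_integral[OF i]])
    fix v assume "v \<in> {-R..R}"
    then show "\<bar>v * f t (x, v)\<bar> \<le> R * M"
      unfolding abs_mult using bound(1)[OF t, of "(x, v)"] R by (intro mult_mono) auto
  qed
  then show ?thesis by (simp add: CJ_def)
qed

lemma J_continuous: "t \<in> {0..T} \<Longrightarrow> continuous_on S (J t)"
proof -
  assume t: "t \<in> {0..T}"
  have "CJ-lipschitz_on S (J t)"
    using J_lipschitz[OF t t] const_nonneg by (intro lipschitz_onI) (auto simp: dist_real_def)
  then show ?thesis by (rule lipschitz_on_continuous_on)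
qed

lemma \<rho>_continuous: "t \<in> {0..T} \<Longrightarrow> continuous_on S (\<rho> t)"
proof -
  assume t: "t \<in> {0..T}"
  have "(2 * R * M)-lipschitz_on S (\<rho> t)"
    using \<rho>_lipschitz[OF t t] R M0 by (intro lipschitz_onI) (auto simp: dist_real_def)
  then show ?thesis by (rule lipschitz_on_continuous_on)
qed

lemma D_lipschitz:
  assumes "t \<in> {0..T}" "s \<in> {0..T}"
  shows "\<bar>D t x - D s x\<bar> \<le> 2 * CJ * \<bar>t - s\<bar>"
proof -
  have i: "J t integrable_on {0..L}" if "t \<in> {0..T}" for t
    using J_continuous[OF that] by (rule integrable_continuous_real)
  have "\<bar>integral {0..L} (J t) - integral {0..L} (J s)\<bar> \<le> (L - 0) * (CJ * \<bar>t - s\<bar>)"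
  proof (rule integral_bound_interval[OF has_integral_diff[OF integrable_integral[OF i] integrable_integral[OF i]]])
    show "\<bar>J t x - J s x\<bar> \<le> CJ * \<bar>t - s\<bar>" for x
      using J_lipschitz[OF assms, of x x] by simp
  qed (use assms L in auto)
  then have "\<bar>integral {0..L} (J t) / L - integral {0..L} (J s) / L\<bar> \<le> CJ * \<bar>t - s\<bar>"
    unfolding diff_divide_distrib[symmetric] abs_divide using L by (simp add: field_simps)
  then show ?thesis
    using J_lipschitz[OF assms, of x x] unfolding D_def by simp
qed

lemma D_bound: "t \<in> {0..T} \<Longrightarrow> \<bar>D t x\<bar> \<le> 2 * CJ"
proof -
  assume t: "t \<in> {0..T}"
  have "\<bar>integral {0..L} (J t)\<bar> \<le> (L - 0) * CJ"
  proof (rule integral_bound_interval[OF integrable_integral])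
    show "J t integrable_on {0..L}" using J_continuous[OF t] by (rule integrable_continuous_real)
  qed (use J_bound[OF t] L in auto)
  then have "\<bar>integral {0..L} (J t) / L\<bar> \<le> CJ"
    unfolding abs_divide using L by (simp add: field_simps)
  then show ?thesis using J_bound[OF t, of x] unfolding D_def by linarith
qed

lemma \<rho>_bound: "t \<in> {0..T} \<Longrightarrow> \<bar>\<rho> t x\<bar> \<le> 2 * R * M"
  using density_bound[OF admissible_f v_supported_f _ bound(1), of t x] R by (simp add: density_f)

lemma E_bound: "t \<in> {0..T} \<Longrightarrow> \<bar>E t x\<bar> \<le> E0"
proof -
  assume t: "t \<in> {0..T}"
  have "\<bar>E t x - E_field L (\<lambda>z. 0) x\<bar> \<le> L * (2 * R * M)"
    by (rule E_field_diff_density[OF admissible_f[OF t] admissible_zero L])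
       (use \<rho>_bound[OF t] in \<open>simp add: density_f[OF t]\<close>)
  then show ?thesis using E_field_zero_bound[OF L, of x] unfolding E0_def by linarith
qed

lemma E_deriv_x: "t \<in> {0..T} \<Longrightarrow> (E t has_real_derivative \<rho> t x - 1) (at x within S)"
  using field[of t x] density_f[of t x] by (auto intro: has_field_derivative_at_within)

lemma E_deriv_x_bound: "t \<in> {0..T} \<Longrightarrow> \<bar>\<rho> t x - 1\<bar> \<le> E1"
  using \<rho>_bound[of t x] unfolding E1_def by linarith

lemma E_lipschitz_x: "t \<in> {0..T} \<Longrightarrow> \<bar>E t x - E t y\<bar> \<le> E1 * \<bar>x - y\<bar>"
  using derivative_approx[where S=UNIV and g="E t" and c=0, OF _ E_deriv_x] E_deriv_x_bound by simp

lemma J_deriv_x: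
  assumes t: "t \<in> {0..T}"
  shows "(J t has_real_derivative integral {-R..R} (\<lambda>v. v * fx t (x, v))) (at x within S)"
proof -
  have "((\<lambda>x. integral (cbox (-R) R) (\<lambda>v. v * f t (x, v))) has_field_derivative
      integral (cbox (-R) R) (\<lambda>v. v * fx t (x, v))) (at x within UNIV)"
  proof (rule leibniz_rule_field_derivative)
    show "((\<lambda>x. v * f t (x, v)) has_field_derivative v * fx t (x, v)) (at x within UNIV)" for x v
      by (intro DERIV_cmult deriv_x t)
    show "(\<lambda>v. v * f t (x, v)) integrable_on cbox (- R) R" for x
      using integrable_v[OF t, of "\<lambda>v. v"] by simp
    show "continuous_on (UNIV \<times> cbox (- R) R) (\<lambda>(x, v). v * fx t (x, v))"
      unfolding split_beta by (intro continuous_intros continuous_compose[OF cont_x]) (use t in auto)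
  qed auto
  then show ?thesis unfolding J_def cbox_interval by (rule has_field_derivative_at_within)
qed

text \<open>Continuity equation: when the Vlasov equation is integrated over v, the force term
  becomes \<open>E t x\<close> times the integral of \<open>fv\<close>, which is 0 because
  \<open>f\<close> vanishes at both ends. What remains is minus the x-derivative of
  \<open>J\<close>.\<close>

lemma \<rho>_deriv_t:
  assumes t: "t \<in> {0..T}"
  shows "((\<lambda>t. \<rho> t x) has_real_derivative - integral {-R..R} (\<lambda>v. v * fx t (x, v))) (at t within {0..T})"
proof -
  have "((\<lambda>t. integral (cbox (-R) R) (\<lambda>v. f t (x, v))) has_field_derivative
      integral (cbox (-R) R) (\<lambda>v. ft t (x, v))) (at t within {0..T})"
  proof (rule leibniz_rule_field_derivative)
    show "((\<lambda>t. f t (x, v)) has_field_derivative ft t (x, v)) (at t within {0..T})" if "t \<in> {0..T}" for t v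
      by (rule deriv_t[OF that])
    show "(\<lambda>v. f t (x, v)) integrable_on cbox (- R) R" if "t \<in> {0..T}" for t
      using integrable_v[OF that, of "\<lambda>v. 1"] by simp
    show "continuous_on ({0..T} \<times> cbox (- R) R) (\<lambda>(t, v). ft t (x, v))"
      unfolding split_beta by (intro continuous_compose[OF cont_t] continuous_intros) auto
  qed (use t in auto)
  moreover have "((\<lambda>v. ft t (x, v)) has_integral - integral {-R..R} (\<lambda>v. v * fx t (x, v))) {-R..R}"
  proof -
    have "(fv t o Pair x has_integral f t (x, R) - f t (x, - R)) {-R..R}"
      using R deriv_v[OF t, of x]
      by (intro fundamental_theorem_of_calculus)
         (auto simp: has_real_derivative_iff_has_vector_derivative[symmetric] intro: has_field_derivative_at_within)
    then have "((\<lambda>v. E t x * fv t (x, v)) has_integral E t x * 0) {-R..R}"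
      using supp[OF t] R by (intro has_integral_mult_right) (simp add: o_def)
    moreover have "((\<lambda>v. v * fx t (x, v)) has_integral integral {-R..R} (\<lambda>v. v * fx t (x, v))) {-R..R}"
      by (intro integrable_integral integrable_continuous_real continuous_intros continuous_compose[OF cont_x]) (use t in auto)
    ultimately have "((\<lambda>v. - (v * fx t (x, v)) - E t x * fv t (x, v)) has_integral - integral {-R..R} (\<lambda>v. v * fx t (x, v)) - E t x * 0) {-R..R}"
      by (intro has_integral_diff has_integral_neg)
    then show ?thesis by (simp add: vlasov[OF t])
  qed
  ultimately show ?thesis unfolding \<rho>_def cbox_interval by (simp add: integral_unique)
qed

lemma E_eq_integrals:
  assumes t: "t \<in> {0..T}" and x: "0 \<le> x" "x < L"
  shows "E t x = integral {0..x} (\<lambda>y. \<rho> t y - 1) + integral {0..L} (\<lambda>y. (y / L - 1) * (\<rho> t y - 1))"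
  by (rule E_field_eq_integrals[OF admissible_f[OF t] L _ _ x])
     (auto simp: density_f[OF t] intro!: continuous_intros \<rho>_continuous[OF t])

text \<open>The representation of the field by two integrals of the density is differentiated under
  the integral sign; the x-derivatives of \<open>J\<close> that appear are then integrated
  back.\<close>

lemma E_deriv_t_cell:
  assumes t: "t \<in> {0..T}" and x: "0 \<le> x" "x < L"
  shows "((\<lambda>t. E t x) has_real_derivative D t x) (at t within {0..T})"
proof -
  define j where "j t y = integral {-R..R} (\<lambda>v. v * fx t (y, v))" for t y
  have j_cont: "continuous_on ({0..T} \<times> UNIV) (\<lambda>p. j (fst p) (snd p))"
  proof -
    have "continuous_on ({0..T} \<times> UNIV) (\<lambda>p. integral (cbox (-R) R) (\<lambda>v. v * fx (fst p) (snd p, v)))"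
    proof (rule integral_continuous_on_param)
      show "continuous_on (({0..T} \<times> UNIV) \<times> cbox (- R) R) (\<lambda>(p, v). v * fx (fst p) (snd p, v))"
        unfolding split_beta by (intro continuous_intros continuous_compose[OF cont_x]) auto
    qed
    then show ?thesis unfolding j_def by simp
  qed
  have jt: "continuous_on S (j t)" if "t \<in> {0..T}" for t S
    using continuous_on_compose2[OF j_cont continuous_on_Pair_left[of S t]] that by (auto simp: image_subset_iff)
  have J': "(J t has_real_derivative j t y) (at y within S)" for y S
    unfolding j_def by (rule J_deriv_x[OF t])
  have leib: "((\<lambda>t. integral {0..b} (\<lambda>y. k y * (\<rho> t y - 1))) has_real_derivative integral {0..b} (\<lambda>y. k y * (- j t y))) (at t within {0..T})"
    if k: "continuous_on {0..b} k" for b k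
  proof -
    have "((\<lambda>t. integral (cbox 0 b) (\<lambda>y. k y * (\<rho> t y - 1))) has_field_derivative integral (cbox 0 b) (\<lambda>y. k y * (- j t y))) (at t within {0..T})"
    proof (rule leibniz_rule_field_derivative)
      show "((\<lambda>t. k y * (\<rho> t y - 1)) has_field_derivative k y * (- j t y)) (at t within {0..T})" if "t \<in> {0..T}" for t y
        using DERIV_cmult[OF DERIV_diff[OF \<rho>_deriv_t[OF that] DERIV_const], of "k y" y 1] by (simp add: j_def)
      show "(\<lambda>y. k y * (\<rho> t y - 1)) integrable_on cbox 0 b" if "t \<in> {0..T}" for t
        unfolding cbox_interval by (intro integrable_continuous_real continuous_intros k \<rho>_continuous that)
      show "continuous_on ({0..T} \<times> cbox 0 b) (\<lambda>(t, y). k y * (- j t y))"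
        unfolding split_beta cbox_interval
        by (intro continuous_intros continuous_on_compose2[OF k, of _ snd] continuous_on_subset[OF j_cont]) auto
    qed (use t in auto)
    then show ?thesis by simp
  qed
  have A: "((\<lambda>t. integral {0..x} (\<lambda>y. 1 * (\<rho> t y - 1)) + integral {0..L} (\<lambda>y. (y / L - 1) * (\<rho> t y - 1)))
     has_real_derivative integral {0..x} (\<lambda>y. 1 * (- j t y)) + integral {0..L} (\<lambda>y. (y / L - 1) * (- j t y))) (at t within {0..T})"
    using L by (intro DERIV_add leib) (auto intro!: continuous_intros)
  have B: "integral {0..x} (\<lambda>y. 1 * (- j t y)) = J t 0 - J t x"
  proof -
    have "(j t has_integral J t x - J t 0) {0..x}"
      using x J' by (intro fundamental_theorem_of_calculus) (auto simp: has_real_derivative_iff_has_vector_derivative[symmetric])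
    from integral_unique[OF has_integral_neg[OF this]] show ?thesis by simp
  qed
  \<comment> \<open>Integration by parts against y / L - 1, which is 0 at L and - 1 at 0. The term
    \<open>J t 0\<close> cancels the one in \<open>B\<close>.\<close>
  have C: "integral {0..L} (\<lambda>y. (y / L - 1) * (- j t y)) = integral {0..L} (J t) / L - J t 0"
  proof -
    have "((\<lambda>y. J t y / L + (y / L - 1) * j t y) has_integral (L / L - 1) * J t L - (0 / L - 1) * J t 0) {0..L}"
      using L
      by (intro fundamental_theorem_of_calculus[where f="\<lambda>y. (y / L - 1) * J t y"])
         (auto simp: has_real_derivative_iff_has_vector_derivative[symmetric] intro!: derivative_eq_intros J')
    then have "((\<lambda>y. J t y / L - (J t y / L + (y / L - 1) * j t y)) has_integral
        integral {0..L} (J t) / L - ((L / L - 1) * J t L - (0 / L - 1) * J t 0)) {0..L}"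
      by (intro has_integral_diff has_integral_divide integrable_integral integrable_continuous_real J_continuous t)
    then have "((\<lambda>y. (y / L - 1) * (- j t y)) has_integral integral {0..L} (J t) / L - J t 0) {0..L}"
      using L by simp
    then show ?thesis by (rule integral_unique)
  qed
  from A have "((\<lambda>t. integral {0..x} (\<lambda>y. 1 * (\<rho> t y - 1)) + integral {0..L} (\<lambda>y. (y / L - 1) * (\<rho> t y - 1)))
     has_real_derivative D t x) (at t within {0..T})"
    unfolding B C D_def by simp
  then show ?thesis
    by (rule has_field_derivative_transform_within[OF _ zero_less_one t]) (simp add: E_eq_integrals x)
qed

lemma E_deriv_t:
  assumes t: "t \<in> {0..T}"
  shows "((\<lambda>t. E t x) has_real_derivative D t x) (at t within {0..T})"
proof -
  have "J t (wrap L x) = J t x"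
    unfolding J_def using x_periodic_wrap[OF periodic[OF t]] by simp
  then have "D t (wrap L x) = D t x" unfolding D_def by simp
  moreover have "E t (wrap L x) = E t x" for t
    by (rule periodic_wrap) (rule E_field_periodic[OF L])
  ultimately show ?thesis
    using E_deriv_t_cell[OF t, of "wrap L x"] wrap_bounds[OF L, of x] by simp
qed

lemma E_lipschitz_t: "t \<in> {0..T} \<Longrightarrow> s \<in> {0..T} \<Longrightarrow> \<bar>E t x - E s x\<bar> \<le> 2 * CJ * \<bar>t - s\<bar>"
  using derivative_approx[where S="{0..T}" and g="\<lambda>t. E t x" and c=0, OF _ E_deriv_t] D_bound by simp

end

section \<open>Local error of one step\<close>

context vp_data
begin

text \<open>The width 2R of the velocity interval times the bound M (E0 + E1) of the integrand that
  is left, up to a factor of size s, after the integration by parts in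
  \<open>density_transport\<close>.\<close>

definition "C1 = 2 * R * (M * (E0 + E1))"

lemma C1_nonneg: "0 \<le> C1"
  unfolding C1_def using R M0 const_nonneg by simp

text \<open>
  Along free transport \<open>\<partial>\<^sub>tf + v \<partial>\<^sub>xf = - E \<partial>\<^sub>vf\<close>, which integrates by parts in \<open>v\<close> to a term of size
  \<open>s - r\<close>: this is why the half step of free transport yields the mid-point field to second order.
\<close>

lemma density_transport:
  assumes t: "0 \<le> t" "t + s \<le> T" and s: "0 \<le> s"
  shows "\<bar>\<rho> (t + s) x - integral {-R..R} (\<lambda>v. f t (x - s * v, v))\<bar> \<le> C1 * s\<^sup>2"
proof -
  define X where "X r v = x - (s - r) * v" for r v
  have tr: "t + r \<in> {0..T}" if "r \<in> {0..s}" for r using that t by auto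
  define g where "g r v = ft (t + r) (X r v, v) + v * fx (t + r) (X r v, v)" for r v
  have g_cont: "continuous_on ({0..s} \<times> cbox (-R) R) (\<lambda>(r, v). g r v)"
    unfolding g_def X_def split_beta
    by (intro continuous_intros continuous_compose[OF cont_t] continuous_compose[OF cont_x]) (use tr in auto)
  have g_cont1: "continuous_on {-R..R} (g r)" if "r \<in> {0..s}" for r
    unfolding g_def X_def
    by (intro continuous_intros continuous_compose[OF cont_t] continuous_compose[OF cont_x]) (use tr[OF that] in auto)
  have der: "((\<lambda>r. integral (cbox (-R) R) (\<lambda>v. f (t + r) (X r v, v))) has_field_derivative integral (cbox (-R) R) (g r)) (at r within {0..s})"
    if r: "r \<in> {0..s}" for r
  proof (rule leibniz_rule_field_derivative[OF _ _ g_cont])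
    fix r v assume r: "r \<in> {0..s}"
    have "((\<lambda>r. f (t + r) (X r v, v)) has_real_derivative
       ft (t + r) (X r v, v) * 1 + fx (t + r) (X r v, v) * v + fv (t + r) (X r v, v) * 0) (at r within {0..s})"
      unfolding X_def by (rule f_chain[where \<theta>="\<lambda>r. t + r", OF _ _ _ r tr]) (auto intro!: derivative_eq_intros)
    then show "((\<lambda>r. f (t + r) (X r v, v)) has_field_derivative g r v) (at r within {0..s})"
      by (simp add: g_def mult.commute)
  next
    fix r assume r: "r \<in> {0..s}"
    show "(\<lambda>v. f (t + r) (X r v, v)) integrable_on cbox (- R) R"
      unfolding X_def cbox_interval
      by (intro integrable_continuous_real continuous_compose[OF f_continuous] continuous_intros) (use tr[OF r] in auto)
  qed (use r in auto)
  have bnd: "\<bar>integral {-R..R} (g r)\<bar> \<le> C1 * s" if r: "r \<in> {0..s}" for r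
  proof -
    let ?t = "t + r" and ?a = "s - r"
    note t' = tr[OF r]
    \<comment> \<open>Total v-derivative of the field times \<open>f\<close> along the slanted line
      \<open>X r\<close>. Its integral is 0, so it may be added to \<open>g r\<close>; this cancels
      the field times \<open>fv\<close> and leaves only terms with the factor s - r.\<close>
    have tot: "((\<lambda>v. E ?t (X r v) * f ?t (X r v, v)) has_real_derivative
        ((\<rho> ?t (X r v) - 1) * (- ?a)) * f ?t (X r v, v) + E ?t (X r v) * (fx ?t (X r v, v) * (- ?a) + fv ?t (X r v, v)))
        (at v within {-R..R})" if v: "v \<in> {-R..R}" for v
    proof -
      have X': "(X r has_real_derivative - ?a) (at v within {-R..R})"
        unfolding X_def by (auto intro!: derivative_eq_intros)
      have "((\<lambda>v. f ?t (X r v, v)) has_real_derivative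
         ft ?t (X r v, v) * 0 + fx ?t (X r v, v) * (- ?a) + fv ?t (X r v, v) * 1) (at v within {-R..R})"
        by (rule f_chain[where \<theta>="\<lambda>_. ?t", OF _ X' _ v]) (use t' in \<open>auto intro!: derivative_eq_intros\<close>)
      moreover have "((\<lambda>v. E ?t (X r v)) has_real_derivative (\<rho> ?t (X r v) - 1) * (- ?a)) (at v within {-R..R})"
        by (rule DERIV_chain2[OF E_deriv_x[OF t'] X'])
      ultimately show ?thesis
        by (auto intro!: derivative_eq_intros simp: algebra_simps)
    qed
    have "((\<lambda>v. ((\<rho> ?t (X r v) - 1) * (- ?a)) * f ?t (X r v, v) + E ?t (X r v) * (fx ?t (X r v, v) * (- ?a) + fv ?t (X r v, v)))
       has_integral (E ?t (X r R) * f ?t (X r R, R) - E ?t (X r (-R)) * f ?t (X r (-R), -R))) {-R..R}"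
      using R tot by (intro fundamental_theorem_of_calculus) (auto simp: has_real_derivative_iff_has_vector_derivative[symmetric])
    then have "((\<lambda>v. ((\<rho> ?t (X r v) - 1) * (- ?a)) * f ?t (X r v, v) + E ?t (X r v) * (fx ?t (X r v, v) * (- ?a) + fv ?t (X r v, v)))
       has_integral 0) {-R..R}"
      using supp[OF t'] R by simp
    moreover have "(g r has_integral integral {-R..R} (g r)) {-R..R}"
      using g_cont1[OF r] by (intro integrable_integral integrable_continuous_real)
    ultimately have sum: "((\<lambda>v. g r v + (((\<rho> ?t (X r v) - 1) * (- ?a)) * f ?t (X r v, v) + E ?t (X r v) * (fx ?t (X r v, v) * (- ?a) + fv ?t (X r v, v))))
      has_integral integral {-R..R} (g r) + 0) {-R..R}"
      by (rule has_integral_add[rotated])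
    have "\<bar>integral {-R..R} (g r) + 0\<bar> \<le> 2 * R * (s * (M * (E0 + E1)))"
    proof (rule integral_bound[OF sum])
      fix v assume "v \<in> {-R..R}"
      have "g r v + (((\<rho> ?t (X r v) - 1) * (- ?a)) * f ?t (X r v, v) + E ?t (X r v) * (fx ?t (X r v, v) * (- ?a) + fv ?t (X r v, v)))
          = - ?a * ((\<rho> ?t (X r v) - 1) * f ?t (X r v, v) + E ?t (X r v) * fx ?t (X r v, v))"
        unfolding g_def vlasov[OF t'] by (simp add: algebra_simps)
      moreover have "\<bar>(\<rho> ?t (X r v) - 1) * f ?t (X r v, v) + E ?t (X r v) * fx ?t (X r v, v)\<bar> \<le> E1 * M + E0 * M"
        using E_deriv_x_bound[OF t', of "X r v"] E_bound[OF t', of "X r v"] bound(1)[OF t', of "(X r v, v)"] bound(3)[OF t', of "(X r v, v)"] const_nonneg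
        by (intro order_trans[OF abs_triangle_ineq] add_mono) (simp_all add: abs_mult mult_mono)
      moreover have "\<bar>- ?a\<bar> \<le> s" using r by auto
      ultimately have "\<bar>g r v + (((\<rho> ?t (X r v) - 1) * (- ?a)) * f ?t (X r v, v) + E ?t (X r v) * (fx ?t (X r v, v) * (- ?a) + fv ?t (X r v, v)))\<bar>
         \<le> s * (E1 * M + E0 * M)"
        unfolding abs_mult using s by (simp only: abs_mult) (intro mult_mono, auto)
      then show "\<bar>g r v + (((\<rho> ?t (X r v) - 1) * (- ?a)) * f ?t (X r v, v) + E ?t (X r v) * (fx ?t (X r v, v) * (- ?a) + fv ?t (X r v, v)))\<bar>
         \<le> s * (M * (E0 + E1))" by (simp add: algebra_simps)
    qed
    then show ?thesis unfolding C1_def by (simp add: mult_ac)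
  qed
  \<comment> \<open>At r = s the integral is the density at time t + s, at r = 0 that of the freely
    transported data; the derivative in r is at most C1 * s.\<close>
  have "\<bar>integral {-R..R} (\<lambda>v. f (t + s) (X s v, v)) - integral {-R..R} (\<lambda>v. f (t + 0) (X 0 v, v)) - 0 * (s - 0)\<bar> \<le> (C1 * s) * \<bar>s - 0\<bar>"
    by (rule derivative_approx[where S="{0..s}", OF _ der[unfolded cbox_interval]]) (use bnd s in auto)
  then show ?thesis
    using s by (simp add: X_def \<rho>_def power2_eq_square)
qed

lemma half_step_field:
  assumes t: "0 \<le> t" "t + s \<le> T" and s: "0 \<le> s"
  shows "\<bar>E (t + s) x - E_field L (exp_A s (f t)) x\<bar> \<le> L * (C1 * s\<^sup>2)"
proof (rule E_field_diff_density[OF admissible_f admissible_exp_A[OF admissible_f] L])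
  have t0: "t \<in> {0..T}" using t s by auto
  fix y
  have "(LINT v|lborel. exp_A s (f t) (y, v)) = integral {-R..R} (\<lambda>v. exp_A s (f t) (y, v))"
    by (rule density_eq_integral)
       (use supp[OF t0] R t0 in \<open>auto simp: exp_A_def intro!: continuous_compose[OF f_continuous] continuous_intros\<close>)
  then show "\<bar>(LINT v|lborel. f (t + s) (y, v)) - (LINT v|lborel. exp_A s (f t) (y, v))\<bar> \<le> C1 * s\<^sup>2"
    using density_transport[OF assms, of y] t s by (simp add: density_f exp_A_def)
qed (use t s in auto)

definition strang :: "real \<Rightarrow> real \<Rightarrow> phase_fun" where
  "strang t \<tau> = exp_A (\<tau> / 2) (exp_B L \<tau> (exp_A (\<tau> / 2) (f t)) (exp_A (\<tau> / 2) (f t)))"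

lemma strang_eq:
  "strang t \<tau> (x, v) = (let w = v - \<tau> * E_field L (exp_A (\<tau> / 2) (f t)) (x - \<tau> / 2 * v)
     in f t (x - \<tau> / 2 * v - \<tau> / 2 * w, w))"
  unfolding strang_def exp_A_def exp_B_def by (simp add: Let_def)

text \<open>
  Backward characteristics are replaced by an explicit curve whose velocity integrates the field
  along the straight line \<open>r \<mapsto> x - (\<tau> - r) v\<close>. It satisfies the characteristic equations up to
  \<open>O(\<tau>\<^sup>2)\<close>, and the mid-point rule shows that it ends \<open>O(\<tau>\<^sup>3)\<close> away from the foot of the splitting.
\<close>

lemma local_error_pointwise:
  fixes V :: real
  assumes "0 \<le> V"
  shows "\<exists>C\<ge>0. \<forall>t \<tau> x v. 0 \<le> t \<and> 0 < \<tau> \<and> t + \<tau> \<le> T \<and> \<bar>v\<bar> \<le> V \<longrightarrow>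
     \<bar>strang t \<tau> (x, v) - f (t + \<tau>) (x, v)\<bar> \<le> C * \<tau> ^ 3"
proof -
  \<comment> \<open>\<open>F\<close> is the Lipschitz constant of the field \<open>e\<close> along
    the straight line and \<open>Ce\<close> its quadratic remainder at the mid-point;
    \<open>CW\<close> and \<open>CU\<close> measure how far its first and second primitive deviate
    from those of the constant field \<open>Es\<close> of the splitting.\<close>
  define F where "F = 2 * CJ + V * E1"
  define Ce where "Ce = 2 * R * M * V * (1 + V) + 2 * CJ"
  define CW where "CW = Ce + L * C1"
  define CU where "CU = F + L * C1 * T"
  define C where "C = M * E1 * E0 + M * ((T * CW + CU) + CW)"
  have nn: "0 \<le> F" "0 \<le> Ce" "0 \<le> CW" "0 \<le> CU"
    unfolding F_def Ce_def CW_def CU_def using assms const_nonneg C1_nonneg R M0 L T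
    by (auto intro!: add_nonneg_nonneg mult_nonneg_nonneg)
  have C: "0 \<le> C" unfolding C_def using nn M0 const_nonneg T by (auto intro!: add_nonneg_nonneg mult_nonneg_nonneg)
  have "\<bar>strang t \<tau> (x, v) - f (t + \<tau>) (x, v)\<bar> \<le> C * \<tau> ^ 3"
    if t: "0 \<le> t" and \<tau>: "0 < \<tau>" and tT: "t + \<tau> \<le> T" and v: "\<bar>v\<bar> \<le> V" for t \<tau> x v
  proof -
    have \<tau>T: "\<tau> \<le> T" using t tT by simp
    have time: "t + r \<in> {0..T}" if "r \<in> {0..\<tau>}" for r using that t tT by auto
    define X where "X r = x - (\<tau> - r) * v" for r
    define e where "e r = E (t + r) (X r)" for r
    define m where "m = \<tau> / 2"
    have m: "m \<in> {0..\<tau>}" using \<tau> by (simp add: m_def)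
    have Xd: "X r - X q = (r - q) * v" for r q unfolding X_def by (simp add: algebra_simps)
    have sq: "\<bar>a\<bar> * \<bar>a\<bar> = a\<^sup>2" for a :: real by (simp add: power2_eq_square)
    have absV: "\<bar>c * v\<bar> \<le> \<bar>c\<bar> * V" for c unfolding abs_mult using v by (intro mult_left_mono) auto
    have e_lip: "\<bar>e r - e q\<bar> \<le> F * \<bar>r - q\<bar>" if r: "r \<in> {0..\<tau>}" and q: "q \<in> {0..\<tau>}" for r q
    proof -
      have "\<bar>E (t + r) (X r) - E (t + r) (X q)\<bar> \<le> E1 * (\<bar>r - q\<bar> * V)"
        using E_lipschitz_x[OF time[OF r], of "X r" "X q"] absV[of "r - q"] const_nonneg
        by (auto simp: Xd intro: order_trans mult_left_mono)
      moreover have "\<bar>E (t + r) (X q) - E (t + q) (X q)\<bar> \<le> 2 * CJ * \<bar>r - q\<bar>"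
        using E_lipschitz_t[OF time[OF r] time[OF q], of "X q"] by simp
      ultimately show ?thesis unfolding e_def F_def by (simp add: algebra_simps)
    qed
    \<comment> \<open>Derivative of \<open>e\<close> at the mid-point: the time derivative of the
      field plus v times its x-derivative.\<close>
    define \<phi> where "\<phi> = D (t + m) (X m) + (\<rho> (t + m) (X m) - 1) * v"
    have e_taylor: "\<bar>e r - e m - \<phi> * (r - m)\<bar> \<le> Ce * (r - m)\<^sup>2" if r: "r \<in> {0..\<tau>}" for r
    proof -
      define k1 where "k1 = 2 * R * M * ((1 + V) * \<bar>r - m\<bar>)"
      have k1: "0 \<le> k1" unfolding k1_def using R M0 assms by (intro mult_nonneg_nonneg) auto
      have "\<bar>E (t + r) (X r) - E (t + r) (X m) - (\<rho> (t + m) (X m) - 1) * (X r - X m)\<bar> \<le> k1 * \<bar>X r - X m\<bar>"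
      proof (rule derivative_approx[where S="closed_segment (X m) (X r)", OF _ E_deriv_x[OF time[OF r]]])
        fix \<xi> assume "\<xi> \<in> closed_segment (X m) (X r)"
        then have "\<bar>\<xi> - X m\<bar> \<le> \<bar>X r - X m\<bar>"
          by (auto simp: closed_segment_eq_real_ivl split: if_splits)
        also have "\<dots> \<le> \<bar>r - m\<bar> * V" unfolding Xd by (rule absV)
        finally have xi: "\<bar>\<xi> - X m\<bar> \<le> \<bar>r - m\<bar> * V" .
        have "\<bar>\<rho> (t + r) \<xi> - \<rho> (t + m) (X m)\<bar> \<le> 2 * R * M * (\<bar>r - m\<bar> + \<bar>\<xi> - X m\<bar>)"
          using \<rho>_lipschitz[OF time[OF r] time[OF m], of \<xi> "X m"] by simp
        also have "\<dots> \<le> k1"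
          unfolding k1_def using xi R M0 by (intro mult_left_mono) (auto simp: algebra_simps)
        finally show "\<bar>\<rho> (t + r) \<xi> - 1 - (\<rho> (t + m) (X m) - 1)\<bar> \<le> k1" by simp
      qed auto
      also have "k1 * \<bar>X r - X m\<bar> \<le> k1 * (\<bar>r - m\<bar> * V)"
        unfolding Xd using k1 by (intro mult_left_mono absV)
      also have "\<dots> = 2 * R * M * V * (1 + V) * (\<bar>r - m\<bar> * \<bar>r - m\<bar>)"
        unfolding k1_def by (simp only: mult_ac)
      also have "\<dots> = 2 * R * M * V * (1 + V) * (r - m)\<^sup>2" unfolding sq ..
      finally have 1: "\<bar>E (t + r) (X r) - E (t + r) (X m) - (\<rho> (t + m) (X m) - 1) * ((r - m) * v)\<bar> \<le> 2 * R * M * V * (1 + V) * (r - m)\<^sup>2"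
        unfolding Xd .
      have "\<bar>E (t + r) (X m) - E (t + m) (X m) - D (t + m) (X m) * ((t + r) - (t + m))\<bar> \<le> (2 * CJ * \<bar>r - m\<bar>) * \<bar>(t + r) - (t + m)\<bar>"
      proof (rule derivative_approx[where S="closed_segment (t + m) (t + r)" and g="\<lambda>t. E t (X m)" and g'="\<lambda>t. D t (X m)"])
        have sub: "closed_segment (t + m) (t + r) \<subseteq> {0..T}"
          using time[OF r] time[OF m] by (intro closed_segment_subset) auto
        fix s assume s: "s \<in> closed_segment (t + m) (t + r)"
        show "((\<lambda>t. E t (X m)) has_real_derivative D s (X m)) (at s within closed_segment (t + m) (t + r))"
          using E_deriv_t[OF subsetD[OF sub s]] sub by (rule DERIV_subset)
        have "\<bar>s - (t + m)\<bar> \<le> \<bar>r - m\<bar>"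
          using s by (auto simp: closed_segment_eq_real_ivl split: if_splits)
        then show "\<bar>D s (X m) - D (t + m) (X m)\<bar> \<le> 2 * CJ * \<bar>r - m\<bar>"
          using const_nonneg
          by (intro order_trans[OF D_lipschitz[OF subsetD[OF sub s] time[OF m]]] mult_left_mono) auto
      qed auto
      also have "(2 * CJ * \<bar>r - m\<bar>) * \<bar>(t + r) - (t + m)\<bar> = 2 * CJ * (r - m)\<^sup>2"
        by (simp add: sq[symmetric])
      finally have 2: "\<bar>E (t + r) (X m) - E (t + m) (X m) - D (t + m) (X m) * (r - m)\<bar> \<le> 2 * CJ * (r - m)\<^sup>2" by simp
      have "e r - e m - \<phi> * (r - m) = (E (t + r) (X r) - E (t + r) (X m) - (\<rho> (t + m) (X m) - 1) * ((r - m) * v))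
         + (E (t + r) (X m) - E (t + m) (X m) - D (t + m) (X m) * (r - m))"
        unfolding e_def \<phi>_def by (simp add: algebra_simps)
      then show ?thesis using 1 2 unfolding Ce_def distrib_right by linarith
    qed
    define Es where "Es = E_field L (exp_A (\<tau> / 2) (f t)) (x - \<tau> / 2 * v)"
    have em: "\<bar>e m - Es\<bar> \<le> L * C1 * \<tau>\<^sup>2"
    proof -
      have "X m = x - \<tau> / 2 * v" unfolding X_def m_def by (simp add: field_simps)
      then have "\<bar>e m - Es\<bar> \<le> L * (C1 * m\<^sup>2)"
        using half_step_field[of t m "X m"] t m time[OF m] unfolding e_def Es_def m_def by simp
      also have "\<dots> \<le> L * (C1 * \<tau>\<^sup>2)"
        using m L C1_nonneg by (intro mult_left_mono power_mono) auto
      finally show ?thesis by (simp add: mult.assoc)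
    qed
    have e_cont: "continuous_on {0..\<tau>} e"
    proof -
      have "F-lipschitz_on {0..\<tau>} e" using e_lip nn by (intro lipschitz_onI) (auto simp: dist_real_def)
      then show ?thesis by (rule lipschitz_on_continuous_on)
    qed
    define W where "W s = integral {0..s} e" for s
    have W': "(W has_real_derivative e s) (at s within {0..\<tau>})" if "s \<in> {0..\<tau>}" for s
      unfolding W_def by (rule integral_has_real_derivative[OF e_cont that])
    have W0: "W 0 = 0" unfolding W_def by simp
    have W_cont: "continuous_on {0..\<tau>} W"
      using W' by (intro DERIV_continuous_on) auto
    define U where "U s = integral {0..s} W" for s
    have U': "(U has_real_derivative W s) (at s within {0..\<tau>})" if "s \<in> {0..\<tau>}" for s
      unfolding U_def by (rule integral_has_real_derivative[OF W_cont that])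
    have U0: "U 0 = 0" unfolding U_def by simp
    have eE0: "\<bar>e s\<bar> \<le> E0" if "s \<in> {0..\<tau>}" for s unfolding e_def by (rule E_bound[OF time[OF that]])
    have in0: "0 \<in> {0..\<tau>}" "\<tau> \<in> {0..\<tau>}" using \<tau> by auto
    \<comment> \<open>Mid-point rule: the linear part of \<open>e\<close> about m integrates to 0,
      as both end points are equally far from m.\<close>
    have "\<bar>(W \<tau> - \<phi> * ((\<tau> - m)\<^sup>2 / 2)) - (W 0 - \<phi> * ((0 - m)\<^sup>2 / 2)) - e m * (\<tau> - 0)\<bar> \<le> (Ce * \<tau>\<^sup>2) * \<bar>\<tau> - 0\<bar>"
    proof (rule derivative_approx[where S="{0..\<tau>}" and g'="\<lambda>s. e s - \<phi> * (s - m)" and g="\<lambda>s. W s - \<phi> * ((s - m)\<^sup>2 / 2)"])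
      fix s assume s: "s \<in> {0..\<tau>}"
      show "((\<lambda>s. W s - \<phi> * ((s - m)\<^sup>2 / 2)) has_real_derivative e s - \<phi> * (s - m)) (at s within {0..\<tau>})"
        using W'[OF s] by (auto intro!: derivative_eq_intros)
      have "\<bar>s - m\<bar> \<le> \<tau>" using s m by auto
      then have "(s - m)\<^sup>2 \<le> \<tau>\<^sup>2" by (rule abs_le_square_iff[THEN iffD1, OF order_trans]) simp
      then have "Ce * (s - m)\<^sup>2 \<le> Ce * \<tau>\<^sup>2" using nn by (intro mult_left_mono)
      then show "\<bar>e s - \<phi> * (s - m) - e m\<bar> \<le> Ce * \<tau>\<^sup>2" using e_taylor[OF s] by simp
    qed (use in0 in auto)
    moreover have "(\<tau> - m)\<^sup>2 = (0 - m)\<^sup>2" unfolding m_def by (simp add: power2_eq_square)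
    ultimately have "\<bar>W \<tau> - \<tau> * e m\<bar> \<le> Ce * \<tau> ^ 3"
      using \<tau> W0 by (simp add: power2_eq_square power3_eq_cube mult_ac)
    moreover have "\<bar>\<tau> * e m - \<tau> * Es\<bar> \<le> L * C1 * \<tau> ^ 3"
    proof -
      have "\<bar>\<tau> * e m - \<tau> * Es\<bar> = \<tau> * \<bar>e m - Es\<bar>"
        unfolding right_diff_distrib[symmetric] abs_mult using \<tau> by simp
      also have "\<dots> \<le> \<tau> * (L * C1 * \<tau>\<^sup>2)" using em \<tau> by (intro mult_left_mono) auto
      also have "\<dots> = L * C1 * \<tau> ^ 3" by (simp add: power2_eq_square power3_eq_cube mult_ac)
      finally show ?thesis .
    qed
    ultimately have W\<tau>: "\<bar>W \<tau> - \<tau> * Es\<bar> \<le> CW * \<tau> ^ 3"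
      unfolding CW_def distrib_right by linarith
    have eEs: "\<bar>e s - Es\<bar> \<le> CU * \<tau>" if s: "s \<in> {0..\<tau>}" for s
    proof -
      have "F * \<bar>s - m\<bar> \<le> F * \<tau>" using s m nn by (intro mult_left_mono) auto
      moreover have "L * C1 * \<tau>\<^sup>2 \<le> L * C1 * (T * \<tau>)"
        unfolding power2_eq_square using \<tau> \<tau>T L C1_nonneg by (intro mult_left_mono mult_right_mono) auto
      ultimately show ?thesis
        using e_lip[OF s m] em unfolding CU_def by (simp add: algebra_simps)
    qed
    have WEs: "\<bar>W s - Es * s\<bar> \<le> CU * \<tau>\<^sup>2" if s: "s \<in> {0..\<tau>}" for s
    proof -
      have "\<bar>W s - W 0 - Es * (s - 0)\<bar> \<le> (CU * \<tau>) * \<bar>s - 0\<bar>"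
        by (rule derivative_approx[where S="{0..\<tau>}", OF _ W' eEs]) (use s in0 in auto)
      also have "\<dots> \<le> (CU * \<tau>) * \<tau>" using s \<tau> nn by (intro mult_left_mono) auto
      finally show ?thesis using W0 by (simp add: power2_eq_square mult_ac)
    qed
    have "\<bar>(U \<tau> - Es * (\<tau>\<^sup>2 / 2)) - (U 0 - Es * (0\<^sup>2 / 2)) - 0 * (\<tau> - 0)\<bar> \<le> (CU * \<tau>\<^sup>2) * \<bar>\<tau> - 0\<bar>"
      by (rule derivative_approx[where S="{0..\<tau>}" and g'="\<lambda>s. W s - Es * s" and g="\<lambda>s. U s - Es * (s\<^sup>2 / 2)"])
         (use in0 WEs U' in \<open>auto intro!: derivative_eq_intros\<close>)
    then have U\<tau>: "\<bar>U \<tau> - Es * (\<tau>\<^sup>2 / 2)\<bar> \<le> CU * \<tau> ^ 3"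
      using \<tau> U0 by (simp add: power2_eq_square power3_eq_cube mult_ac)
    \<comment> \<open>The explicit curve: it ends in (x, v) at s = \<tau> and satisfies y' = w
      exactly, while w' is the field along the straight line \<open>X\<close> instead of along
      y.\<close>
    define y where "y s = x - (\<tau> - s) * (v - W \<tau>) - (U \<tau> - U s)" for s
    define w where "w s = v - (W \<tau> - W s)" for s
    have y': "(y has_real_derivative w s) (at s within {0..\<tau>})" if "s \<in> {0..\<tau>}" for s
      unfolding y_def w_def using U'[OF that] by (auto intro!: derivative_eq_intros)
    have w': "(w has_real_derivative e s) (at s within {0..\<tau>})" if "s \<in> {0..\<tau>}" for s
      unfolding w_def using W'[OF that] by (auto intro!: derivative_eq_intros)
    have end_pt: "y \<tau> = x" "w \<tau> = v" unfolding y_def w_def by simp_all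
    have wv: "\<bar>w s - v\<bar> \<le> E0 * \<tau>" if s: "s \<in> {0..\<tau>}" for s
    proof -
      have "\<bar>w s - w \<tau> - 0 * (s - \<tau>)\<bar> \<le> E0 * \<bar>s - \<tau>\<bar>"
        by (rule derivative_approx[where S="{0..\<tau>}", OF _ w']) (use s in0 eE0 in auto)
      also have "\<dots> \<le> E0 * \<tau>" using s const_nonneg by (intro mult_left_mono) auto
      finally show ?thesis using end_pt by simp
    qed
    have yX: "\<bar>y s - X s\<bar> \<le> E0 * \<tau>\<^sup>2" if s: "s \<in> {0..\<tau>}" for s
    proof -
      have "\<bar>(y s - X s) - (y \<tau> - X \<tau>) - 0 * (s - \<tau>)\<bar> \<le> (E0 * \<tau>) * \<bar>s - \<tau>\<bar>"
      proof (rule derivative_approx[where S="{0..\<tau>}" and g="\<lambda>s. y s - X s" and g'="\<lambda>s. w s - v"])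
        show "((\<lambda>s. y s - X s) has_real_derivative w s - v) (at s within {0..\<tau>})" if "s \<in> {0..\<tau>}" for s
          unfolding X_def using y'[OF that] by (auto intro!: derivative_eq_intros)
      qed (use s in0 wv in auto)
      also have "\<dots> \<le> (E0 * \<tau>) * \<tau>" using s \<tau> const_nonneg by (intro mult_left_mono) auto
      finally show ?thesis using end_pt unfolding X_def by (simp add: power2_eq_square mult_ac)
    qed
    \<comment> \<open>The only defect in the characteristic equations is the field taken at
      \<open>X s\<close> instead of \<open>y s\<close>. These points are O(\<tau>^2) apart, which
      integrates to O(\<tau>^3).\<close>
    have path: "\<bar>f (t + \<tau>) (x, v) - f t (y 0, w 0)\<bar> \<le> M * E1 * E0 * \<tau> ^ 3"
    proof -
      have "\<bar>f (t + \<tau>) (y \<tau>, w \<tau>) - f (t + 0) (y 0, w 0) - 0 * (\<tau> - 0)\<bar> \<le> (E1 * (E0 * \<tau>\<^sup>2) * M) * \<bar>\<tau> - 0\<bar>"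
      proof (rule derivative_approx[where S="{0..\<tau>}" and g="\<lambda>s. f (t + s) (y s, w s)"])
        fix s assume s: "s \<in> {0..\<tau>}"
        show "((\<lambda>s. f (t + s) (y s, w s)) has_real_derivative
            ft (t + s) (y s, w s) * 1 + fx (t + s) (y s, w s) * w s + fv (t + s) (y s, w s) * e s) (at s within {0..\<tau>})"
          by (rule f_chain[where \<theta>="\<lambda>s. t + s", OF _ y'[OF s] w'[OF s] s time]) (auto intro!: derivative_eq_intros)
        have "ft (t + s) (y s, w s) * 1 + fx (t + s) (y s, w s) * w s + fv (t + s) (y s, w s) * e s
           = (e s - E (t + s) (y s)) * fv (t + s) (y s, w s)"
          unfolding vlasov[OF time[OF s]] by (simp add: algebra_simps)
        moreover have "\<bar>e s - E (t + s) (y s)\<bar> \<le> E1 * (E0 * \<tau>\<^sup>2)"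
          unfolding e_def using E_lipschitz_x[OF time[OF s], of "X s" "y s"] yX[OF s] const_nonneg
          by (auto simp: abs_minus_commute intro: order_trans mult_left_mono)
        moreover have "\<bar>fv (t + s) (y s, w s)\<bar> \<le> M" by (rule bound(4)[OF time[OF s]])
        ultimately show "\<bar>ft (t + s) (y s, w s) * 1 + fx (t + s) (y s, w s) * w s + fv (t + s) (y s, w s) * e s - 0\<bar> \<le> E1 * (E0 * \<tau>\<^sup>2) * M"
          using const_nonneg by (simp only: abs_mult diff_0_right) (intro mult_mono, auto)
      qed (use in0 in auto)
      then show ?thesis using \<tau> by (simp add: end_pt power2_eq_square power3_eq_cube mult_ac)
    qed
    define w1 where "w1 = v - \<tau> * Es"
    define y1 where "y1 = x - \<tau> / 2 * v - \<tau> / 2 * w1"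
    have S: "strang t \<tau> (x, v) = f t (y1, w1)"
      unfolding strang_eq y1_def w1_def Es_def by (simp add: Let_def)
    have dw: "\<bar>y1 - y 0\<bar> \<le> (T * CW + CU) * \<tau> ^ 3" "\<bar>w1 - w 0\<bar> \<le> CW * \<tau> ^ 3"
    proof -
      \<comment> \<open>The splitting moves with the constant field \<open>Es\<close>, so the
        distance of the two feet reduces to the deviations of \<open>U\<close> and \<open>W\<close>
        estimated above.\<close>
      have "y1 - y 0 = (U \<tau> - Es * (\<tau>\<^sup>2 / 2)) - \<tau> * (W \<tau> - \<tau> * Es)"
        unfolding y1_def y_def w1_def U0 by (simp add: field_simps power2_eq_square)
      moreover have "\<bar>\<tau> * (W \<tau> - \<tau> * Es)\<bar> \<le> T * (CW * \<tau> ^ 3)"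
        unfolding abs_mult using W\<tau> \<tau> \<tau>T T by (intro mult_mono) auto
      ultimately show "\<bar>y1 - y 0\<bar> \<le> (T * CW + CU) * \<tau> ^ 3"
        using U\<tau> by (simp add: distrib_right mult.assoc)
      show "\<bar>w1 - w 0\<bar> \<le> CW * \<tau> ^ 3"
        using W\<tau> unfolding w1_def w_def W0 by simp
    qed
    have "\<bar>f t (y1, w1) - f t (y 0, w 0)\<bar> \<le> M * (\<bar>t - t\<bar> + \<bar>y1 - y 0\<bar> + \<bar>w1 - w 0\<bar>)"
      using time[OF in0(1)] by (intro f_lipschitz) auto
    also have "\<dots> \<le> M * ((T * CW + CU) * \<tau> ^ 3 + CW * \<tau> ^ 3)"
      using dw M0 by (intro mult_left_mono) auto
    finally show ?thesis
      using path unfolding S C_def by (simp add: algebra_simps)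
  qed
  then show ?thesis using C by blast
qed

end

section \<open>From local to global error\<close>

context vp_data
begin

lemma exp_A_E_bound:
  assumes t: "t \<in> {0..T}"
  shows "\<bar>E_field L (exp_A s (f t)) x\<bar> \<le> E0"
proof -
  have a: "admissible L (exp_A s (f t))" by (intro admissible_exp_A admissible_f t)
  have "\<bar>E_field L (exp_A s (f t)) x - E_field L (\<lambda>z. 0) x\<bar> \<le> L * (2 * R * M)"
  proof (rule E_field_diff_density[OF a admissible_zero L])
    fix y
    have "\<bar>LINT v|lborel. exp_A s (f t) (y, v)\<bar> \<le> 2 * R * M"
      using R bound(1)[OF t]
      by (intro density_bound[OF a v_supported_exp_A[OF v_supported_f[OF t]]]) (auto simp: exp_A_def)
    then show "\<bar>(LINT v|lborel. exp_A s (f t) (y, v)) - (LINT v|lborel. 0)\<bar> \<le> 2 * R * M" by simp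
  qed
  then show ?thesis using E_field_zero_bound[OF L, of x] unfolding E0_def by linarith
qed

lemma admissible_strang: "t \<in> {0..T} \<Longrightarrow> admissible L (strang t \<tau>)"
  unfolding strang_def by (intro admissible_exp_A admissible_exp_B admissible_f L)

lemma local_error_l2:
  "\<exists>C\<ge>0. \<forall>t \<tau>. 0 \<le> t \<and> 0 < \<tau> \<and> t + \<tau> \<le> T \<longrightarrow>
     l2_norm L (\<lambda>z. strang t \<tau> z - f (t + \<tau>) z) \<le> C * \<tau> ^ 3"
proof -
  \<comment> \<open>One splitting step enlarges the velocity support by at most T * E0, so a
    pointwise bound for |v| <= V is a bound everywhere.\<close>
  define V where "V = R + T * E0"
  have V: "0 \<le> V" "R \<le> V" unfolding V_def using R T const_nonneg by auto
  obtain C where C: "0 \<le> C" "\<And>t \<tau> x v. 0 \<le> t \<Longrightarrow> 0 < \<tau> \<Longrightarrow> t + \<tau> \<le> T \<Longrightarrow> \<bar>v\<bar> \<le> V \<Longrightarrow>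
     \<bar>strang t \<tau> (x, v) - f (t + \<tau>) (x, v)\<bar> \<le> C * \<tau> ^ 3"
    using local_error_pointwise[OF V(1)] by blast
  have "l2_norm L (\<lambda>z. strang t \<tau> z - f (t + \<tau>) z) \<le> (C * sqrt (2 * V * L)) * \<tau> ^ 3"
    if t: "0 \<le> t" "0 < \<tau>" "t + \<tau> \<le> T" for t \<tau>
  proof -
    have ti: "t \<in> {0..T}" "t + \<tau> \<in> {0..T}" using t by auto
    have "v_supported (R + T * E0) (strang t \<tau>)"
      unfolding strang_def
    proof (intro v_supported_exp_A v_supported_exp_B v_supported_f ti)
      fix x
      show "\<bar>\<tau> * E_field L (exp_A (\<tau> / 2) (f t)) x\<bar> \<le> T * E0"
        unfolding abs_mult using t T exp_A_E_bound[OF ti(1)] by (intro mult_mono) auto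
    qed
    then have supp: "v_supported V (\<lambda>z. strang t \<tau> z - f (t + \<tau>) z)"
      using v_supported_mono[OF v_supported_f[OF ti(2)] V(2)] by (intro v_supported_diff) (auto simp: V_def)
    have ptw: "\<bar>strang t \<tau> z - f (t + \<tau>) z\<bar> \<le> C * \<tau> ^ 3" for z
    proof (cases "\<bar>snd z\<bar> \<le> V")
      case True
      then show ?thesis using C(2)[OF t, of "snd z" "fst z"] by simp
    next
      case False
      then have "strang t \<tau> z - f (t + \<tau>) z = 0"
        using supp unfolding v_supported_def by (cases z) auto
      then show ?thesis using C(1) t by simp
    qed
    have "l2_norm L (\<lambda>z. strang t \<tau> z - f (t + \<tau>) z) \<le> (C * \<tau> ^ 3) * sqrt (2 * V * L)"
      using L V C(1) t
      by (intro l2_norm_le_sup[OF _ _ _ _ supp ptw] admissible_measurable[of L] admissible_diff admissible_strang admissible_f ti) auto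
    then show ?thesis by (simp add: mult_ac)
  qed
  then show ?thesis using C(1) V L by (intro exI[of _ "C * sqrt (2 * V * L)"]) auto
qed

text \<open>The shear turns a change of v into an additional change of x, at most T times as large;
  hence T + 1.\<close>

lemma exp_A_f_lipschitz:
  assumes t: "t \<in> {0..T}" and s: "0 \<le> s" "s \<le> T"
  shows "\<bar>exp_A s (f t) (x, v) - exp_A s (f t) (x, w)\<bar> \<le> M * (T + 1) * \<bar>v - w\<bar>"
proof -
  have "\<bar>s * w - s * v\<bar> \<le> T * \<bar>v - w\<bar>"
    unfolding right_diff_distrib[symmetric] abs_mult using s by (intro mult_mono) auto
  then have "M * (\<bar>t - t\<bar> + \<bar>(x - s * v) - (x - s * w)\<bar> + \<bar>v - w\<bar>) \<le> M * ((T + 1) * \<bar>v - w\<bar>)"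
    using M0 by (intro mult_left_mono) (auto simp: algebra_simps)
  then show ?thesis
    using f_lipschitz[OF t t, of "x - s * v" v "x - s * w" w] unfolding exp_A_def by (simp add: mult.assoc)
qed

text \<open>An interface common to the discontinuous Galerkin projection and the identity. The
  consistency error \<epsilon> concerns the initial value and the three stages of a step started on
  the exact solution; of the numerical solution only the support after the first half step is
  recorded.\<close>

definition stable_consistent :: "real \<Rightarrow> (phase_fun \<Rightarrow> phase_fun) \<Rightarrow> real \<Rightarrow> nat \<Rightarrow> real \<Rightarrow> bool" where
  "stable_consistent R' P \<tau> N \<epsilon> \<longleftrightarrow>
      0 < \<tau> \<and> real N * \<tau> \<le> T \<and> 0 \<le> \<epsilon> \<and>
      (\<forall>u. admissible L u \<longrightarrow> admissible L (P u)) \<and>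
      (\<forall>u w. admissible L u \<longrightarrow> admissible L w \<longrightarrow> l2_norm L (\<lambda>z. P u z - P w z) \<le> l2_norm L (\<lambda>z. u z - w z)) \<and>
      (\<forall>n<N. v_supported R' (S_A P \<tau> (strang_dg P L \<tau> (f 0) n))) \<and>
      l2_norm L (\<lambda>z. P (f 0) z - f 0 z) \<le> \<epsilon> \<and>
      (\<forall>n<N. \<forall>w\<in>{exp_A (\<tau> / 2) (f (real n * \<tau>)),
          exp_B L \<tau> (exp_A (\<tau> / 2) (f (real n * \<tau>))) (exp_A (\<tau> / 2) (f (real n * \<tau>))),
          strang (real n * \<tau>) \<tau>}. l2_norm L (\<lambda>z. P w z - w z) \<le> \<epsilon>)"

text \<open>
  With the identity in place of the projection, this approximates the exact solution by
  semi-discrete ones.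
\<close>

lemma convergence:
  assumes "R \<le> R'"
  shows "\<exists>K\<ge>0. \<forall>P \<tau> N \<epsilon>. stable_consistent R' P \<tau> N \<epsilon> \<longrightarrow>
      (\<forall>n\<le>N. l2_norm L (\<lambda>z. strang_dg P L \<tau> (f 0) n z - f (real n * \<tau>) z)
          \<le> K * (\<epsilon> + real n * (\<epsilon> + \<tau> ^ 3)))"
proof -
  obtain C where C: "0 \<le> C" "\<And>t \<tau>. 0 \<le> t \<Longrightarrow> 0 < \<tau> \<Longrightarrow> t + \<tau> \<le> T \<Longrightarrow>
     l2_norm L (\<lambda>z. strang t \<tau> z - f (t + \<tau>) z) \<le> C * \<tau> ^ 3"
    using local_error_l2 by blast
  have R': "0 \<le> R'" using assms R by simp
  define k where "k = M * (T + 1) * stability_const L R'"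
  have k: "0 \<le> k" unfolding k_def stability_const_def using M0 T L R' by simp
  \<comment> \<open>The exponential is the Gronwall factor; 3 + T * k accounts for the three
    projection errors of a step, one of them amplified by 1 + \<tau> * k; C is the local error
    constant.\<close>
  define K where "K = exp (k * T) * (3 + T * k + C)"
  have K: "0 \<le> K" unfolding K_def using k T C(1) by simp
  have "l2_norm L (\<lambda>z. strang_dg P L \<tau> (f 0) n z - f (real n * \<tau>) z) \<le> K * (\<epsilon> + real n * (\<epsilon> + \<tau> ^ 3))"
    if \<tau>: "0 < \<tau>" "real N * \<tau> \<le> T" and \<epsilon>: "0 \<le> \<epsilon>"
      and P: "\<And>u. admissible L u \<Longrightarrow> admissible L (P u)"
      and contr: "\<And>u w. admissible L u \<Longrightarrow> admissible L w \<Longrightarrow> l2_norm L (\<lambda>z. P u z - P w z) \<le> l2_norm L (\<lambda>z. u z - w z)"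
      and supp': "\<And>n. n < N \<Longrightarrow> v_supported R' (S_A P \<tau> (strang_dg P L \<tau> (f 0) n))"
      and init: "l2_norm L (\<lambda>z. P (f 0) z - f 0 z) \<le> \<epsilon>"
      and err: "\<And>n w. n < N \<Longrightarrow> w\<in>{exp_A (\<tau> / 2) (f (real n * \<tau>)),
          exp_B L \<tau> (exp_A (\<tau> / 2) (f (real n * \<tau>))) (exp_A (\<tau> / 2) (f (real n * \<tau>))),
          strang (real n * \<tau>) \<tau>} \<Longrightarrow> l2_norm L (\<lambda>z. P w z - w z) \<le> \<epsilon>"
      and n: "n \<le> N" for P \<tau> N \<epsilon> n
  proof -
    let ?F = "strang_dg P L \<tau> (f 0)"
    have time: "real n * \<tau> \<in> {0..T}" if "n \<le> N" for n
    proof -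
      have "real n * \<tau> \<le> real N * \<tau>" using that \<tau> by (intro mult_right_mono) auto
      with \<tau>(2) have "real n * \<tau> \<le> T" by linarith
      then show ?thesis using \<tau> by simp
    qed
    define e where "e n = l2_norm L (\<lambda>z. ?F n z - f (real n * \<tau>) z)" for n
    have \<tau>T: "\<tau> \<le> T" if "n < N" for n
      using time[of 1] that by simp
    have adm: "n \<le> N \<Longrightarrow> admissible L (?F n)" for n
    proof (induction n)
      case 0
      then show ?case using P admissible_f[of 0] T by simp
    next
      case (Suc n)
      then show ?case unfolding strang_dg.simps S_strang_def S_B_def S_A_def
        by (intro P admissible_exp_A admissible_exp_B L) auto
    qed
    have step: "e (Suc n) \<le> (1 + \<tau> * k) * e n + ((3 + T * k) * \<epsilon> + C * \<tau> ^ 3)" if n: "n < N" for n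
    proof -
      let ?t = "real n * \<tau>"
      have t: "?t \<in> {0..T}" "?t + \<tau> \<in> {0..T}" using time[of n] time[of "Suc n"] n by (auto simp: algebra_simps)
      have st: "real (Suc n) * \<tau> = ?t + \<tau>" by (simp add: algebra_simps)
      have kn: "0 \<le> M * (T + 1)" using M0 T by simp
      have "l2_norm L (\<lambda>z. S_strang P L \<tau> (?F n) (?F n) z - strang ?t \<tau> z)
        \<le> (1 + \<tau> * (M * (T + 1) * stability_const L R')) * (l2_norm L (\<lambda>z. ?F n z - f ?t z) + \<epsilon>) + 2 * \<epsilon>"
      proof (rule strang_step_error(2)[where b="exp_B L \<tau> (exp_A (\<tau> / 2) (f ?t)) (exp_A (\<tau> / 2) (f ?t))"])
        show "v_supported R' (f ?t)" using v_supported_f[OF t(1)] assms by (rule v_supported_mono)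
        show "\<bar>exp_A (\<tau> / 2) (f ?t) (x, v) - exp_A (\<tau> / 2) (f ?t) (x, w)\<bar> \<le> M * (T + 1) * \<bar>v - w\<bar>" for x v w
          using \<tau> \<tau>T[OF n] by (intro exp_A_f_lipschitz t) auto
      qed (use L R' \<tau> kn P contr adm[of n] n supp' admissible_f[OF t(1)] err[OF n] in \<open>auto simp: strang_def\<close>)
      then have 1: "l2_norm L (\<lambda>z. ?F (Suc n) z - strang ?t \<tau> z) \<le> (1 + \<tau> * k) * (e n + \<epsilon>) + 2 * \<epsilon>"
        unfolding k_def e_def by simp
      have 2: "l2_norm L (\<lambda>z. strang ?t \<tau> z - f (?t + \<tau>) z) \<le> C * \<tau> ^ 3"
        using C(2)[of ?t \<tau>] t \<tau> by simp
      have "e (Suc n) \<le> l2_norm L (\<lambda>z. ?F (Suc n) z - strang ?t \<tau> z) + l2_norm L (\<lambda>z. strang ?t \<tau> z - f (?t + \<tau>) z)"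
        unfolding e_def st using n
        by (intro l2_norm_diff_triangle adm admissible_strang admissible_f t L) auto
      also have "\<dots> \<le> ((1 + \<tau> * k) * (e n + \<epsilon>) + 2 * \<epsilon>) + C * \<tau> ^ 3" using 1 2 by linarith
      also have "\<dots> = (1 + \<tau> * k) * e n + ((3 + \<tau> * k) * \<epsilon> + C * \<tau> ^ 3)" by (simp add: algebra_simps)
      also have "(3 + \<tau> * k) * \<epsilon> \<le> (3 + T * k) * \<epsilon>"
        using \<tau>T[OF n] k \<epsilon> by (intro mult_right_mono add_left_mono) auto
      finally show ?thesis by simp
    qed
    have e0: "0 \<le> e 0" "e 0 \<le> \<epsilon>" unfolding e_def using init l2_norm_nonneg by auto
    define d where "d = (3 + T * k) * \<epsilon> + C * \<tau> ^ 3"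
    have d: "0 \<le> d" unfolding d_def using k T \<epsilon> C(1) \<tau> by auto
    have "e n \<le> exp (\<tau> * k * real n) * (e 0 + real n * d)"
      using k \<tau> d e0 step n unfolding d_def[symmetric] by (intro discrete_gronwall[where N=N]) auto
    also have "\<dots> \<le> exp (k * T) * (\<epsilon> + real n * d)"
    proof (intro mult_mono add_right_mono e0)
      have "k * (real n * \<tau>) \<le> k * T" using time[OF n] k by (intro mult_left_mono) auto
      then show "exp (\<tau> * k * real n) \<le> exp (k * T)" by (simp add: mult_ac)
    qed (use e0 d in auto)
    also have "\<epsilon> + real n * d \<le> (3 + T * k + C) * (\<epsilon> + real n * (\<epsilon> + \<tau> ^ 3))"
    proof -
      have "\<epsilon> \<le> (3 + T * k + C) * \<epsilon>"
        using k T C(1) \<epsilon> by (simp add: mult_le_cancel_right1)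
      moreover have "d \<le> (3 + T * k + C) * (\<epsilon> + \<tau> ^ 3)"
        unfolding d_def using k T C(1) \<epsilon> \<tau> by (simp add: algebra_simps)
      then have "real n * d \<le> real n * ((3 + T * k + C) * (\<epsilon> + \<tau> ^ 3))" by (intro mult_left_mono) auto
      ultimately show ?thesis by (simp add: algebra_simps)
    qed
    finally show ?thesis unfolding e_def K_def by (simp add: mult.assoc)
  qed
  note main = this
  show ?thesis
    by (intro exI[of _ K] conjI allI impI K, unfold stable_consistent_def, elim conjE, rule main; (assumption | blast))
qed

end

section \<open>Regularity of the semi-discrete splitting\<close>

locale semidiscrete =
  fixes L T R M :: real and f0 :: phase_fun
  assumes L: "0 < L" and T: "0 < T" and R: "0 < R"
    and f0_cont: "continuous_on UNIV f0" and f0_periodic: "x_periodic L f0"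
    and f0_supp: "v_supported R f0" and f0_range: "0 \<le> f0 z" "f0 z \<le> M"
    and f0_mass: "(\<integral>\<^sup>+z. ennreal (f0 z) * indicator (torus L) z \<partial>lborel) = ennreal L"
begin

text \<open>Invariants of the semi-discrete scheme. M and the mass are the same for all steps, the
  support radius is not; a uniform radius is recovered afterwards from the field bound that mass and
  positivity provide.\<close>

definition good :: "phase_fun \<Rightarrow> bool" where
  "good g \<longleftrightarrow> continuous_on UNIV g \<and> x_periodic L g \<and> (\<exists>R. v_supported R g) \<and> (\<forall>z. 0 \<le> g z \<and> g z \<le> M) \<and>
     (\<integral>\<^sup>+z. ennreal (g z) * indicator (torus L) z \<partial>lborel) = ennreal L"

lemma good_f0: "good f0"
  unfolding good_def using f0_cont f0_periodic f0_supp f0_range f0_mass by blast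

lemma good_admissible: "good g \<Longrightarrow> admissible L g"
proof -
  assume g: "good g"
  have "\<bar>g z\<bar> \<le> M" for z using g unfolding good_def by (metis abs_of_nonneg)
  then show ?thesis using g unfolding good_def admissible_def
    by (blast intro: borel_measurable_continuous_onI)
qed

text \<open>The mass of a non-negative density contributes L and the background another L,
  regardless of the support.\<close>

lemma good_E_bound: "good g \<Longrightarrow> \<bar>E_field L g x\<bar> \<le> 2 * L"
proof -
  assume g: "good g"
  have eq: "(\<integral>\<^sup>+z. ennreal \<bar>g z\<bar> * indicator (torus L) z \<partial>lborel) = (\<integral>\<^sup>+z. ennreal (g z) * indicator (torus L) z \<partial>lborel)"
  proof (rule nn_integral_cong)
    have "0 \<le> g z" for z using g unfolding good_def by blast
    then show "ennreal \<bar>g z\<bar> * indicator (torus L) z = ennreal (g z) * indicator (torus L) z" for z by simp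
  qed
  have "(\<integral>\<^sup>+z. ennreal \<bar>g z\<bar> * indicator (torus L) z \<partial>lborel) \<le> ennreal L"
  proof -
    have "(\<integral>\<^sup>+z. ennreal (g z) * indicator (torus L) z \<partial>lborel) = ennreal L"
      using g unfolding good_def by blast
    then show ?thesis by (simp only: eq order_refl)
  qed
  from E_field_L1_bound[OF good_admissible[OF g] L _ this] L show ?thesis by simp
qed

lemma good_density_continuous:
  assumes g: "good g"
  shows "continuous_on UNIV (\<lambda>y. LINT v|lborel. g (y, v))"
proof -
  obtain R where R: "v_supported R g" using g unfolding good_def by blast
  define S where "S = \<bar>R\<bar> + 1"
  have cont: "continuous_on UNIV g" using g unfolding good_def by blast
  have "(LINT v|lborel. g (y, v)) = integral {-S..S} (\<lambda>v. g (y, v))" for y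
  proof (rule density_eq_integral)
    show "continuous_on UNIV (\<lambda>v. g (y, v))"
      by (intro continuous_on_compose2[OF cont] continuous_intros) auto
    show "g (y, v) = 0" if "S \<le> \<bar>v\<bar>" for v
      using R that unfolding v_supported_def S_def by auto
  qed (simp add: S_def)
  moreover have "continuous_on UNIV (\<lambda>y. integral (cbox (-S) S) (\<lambda>v. g (y, v)))"
    by (rule integral_continuous_on_param) (auto simp: split_beta intro: continuous_on_subset[OF cont])
  ultimately show ?thesis by simp
qed

text \<open>Neutrality: plasma and background balance, which makes primitives of the density minus 1
  periodic.\<close>

lemma good_mean_zero:
  assumes g: "good g"
  shows "integral {0..L} (\<lambda>y. (LINT v|lborel. g (y, v)) - 1) = 0"
proof -
  note a = good_admissible[OF g]
  note [measurable] = admissible_measurable[OF a]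
  define \<rho> where "\<rho> y = (LINT v|lborel. g (y, v))" for y
  have cont: "continuous_on UNIV \<rho>" unfolding \<rho>_def by (rule good_density_continuous[OF g])
  have c: "continuous_on {0..L} \<rho>" using cont by (rule continuous_on_subset) simp
  have [measurable]: "\<rho> \<in> borel_measurable borel" using cont by (rule borel_measurable_continuous_onI)
  have pos: "0 \<le> g z" for z using g unfolding good_def by blast
  have \<rho>: "ennreal (\<rho> y) = (\<integral>\<^sup>+v. ennreal (g (y, v)) \<partial>lborel)" for y
    unfolding \<rho>_def by (rule nn_integral_eq_integral[symmetric, OF density_integrable[OF a]]) (simp add: pos)
  have \<rho>0: "0 \<le> \<rho> y" for y unfolding \<rho>_def by (intro Bochner_Integration.integral_nonneg) (simp add: pos)
  have "(LINT y:{0..L}|lborel. \<rho> y) = enn2real (\<integral>\<^sup>+y. ennreal (indicator {0..L} y *\<^sub>R \<rho> y) \<partial>lborel)"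
    unfolding set_lebesgue_integral_def using \<rho>0 by (intro integral_eq_nn_integral) auto
  also have "(\<integral>\<^sup>+y. ennreal (indicator {0..L} y *\<^sub>R \<rho> y) \<partial>lborel) = (\<integral>\<^sup>+y. (\<integral>\<^sup>+v. ennreal (g (y, v)) * indicator {0..L} y \<partial>lborel) \<partial>lborel)"
    by (intro nn_integral_cong) (auto simp: \<rho> split: split_indicator)
  also have "\<dots> = (\<integral>\<^sup>+z. ennreal (g z) * indicator (torus L) z \<partial>lborel)"
    by (subst nn_integral_lborel_fst) (auto simp: torus_def indicator_times)
  also have "\<dots> = ennreal L" using g unfolding good_def by blast
  finally have "(LINT y:{0..L}|lborel. \<rho> y) = L" using L by simp
  then have "integral {0..L} \<rho> = L"
    using set_borel_integral_eq_integral(2)[OF borel_integrable_atLeastAtMost'[OF c]] by simp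
  moreover have "integral {0..L} (\<lambda>y. \<rho> y - 1) = integral {0..L} \<rho> - integral {0..L} (\<lambda>y. 1)"
    using c by (intro Henstock_Kurzweil_Integration.integral_diff integrable_continuous_real) auto
  ultimately show ?thesis using L unfolding \<rho>_def by simp
qed

text \<open>Within one period the field is a primitive of the density minus 1 up to a constant. At
  multiples of L, where \<open>wrap\<close> jumps, differentiability holds because neutrality makes
  this primitive periodic.\<close>

lemma good_E_deriv:
  assumes g: "good g"
  shows "(E_field L g has_real_derivative (LINT v|lborel. g (x, v)) - 1) (at x)"
proof -
  define r where "r y = (LINT v|lborel. g (y, v)) - 1" for y
  have cont: "continuous_on S r" for S
    unfolding r_def using good_density_continuous[OF g] by (intro continuous_intros) (rule continuous_on_subset, auto)
  have per: "r (y + L) = r y" for y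
    using g unfolding r_def good_def x_periodic_def by simp
  \<comment> \<open>Started at - L to cover negative y near 0; its range up to 2 * L leaves room for
    y + L.\<close>
  define H where "H x = integral {-L..x} r" for x
  have H': "(H has_real_derivative r y) (at y within {-L..2 * L})" if "y \<in> {-L..2 * L}" for y
    unfolding H_def by (rule integral_has_real_derivative[OF cont that])
  have H_diff: "integral {a..b} r = H b - H a" if "- L \<le> a" "a \<le> b" for a b
    unfolding H_def using Henstock_Kurzweil_Integration.integral_combine[OF that, of r] cont
    by (simp add: integrable_continuous_real)
  \<comment> \<open>The difference has derivative 0 since \<open>r\<close> is periodic, and it is 0
    at y = 0 by neutrality.\<close>
  have H_per: "H (y + L) = H y" if y: "- L \<le> y" "y \<le> L" for y
  proof -
    have "\<bar>(H (y + L) - H y) - (H (0 + L) - H 0) - 0 * (y - 0)\<bar> \<le> 0 * \<bar>y - 0\<bar>"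
    proof (rule derivative_approx[where S="{-L..L}" and g="\<lambda>y. H (y + L) - H y" and g'="\<lambda>y. r (y + L) - r y"])
      fix s assume s: "s \<in> {-L..L}"
      have "(H has_real_derivative r (s + L)) (at (s + L) within (\<lambda>y. y + L) ` {-L..L})"
        by (rule DERIV_subset[OF H']) (use s in auto)
      moreover have "((\<lambda>y. y + L) has_real_derivative 1) (at s within {-L..L})"
        by (auto intro!: derivative_eq_intros)
      ultimately have "((\<lambda>y. H (y + L)) has_real_derivative r (s + L) * 1) (at s within {-L..L})"
        using DERIV_image_chain[of H "r (s + L)" "\<lambda>y. y + L" s "{-L..L}" 1] by (simp add: o_def)
      then show "((\<lambda>y. H (y + L) - H y) has_real_derivative r (s + L) - r s) (at s within {-L..L})"
        using DERIV_subset[OF H', of s "{-L..L}"] s by (auto intro!: derivative_eq_intros)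
    qed (use y L per in auto)
    moreover have "H (0 + L) - H 0 = 0"
      using good_mean_zero[OF g] H_diff[of 0 L] L unfolding r_def by simp
    ultimately show ?thesis by simp
  qed
  define c where "c = integral {0..L} (\<lambda>y. (y / L - 1) * r y) - H 0"
  \<comment> \<open>The open interval (- L, L) is a neighbourhood of every wrapped point, including
    0.\<close>
  have E: "E_field L g y = H y + c" if "- L < y" "y < L" for y
  proof (cases "0 \<le> y")
    case True
    then show ?thesis
      using E_field_eq_integrals[OF good_admissible[OF g] L r_def cont True that(2)] H_diff[of 0 y] L
      by (simp add: c_def)
  next
    case False
    have "E_field L g y = E_field L g (y + L)" by (rule E_field_periodic[OF L, symmetric])
    also have "\<dots> = H (y + L) + c"
      using E_field_eq_integrals[OF good_admissible[OF g] L r_def cont, of "y + L"] H_diff[of 0 "y + L"] L that False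
      by (simp add: c_def)
    finally show ?thesis using H_per[of y] that by simp
  qed
  have cell: "(E_field L g has_real_derivative r y) (at y)" if "- L < y" "y < L" for y
  proof -
    have "(H has_real_derivative r y) (at y within {-L<..<L})"
      by (rule DERIV_subset[OF H']) (use that L in auto)
    then have "(H has_real_derivative r y) (at y)"
      using that by (simp add: at_within_open[of y "{-L<..<L}"])
    then have "((\<lambda>y. H y + c) has_real_derivative r y) (at y)" by (auto intro!: derivative_eq_intros)
    then show ?thesis
      by (rule has_field_derivative_transform_within_open[of _ _ _ "{-L<..<L}"]) (use that E in auto)
  qed
  have "((\<lambda>y. E_field L g (y + (wrap L x - x))) has_real_derivative r (wrap L x)) (at x)"
    using cell[of "wrap L x"] wrap_bounds[OF L, of x] L
    by (subst DERIV_shift[symmetric]) (auto simp: algebra_simps)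
  moreover have "E_field L g (y + (wrap L x - x)) = E_field L g y" for y
    using periodic_add_int[of "E_field L g" L y "- \<lfloor>x / L\<rfloor>"] E_field_periodic[OF L] by (simp add: wrap_def)
  moreover have "r (wrap L x) = r x" by (rule periodic_wrap[of r, OF per])
  ultimately show ?thesis by (simp add: r_def)
qed

lemma good_E_continuous: "good g \<Longrightarrow> continuous_on S (E_field L g)"
  using good_E_deriv by (intro continuous_at_imp_continuous_on) (auto intro: DERIV_isCont)

lemma good_exp_A:
  assumes g: "good g"
  shows "good (exp_A s g)"
proof -
  have cont: "continuous_on UNIV g" and pos: "\<And>z. 0 \<le> g z \<and> g z \<le> M" and per: "x_periodic L g"
    using g unfolding good_def by blast+
  have m: "(\<lambda>z. ennreal (g z)) \<in> borel_measurable borel"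
    using borel_measurable_continuous_onI[OF cont] by simp
  have "continuous_on UNIV (exp_A s g)"
    unfolding exp_A_def split_beta by (intro continuous_on_compose2[OF cont] continuous_intros) auto
  moreover have "(\<integral>\<^sup>+z. ennreal (exp_A s g z) * indicator (torus L) z \<partial>lborel) = ennreal L"
    using nn_integral_exp_A[OF m L, of s] g per unfolding good_def x_periodic_def exp_A_def split_beta by simp
  moreover have "\<forall>z. 0 \<le> exp_A s g z \<and> exp_A s g z \<le> M" unfolding exp_A_def using pos by (simp add: split_beta)
  ultimately show ?thesis
    using g x_periodic_exp_A[of L g s] v_supported_exp_A[of _ g s] unfolding good_def by blast
qed

lemma good_exp_B:
  assumes g0: "good g0" and g: "good g"
  shows "good (exp_B L s g0 g)"
proof -
  have cont: "continuous_on UNIV g" and pos: "\<And>z. 0 \<le> g z \<and> g z \<le> M" and per: "x_periodic L g"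
    using g unfolding good_def by blast+
  have m: "(\<lambda>z. ennreal (g z)) \<in> borel_measurable borel" and mE: "(\<lambda>x. s * E_field L g0 x) \<in> borel_measurable borel"
    using borel_measurable_continuous_onI[OF cont] borel_measurable_continuous_onI[OF good_E_continuous[OF g0, of UNIV]] by simp_all
  have "continuous_on UNIV (exp_B L s g0 g)"
    unfolding exp_B_def split_beta
    by (intro continuous_on_compose2[OF cont] continuous_on_compose2[OF good_E_continuous[OF g0, of UNIV]] continuous_intros) auto
  moreover have "(\<integral>\<^sup>+z. ennreal (exp_B L s g0 g z) * indicator (torus L) z \<partial>lborel) = ennreal L"
    using nn_integral_exp_B[OF m mE, of L] g unfolding good_def exp_B_def split_beta by simp
  moreover have "\<forall>z. 0 \<le> exp_B L s g0 g z \<and> exp_B L s g0 g z \<le> M" unfolding exp_B_def using pos by (simp add: split_beta)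
  moreover have "\<exists>R. v_supported R (exp_B L s g0 g)"
    using admissible_exp_B[OF good_admissible[OF g0] good_admissible[OF g] L] unfolding admissible_def by blast
  ultimately show ?thesis
    using x_periodic_exp_B[OF L per] unfolding good_def by blast
qed

definition scheme :: "real \<Rightarrow> nat \<Rightarrow> phase_fun" where
  "scheme \<delta> m = strang_dg id L \<delta> f0 m"

lemma scheme_0: "scheme \<delta> 0 = f0"
  unfolding scheme_def by simp

lemma scheme_Suc:
  "scheme \<delta> (Suc m) = exp_A (\<delta> / 2) (exp_B L \<delta> (exp_A (\<delta> / 2) (scheme \<delta> m)) (exp_A (\<delta> / 2) (scheme \<delta> m)))"
  unfolding scheme_def by (simp add: S_strang_def S_A_def S_B_def)

lemma good_scheme: "good (scheme \<delta> m)"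
  by (induction m) (auto simp: scheme_0 scheme_Suc good_f0 intro: good_exp_A good_exp_B)

lemma good_shift_supported:
  assumes "good g0" "v_supported S g" "0 \<le> s"
  shows "v_supported (S + s * (2 * L)) (exp_B L s g0 g)"
  using assms good_E_bound[OF assms(1)]
  by (intro v_supported_exp_B) (auto simp: abs_mult intro: mult_left_mono)

lemma scheme_supported_steps:
  "0 \<le> \<delta> \<Longrightarrow> v_supported (R + real m * \<delta> * (2 * L)) (scheme \<delta> m)"
proof (induction m)
  case (Suc m)
  have "v_supported ((R + real m * \<delta> * (2 * L)) + \<delta> * (2 * L)) (scheme \<delta> (Suc m))"
    unfolding scheme_Suc using Suc
    by (intro v_supported_exp_A good_shift_supported good_exp_A good_scheme) auto
  then show ?case by (simp add: algebra_simps)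
qed (simp add: scheme_0 f0_supp)

text \<open>The support grows at most at the rate 2L, the bound of the field, so this radius serves
  all step sizes up to time T.\<close>

definition "RR = R + T * (2 * L)"

lemma scheme_supported:
  assumes "0 \<le> \<delta>" "real m * \<delta> \<le> T"
  shows "v_supported RR (scheme \<delta> m)"
proof (rule v_supported_mono[OF scheme_supported_steps[OF assms(1)]])
  show "R + real m * \<delta> * (2 * L) \<le> RR"
    unfolding RR_def using assms L by (intro add_left_mono mult_right_mono) auto
qed

end

text \<open>Feet of the characteristics of the splitting after \<open>j\<close> steps backwards, in the fields \<open>e 0, e 1, \<dots>\<close>.\<close>

primrec orbit :: "(nat \<Rightarrow> real \<Rightarrow> real) \<Rightarrow> real \<Rightarrow> real \<times> real \<Rightarrow> nat \<Rightarrow> real \<times> real" where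
  "orbit e \<delta> z 0 = z"
| "orbit e \<delta> z (Suc j) =
     (let x = fst (orbit e \<delta> z j) - \<delta> / 2 * snd (orbit e \<delta> z j);
          v = snd (orbit e \<delta> z j) - \<delta> * e j x
      in (x - \<delta> / 2 * v, v))"

text \<open>The top derivative of F o X contains that of X linearly, multiplied by F' o X. The bound
  is therefore affine in N with a constant fixed in advance; the bound for the lower orders is crude
  and left existential.\<close>

lemma bounded_curve_compose:
  "\<exists>C\<ge>0. \<forall>F X N. bounded_curve (Suc k) A A F \<longrightarrow> bounded_curve (Suc k) M N X \<longrightarrow> 0 \<le> N \<longrightarrow>
     (\<exists>B. bounded_curve (Suc k) B (C * N + C) (\<lambda>s. F (X s)))"
proof -
  obtain C where C: "0 \<le> C" "\<And>F X. bounded_derivs k A A F \<Longrightarrow> bounded_curve k M M X \<Longrightarrow> bounded_derivs k C C (\<lambda>s. F (X s))"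
    using bounded_derivs_compose[of k A M] by blast
  define C' where "C' = C + real k * 2 ^ k * C * \<bar>M\<bar>"
  have C': "0 \<le> C'" "C \<le> C'" "real k * 2 ^ k * C * \<bar>M\<bar> \<le> C'" unfolding C'_def using C(1) by auto
  have "bounded_curve (Suc k) (2 ^ k * C * \<bar>M\<bar>) (C' * N + C') (\<lambda>s. F (X s))"
    if F: "bounded_curve (Suc k) A A F" and X: "bounded_curve (Suc k) M N X" and N: "0 \<le> N" for F X N
  proof -
    obtain F' where F': "\<And>x. (F has_real_derivative F' x) (at x)" "bounded_derivs k A A F'"
      using bounded_curve_SucE[OF F] by blast
    obtain X' where X': "\<And>x. (X has_real_derivative X' x) (at x)" "bounded_derivs k M N X'"
      using bounded_curve_SucE[OF X] by blast
    have "bounded_derivs k C C (\<lambda>s. F' (X s))"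
      by (rule C(2)[OF F'(2) bounded_curve_lower[OF X]])
    moreover have "bounded_derivs k \<bar>M\<bar> N X'" using X'(2) by (rule bounded_derivs_mono) auto
    ultimately have "bounded_derivs k (2 ^ k * C * \<bar>M\<bar>) (C * N + real k * 2 ^ k * C * \<bar>M\<bar>) (\<lambda>s. F' (X s) * X' s)"
      by (rule bounded_derivs_mult)
    moreover have "C * N + real k * 2 ^ k * C * \<bar>M\<bar> \<le> C' * N + C'"
      using C' N by (intro add_mono mult_right_mono) auto
    ultimately have "bounded_derivs k (2 ^ k * C * \<bar>M\<bar>) (C' * N + C') (\<lambda>s. F' (X s) * X' s)"
      by (elim bounded_derivs_mono) auto
    then show ?thesis
      by (rule bounded_curve_SucI[rotated]) (rule DERIV_chain2[OF F'(1) X'(1)])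
  qed
  then show ?thesis using C'(1) by (intro exI[of _ C'] conjI allI impI exI)
qed

text \<open>Induction on the order of differentiation. Once the lower orders are bounded along all
  orbits by a common M, the top order obeys a linear recursion with factor 1 + \<delta> * K and
  increment \<delta> * Q, and Gronwall with m * \<delta> <= T removes the dependence on the step
  size and the number of steps. Order 0 is vacuous, since curves may be unbounded.\<close>

lemma bounded_curve_orbit:
  fixes T :: real
  assumes T: "0 < T"
  shows "\<exists>C\<ge>0. \<forall>e \<delta> m X V. 0 < \<delta> \<and> real m * \<delta> \<le> T \<and> (\<forall>j<m. bounded_curve k A A (e j)) \<and>
     bounded_curve k B B X \<and> bounded_curve k B B V \<longrightarrow>
     (\<forall>j\<le>m. bounded_curve k C C (\<lambda>s. fst (orbit e \<delta> (X s, V s) j)) \<and>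
            bounded_curve k C C (\<lambda>s. snd (orbit e \<delta> (X s, V s) j)))"
proof (induction k)
  case 0
  show ?case by (intro exI[of _ 0]) auto
next
  case (Suc k)
  then obtain M where M: "0 \<le> M" and M_all: "\<forall>e \<delta> m X V. 0 < \<delta> \<and> real m * \<delta> \<le> T \<and> (\<forall>j<m. bounded_curve k A A (e j)) \<and>
     bounded_curve k B B X \<and> bounded_curve k B B V \<longrightarrow>
     (\<forall>j\<le>m. bounded_curve k M M (\<lambda>s. fst (orbit e \<delta> (X s, V s) j)) \<and>
            bounded_curve k M M (\<lambda>s. snd (orbit e \<delta> (X s, V s) j)))"
    by (elim exE conjE)
  have low: "bounded_curve k M M (\<lambda>s. fst (orbit e \<delta> (X s, V s) j)) \<and>
     bounded_curve k M M (\<lambda>s. snd (orbit e \<delta> (X s, V s) j))"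
    if "0 < \<delta>" "real m * \<delta> \<le> T" "\<And>j. j < m \<Longrightarrow> bounded_curve k A A (e j)"
      "bounded_curve k B B X" "bounded_curve k B B V" "j \<le> m" for e \<delta> m X V j
    by (rule M_all[rule_format, OF _ that(6)]) (use that in auto)
  \<comment> \<open>Bounds the lower derivatives of the intermediate position \<open>y\<close>,
    reached by half a step of free transport.\<close>
  define M' where "M' = M + T * M"
  obtain C where C: "0 \<le> C" and comp: "\<And>F X N. bounded_curve (Suc k) A A F \<Longrightarrow> bounded_curve (Suc k) M' N X \<Longrightarrow> 0 \<le> N \<Longrightarrow>
     \<exists>B. bounded_curve (Suc k) B (C * N + C) (\<lambda>s. F (X s))"
    using bounded_curve_compose[of k A M'] by blast
  \<comment> \<open>Chosen to give \<open>(1 + \<delta> * K) * n + \<delta> * Q = n + \<delta> * ((1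
    + T) * (n + a))\<close>, where \<open>a = C * (1 + T) * n + C\<close> bounds the top derivative
    of the field along \<open>y\<close>.\<close>
  define K where "K = (1 + T) * (1 + C * (1 + T))"
  define Q where "Q = (1 + T) * C"
  have KQ: "0 \<le> K" "0 \<le> Q" unfolding K_def Q_def using T C by auto
  define top where "top = exp (K * T) * (\<bar>B\<bar> + T * Q)"
  define C' where "C' = max M top"
  have "bounded_curve (Suc k) C' C' (\<lambda>s. fst (orbit e \<delta> (X s, V s) j)) \<and>
        bounded_curve (Suc k) C' C' (\<lambda>s. snd (orbit e \<delta> (X s, V s) j))"
    if \<delta>: "0 < \<delta>" and m: "real m * \<delta> \<le> T" and e: "\<And>j. j < m \<Longrightarrow> bounded_curve (Suc k) A A (e j)"
      and X: "bounded_curve (Suc k) B B X" and V: "bounded_curve (Suc k) B B V" and j: "j \<le> m" for e \<delta> m X V j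
  proof -
    define x where "x j s = fst (orbit e \<delta> (X s, V s) j)" for j s
    define v where "v j s = snd (orbit e \<delta> (X s, V s) j)" for j s
    have lowj: "bounded_curve k M M (x j)" "bounded_curve k M M (v j)" if "j \<le> m" for j
      using low[OF \<delta> m, of e X V j] that bounded_curve_lower[OF e] bounded_curve_lower[OF X] bounded_curve_lower[OF V]
      unfolding x_def v_def by auto
    \<comment> \<open>The recursion of the top order taken with equality, started at the absolute
      value of B to remain non-negative.\<close>
    define N where "N = rec_nat \<bar>B\<bar> (\<lambda>_ n. (1 + \<delta> * K) * n + \<delta> * Q)"
    have N0: "N 0 = \<bar>B\<bar>" and NS: "N (Suc j) = (1 + \<delta> * K) * N j + \<delta> * Q" for j unfolding N_def by simp_all
    have Npos: "0 \<le> N j" for j by (induction j) (use \<delta> KQ in \<open>auto simp: N0 NS\<close>)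
    have "j \<le> m \<Longrightarrow> bounded_curve (Suc k) M (N j) (x j) \<and> bounded_curve (Suc k) M (N j) (v j)" for j
    proof (induction j)
      case 0
      have "bounded_curve (Suc k) B \<bar>B\<bar> (x 0)" "bounded_curve (Suc k) B \<bar>B\<bar> (v 0)"
        unfolding x_def v_def using bounded_curve_mono[OF X, of B "\<bar>B\<bar>"] bounded_curve_mono[OF V, of B "\<bar>B\<bar>"]
        by auto
      then show ?case using bounded_curve_top[OF lowj(1)] bounded_curve_top[OF lowj(2)] by (auto simp: N0)
    next
      case (Suc j)
      then have IH: "bounded_curve (Suc k) M (N j) (x j)" "bounded_curve (Suc k) M (N j) (v j)" by auto
      have "1 * \<delta> \<le> real m * \<delta>" using Suc.prems \<delta> by (intro mult_right_mono) auto
      then have \<delta>T: "\<delta> \<le> T" using m by linarith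
      define n where "n = N j"
      have n: "0 \<le> n" unfolding n_def by (rule Npos)
      define y where "y s = x j s - \<delta> / 2 * v j s" for s
      have y1: "bounded_curve (Suc k) (M + \<bar>\<delta> / 2\<bar> * M) (n + \<bar>\<delta> / 2\<bar> * n) y"
        unfolding y_def n_def by (rule bounded_curve_diff_cmult[OF IH])
      have half: "\<bar>\<delta> / 2\<bar> = \<delta> / 2" using \<delta> by simp
      have "\<delta> / 2 * M \<le> T * M" using \<delta> \<delta>T M by (intro mult_right_mono) auto
      then have y: "bounded_curve (Suc k) M' (n + \<delta> / 2 * n) y"
        using y1 unfolding half M'_def by (elim bounded_curve_mono) auto
      obtain B' where "bounded_curve (Suc k) B' (C * (n + \<delta> / 2 * n) + C) (\<lambda>s. e j (y s))"
      proof -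
        have "j < m" "0 \<le> n + \<delta> / 2 * n" using Suc.prems n \<delta> by auto
        then show ?thesis using comp[OF e y] that by blast
      qed
      then have v1: "bounded_curve (Suc k) (M + \<bar>\<delta>\<bar> * B') (n + \<bar>\<delta>\<bar> * (C * (n + \<delta> / 2 * n) + C)) (\<lambda>s. v j s - \<delta> * e j (y s))"
        unfolding n_def by (rule bounded_curve_diff_cmult[OF IH(2)])
      have vS: "v (Suc j) = (\<lambda>s. v j s - \<delta> * e j (y s))" "x (Suc j) = (\<lambda>s. y s - \<delta> / 2 * v (Suc j) s)"
        unfolding v_def x_def y_def by (auto simp: Let_def fun_eq_iff)
      define w where "w = n + \<delta> * (C * (n + \<delta> / 2 * n) + C)"
      have v2: "bounded_curve (Suc k) (M + \<bar>\<delta>\<bar> * B') w (v (Suc j))"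
        using v1 \<delta> unfolding vS w_def by simp
      have x2: "bounded_curve (Suc k) (M' + \<bar>\<delta> / 2\<bar> * (M + \<bar>\<delta>\<bar> * B')) (n + \<delta> / 2 * n + \<delta> / 2 * w) (x (Suc j))"
        using bounded_curve_diff_cmult[OF y v2, of "\<delta> / 2"] unfolding vS(2) half .
      have core: "C * (n + \<delta> / 2 * n) + C \<le> C * (1 + T) * n + C"
      proof -
        have "\<delta> / 2 * n \<le> T * n" using \<delta> \<delta>T n by (intro mult_right_mono) auto
        then have "C * (n + \<delta> / 2 * n) \<le> C * (n + T * n)" using C by (intro mult_left_mono) auto
        then show ?thesis by (simp add: algebra_simps)
      qed
      define a where "a = C * (1 + T) * n + C"
      have a: "0 \<le> a" unfolding a_def using C T n by simp
      have w: "w \<le> n + \<delta> * a" unfolding w_def a_def using core \<delta> by (intro add_left_mono mult_left_mono) auto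
      have Na: "(1 + \<delta> * K) * n + \<delta> * Q = n + \<delta> * ((1 + T) * (n + a))"
        unfolding K_def Q_def a_def by (simp add: algebra_simps)
      have wN: "w \<le> N (Suc j)"
      proof -
        have "a \<le> (1 + T) * (n + a)" using T n a by (simp add: algebra_simps)
        then have "\<delta> * a \<le> \<delta> * ((1 + T) * (n + a))" using \<delta> by (intro mult_left_mono) auto
        then show ?thesis using w unfolding NS n_def[symmetric] Na by linarith
      qed
      have xN: "n + \<delta> / 2 * n + \<delta> / 2 * w \<le> N (Suc j)"
      proof -
        have "w \<le> n + T * a" using w mult_right_mono[OF \<delta>T a] by linarith
        then have "\<delta> / 2 * w \<le> \<delta> / 2 * (n + T * a)" using \<delta> by (intro mult_left_mono) auto
        then have "n + \<delta> / 2 * n + \<delta> / 2 * w \<le> n + \<delta> * (n + T / 2 * a)" by (simp add: algebra_simps)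
        also have "\<dots> \<le> n + \<delta> * ((1 + T) * (n + a))"
        proof -
          have "T / 2 * a \<le> T * a" using T a by (intro mult_right_mono) auto
          moreover have "(1 + T) * (n + a) = n + T * n + a + T * a" by (simp add: algebra_simps)
          ultimately have "n + T / 2 * a \<le> (1 + T) * (n + a)"
            using mult_nonneg_nonneg[of T n] mult_nonneg_nonneg[of T a] T n a by linarith
          then show ?thesis using \<delta> by (intro add_left_mono mult_left_mono) auto
        qed
        finally show ?thesis unfolding NS n_def[symmetric] Na .
      qed
      \<comment> \<open>\<open>bounded_curve_top\<close> replaces the lower-order bounds, which
        would deteriorate in every step, by the uniform M of the outer induction.\<close>
      show ?case
        using bounded_curve_mono[OF bounded_curve_top[OF lowj(1)[OF Suc.prems] x2] order_refl xN]
          bounded_curve_mono[OF bounded_curve_top[OF lowj(2)[OF Suc.prems] v2] order_refl wN] by blast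
    qed
    then have fin: "bounded_curve (Suc k) M (N j) (x j)" "bounded_curve (Suc k) M (N j) (v j)" using j by auto
    have "N j \<le> exp (\<delta> * K * real j) * (N 0 + real j * (\<delta> * Q))"
      using \<delta> KQ by (intro discrete_gronwall[where N=j]) (auto simp: NS N0)
    also have "\<dots> \<le> exp (K * T) * (\<bar>B\<bar> + T * Q)"
    proof -
      have jT: "real j * \<delta> \<le> T"
        using mult_right_mono[of "real j" "real m" \<delta>] j \<delta> m by linarith
      have eqs: "\<delta> * K * real j = K * (real j * \<delta>)" "real j * (\<delta> * Q) = (real j * \<delta>) * Q" by (simp_all add: mult_ac)
      have "K * (real j * \<delta>) \<le> K * T" "(real j * \<delta>) * Q \<le> T * Q"
        using jT KQ by (auto intro: mult_left_mono mult_right_mono)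
      then have "exp (\<delta> * K * real j) \<le> exp (K * T)" "N 0 + real j * (\<delta> * Q) \<le> \<bar>B\<bar> + T * Q"
        unfolding N0 eqs by simp_all
      moreover have "0 \<le> N 0 + real j * (\<delta> * Q)" unfolding N0 using KQ \<delta> by simp
      ultimately show ?thesis by (intro mult_mono) auto
    qed
    finally have "N j \<le> C'" unfolding C'_def top_def by simp
    then show ?thesis
      using bounded_curve_mono[OF fin(1), of C' C'] bounded_curve_mono[OF fin(2), of C' C']
      unfolding x_def v_def C'_def by simp
  qed
  note main = this
  have "0 \<le> C'" unfolding C'_def using M by simp
  show ?case
    by (intro exI[of _ C'] conjI[OF \<open>0 \<le> C'\<close>] allI impI, elim conjE, rule main; (assumption | blast))
qed

section \<open>Smooth functions along curves and integrals with a parameter\<close>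

lemma C_k_imp_continuous: "C_k k f \<Longrightarrow> continuous_on UNIV f"
  by (cases k) (auto intro: differentiable_imp_continuous_on)

lemma C_k_Suc: "C_k (Suc k) f \<Longrightarrow> C_k k f"
proof (induction k arbitrary: f)
  case 0
  then show ?case using C_k_imp_continuous[OF 0] by simp
next
  case (Suc k)
  from Suc.prems have "f differentiable_on UNIV" "\<And>b. b \<in> Basis \<Longrightarrow> C_k (Suc k) (\<lambda>z. frechet_derivative f (at z) b)"
    by (simp_all only: C_k.simps(2)[of "Suc k"])
  then show ?case using Suc.IH by simp
qed

lemma C_k_le: "C_k k f \<Longrightarrow> j \<le> k \<Longrightarrow> C_k j f"
  by (induction k) (auto simp: le_Suc_eq simp del: C_k.simps intro: C_k_Suc)

lemma periodic_supported_bounded: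
  assumes cont: "continuous_on UNIV g" and per: "x_periodic L g" and supp: "v_supported R g" and L: "0 < L"
  shows "\<exists>B\<ge>0. \<forall>z. \<bar>g z\<bar> \<le> B"
proof -
  have "compact (g ` ({0..L} \<times> {- R..R}))"
    using cont by (intro compact_continuous_image compact_Times) (auto intro: continuous_on_subset)
  then obtain B where B: "\<And>y. y \<in> g ` ({0..L} \<times> {- R..R}) \<Longrightarrow> norm y \<le> B"
    using compact_imp_bounded bounded_iff by metis
  have "\<bar>g (x, v)\<bar> \<le> \<bar>B\<bar>" for x v
  proof (cases "\<bar>v\<bar> \<le> R")
    case True
    have "g (x, v) = g (wrap L x, v)" by (rule x_periodic_wrap[OF per, symmetric])
    moreover have "(wrap L x, v) \<in> {0..L} \<times> {- R..R}" using wrap_bounds[OF L, of x] True by auto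
    ultimately show ?thesis using B[of "g (x, v)"] by auto
  next
    case False
    then show ?thesis using supp unfolding v_supported_def by auto
  qed
  then show ?thesis by (intro exI[of _ "\<bar>B\<bar>"]) auto
qed

text \<open>Turns \<open>C_k\<close> regularity into bounds along curves. The chain rule leads to
  the partial derivatives along the curve; they inherit periodicity and support, so the induction
  hypothesis applies to them, and compactness of one period of the strip yields the bounds.\<close>

lemma C_k_compose_curves:
  fixes f :: phase_fun
  assumes "C_k k f" "x_periodic L f" "v_supported R f" "0 < L"
  shows "\<exists>C\<ge>0. \<forall>X V. bounded_curve k B B X \<longrightarrow> bounded_curve k B B V \<longrightarrow> bounded_derivs k C C (\<lambda>s. f (X s, V s))"
  using assms(1-3)
proof (induction k arbitrary: f)
  case 0
  obtain C where "0 \<le> C" "\<And>z. \<bar>f z\<bar> \<le> C"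
    using periodic_supported_bounded[OF C_k_imp_continuous[OF 0(1)] 0(2,3) assms(4)] by blast
  then show ?case by (intro exI[of _ C]) auto
next
  case (Suc k)
  define D where "D z = frechet_derivative f (at z)" for z
  have D: "(f has_derivative D z) (at z)" for z
  proof -
    have "f differentiable_on UNIV" using Suc.prems(1) by simp
    then have "f differentiable (at z)" unfolding differentiable_on_def by blast
    then show ?thesis unfolding D_def by (rule frechet_derivative_works[THEN iffD1])
  qed
  have CkD: "C_k k (\<lambda>z. D z b)" if "b \<in> Basis" for b
    using Suc.prems(1) that unfolding D_def by simp
  have basis: "(1, 0) \<in> (Basis :: (real \<times> real) set)" "(0, 1) \<in> (Basis :: (real \<times> real) set)"
    unfolding Basis_prod_def by auto
  have D_per: "D (x + L, v) = D (x, v)" for x v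
  proof -
    have "((\<lambda>z. f (z + (L, 0))) has_derivative (\<lambda>h. D ((x, v) + (L, 0)) (id h))) (at (x, v))"
      by (rule has_derivative_compose[OF _ D]) (auto intro!: derivative_eq_intros)
    moreover have "(\<lambda>z. f (z + (L, 0))) = f"
      using Suc.prems(2) unfolding x_periodic_def by (auto simp: fun_eq_iff)
    ultimately have "(f has_derivative D (x + L, v)) (at (x, v))" by simp
    then show ?thesis using D has_derivative_unique by blast
  qed
  have D_supp: "D (x, v) = (\<lambda>h. 0)" if "R < \<bar>v\<bar>" for x v
  proof -
    have "open {z :: real \<times> real. R < \<bar>snd z\<bar>}" by (intro open_Collect_less continuous_intros)
    then have "(f has_derivative (\<lambda>h. 0)) (at (x, v))"
      using Suc.prems(3) that unfolding v_supported_def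
      by (intro has_derivative_transform_within_open[OF has_derivative_const[of 0]]) auto
    then show ?thesis using D has_derivative_unique by blast
  qed
  have IH: "\<exists>C\<ge>0. \<forall>X V. bounded_curve k B B X \<longrightarrow> bounded_curve k B B V \<longrightarrow> bounded_derivs k C C (\<lambda>s. D (X s, V s) b)"
    if "b \<in> Basis" for b
    by (rule Suc.IH[OF CkD[OF that]]) (auto simp: x_periodic_def v_supported_def D_per D_supp)
  obtain C1 where C1: "0 \<le> C1" "\<And>X V. bounded_curve k B B X \<Longrightarrow> bounded_curve k B B V \<Longrightarrow> bounded_derivs k C1 C1 (\<lambda>s. D (X s, V s) (1, 0))"
    using IH[OF basis(1)] by blast
  obtain C2 where C2: "0 \<le> C2" "\<And>X V. bounded_curve k B B X \<Longrightarrow> bounded_curve k B B V \<Longrightarrow> bounded_derivs k C2 C2 (\<lambda>s. D (X s, V s) (0, 1))"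
    using IH[OF basis(2)] by blast
  obtain C0 where C0: "0 \<le> C0" "\<And>z. \<bar>f z\<bar> \<le> C0"
    using periodic_supported_bounded[OF C_k_imp_continuous[OF Suc.prems(1)] Suc.prems(2,3) assms(4)] by blast
  define Q where "Q c = c * \<bar>B\<bar> + real k * 2 ^ k * c * \<bar>B\<bar>" for c
  define C where "C = C0 + (2 ^ k * C1 * \<bar>B\<bar> + 2 ^ k * C2 * \<bar>B\<bar>) + (Q C1 + Q C2)"
  have pos: "0 \<le> 2 ^ k * C1 * \<bar>B\<bar> + 2 ^ k * C2 * \<bar>B\<bar>" "0 \<le> Q C1 + Q C2"
    using C1(1) C2(1) unfolding Q_def by auto
  have "bounded_derivs (Suc k) C C (\<lambda>s. f (X s, V s))"
    if X: "bounded_curve (Suc k) B B X" and V: "bounded_curve (Suc k) B B V" for X V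
  proof -
    obtain X' where X': "\<And>x. (X has_real_derivative X' x) (at x)" "bounded_derivs k B B X'"
      using bounded_curve_SucE[OF X] by blast
    obtain V' where V': "\<And>x. (V has_real_derivative V' x) (at x)" "bounded_derivs k B B V'"
      using bounded_curve_SucE[OF V] by blast
    note low = bounded_curve_lower[OF X] bounded_curve_lower[OF V]
    have "bounded_derivs k \<bar>B\<bar> \<bar>B\<bar> X'" "bounded_derivs k \<bar>B\<bar> \<bar>B\<bar> V'"
      using X'(2) V'(2) by (auto elim: bounded_derivs_mono)
    then have "bounded_derivs k (2 ^ k * C1 * \<bar>B\<bar> + 2 ^ k * C2 * \<bar>B\<bar>) (Q C1 + Q C2)
        (\<lambda>s. D (X s, V s) (1, 0) * X' s + D (X s, V s) (0, 1) * V' s)"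
      unfolding Q_def by (intro bounded_derivs_add bounded_derivs_mult C1(2) C2(2) low)
    then have bd: "bounded_derivs k C C (\<lambda>s. D (X s, V s) (1, 0) * X' s + D (X s, V s) (0, 1) * V' s)"
      by (rule bounded_derivs_mono) (use pos C0(1) in \<open>auto simp: C_def\<close>)
    have der: "((\<lambda>s. f (X s, V s)) has_real_derivative D (X s, V s) (1, 0) * X' s + D (X s, V s) (0, 1) * V' s) (at s)" for s
    proof -
      have "((\<lambda>s. (X s, V s)) has_derivative (\<lambda>h. (X' s * h, V' s * h))) (at s)"
        using X'(1)[of s] V'(1)[of s] by (intro has_derivative_Pair) (auto simp: has_field_derivative_def)
      then have "((\<lambda>s. f (X s, V s)) has_derivative (\<lambda>h. D (X s, V s) (X' s * h, V' s * h))) (at s)"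
        by (rule has_derivative_compose) (rule D)
      moreover have "D (X s, V s) (X' s * h, V' s * h) = (D (X s, V s) (1, 0) * X' s + D (X s, V s) (0, 1) * V' s) * h" for h
      proof -
        interpret l: linear "D (X s, V s)" using D has_derivative_linear by blast
        have "D (X s, V s) ((X' s * h) *\<^sub>R (1, 0) + (V' s * h) *\<^sub>R (0, 1)) =
           (X' s * h) *\<^sub>R D (X s, V s) (1, 0) + (V' s * h) *\<^sub>R D (X s, V s) (0, 1)"
          by (simp only: l.add l.scale)
        then show ?thesis by (simp add: algebra_simps)
      qed
      ultimately show ?thesis unfolding has_field_derivative_def by simp
    qed
    have "\<bar>f (X s, V s)\<bar> \<le> C" for s
      using C0(2)[of "(X s, V s)"] pos unfolding C_def by linarith
    then show ?thesis by (rule bounded_derivs_SucI[OF _ der bd])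
  qed
  moreover have "0 \<le> C" unfolding C_def using C0(1) pos by linarith
  ultimately show ?case by blast
qed

text \<open>Dominated convergence for difference quotients. The derivative is known for each v
  separately, with no regularity in v, so a rule requiring its joint continuity cannot be applied;
  its measurability comes from being a limit of quotients.\<close>

lemma integral_parameter_derivative:
  fixes g g' :: "real \<Rightarrow> real \<Rightarrow> real"
  assumes der: "\<And>x v. ((\<lambda>x. g x v) has_real_derivative g' x v) (at x)" and bnd: "\<And>x v. \<bar>g' x v\<bar> \<le> C"
    and gb: "\<And>x v. \<bar>g x v\<bar> \<le> B"
    and [measurable]: "\<And>x. g x \<in> borel_measurable borel"
  shows "g' x \<in> borel_measurable borel"
    and "((\<lambda>x. LINT v:{-S..S}|lborel. g x v) has_real_derivative (LINT v:{-S..S}|lborel. g' x v)) (at x)"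
proof -
  have lim: "(\<lambda>n. (g (x + s n) v - g x v) / s n) \<longlonglongrightarrow> g' x v"
    if "\<And>n. s n \<noteq> 0" "s \<longlonglongrightarrow> 0" for s :: "nat \<Rightarrow> real" and x v
    using der[of v x] that unfolding DERIV_def
    using LIMSEQ_SEQ_conv[of "0::real" "\<lambda>h. (g (x + h) v - g x v) / h" "g' x v"] by blast
  \<comment> \<open>One sequence of non-zero increments suffices to exhibit \<open>g' x\<close> as a
    pointwise limit.\<close>
  have inv: "(\<lambda>n. 1 / real (Suc n)) \<longlonglongrightarrow> 0" using LIMSEQ_Suc[OF lim_1_over_n] by simp
  show m: "g' x \<in> borel_measurable borel" for x
    by (rule borel_measurable_LIMSEQ_real[OF lim[OF _ inv]]) auto
  have si: "set_integrable lborel {-S..S} h" if [measurable]: "h \<in> borel_measurable borel" and "\<And>v. \<bar>h v\<bar> \<le> K" for h :: "real \<Rightarrow> real" and K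
  proof (rule set_integrable_bound)
    show "set_integrable lborel {-S..S} (\<lambda>v. K)"
      unfolding set_integrable_def by (intro integrable_scaleR_left integrable_real_indicator) (auto simp: emeasure_lborel_Icc_eq)
  qed (use that in \<open>auto simp: set_borel_measurable_def intro!: AE_I2 intro: order_trans[OF _ abs_ge_self]\<close>)
  show "((\<lambda>x. LINT v:{-S..S}|lborel. g x v) has_real_derivative (LINT v:{-S..S}|lborel. g' x v)) (at x)"
    unfolding DERIV_def
  proof (rule LIMSEQ_SEQ_conv[THEN iffD1], intro allI impI, elim conjE)
    fix s :: "nat \<Rightarrow> real" assume s: "\<forall>n. s n \<noteq> 0" "s \<longlonglongrightarrow> 0"
    have conv: "(\<lambda>n. LINT v|lborel. indicator {-S..S} v *\<^sub>R ((g (x + s n) v - g x v) / s n)) \<longlonglongrightarrow> (LINT v|lborel. indicator {-S..S} v *\<^sub>R g' x v)"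
    proof (rule integral_dominated_convergence)
      note [measurable] = m[of x]
      show "(\<lambda>v. indicator {-S..S} v *\<^sub>R g' x v) \<in> borel_measurable lborel" by measurable
      show "(\<lambda>v. indicator {-S..S} v *\<^sub>R ((g (x + s n) v - g x v) / s n)) \<in> borel_measurable lborel" for n by measurable
      show "integrable lborel (\<lambda>v. indicator {-S..S} v *\<^sub>R C)"
        by (intro integrable_scaleR_left integrable_real_indicator) (auto simp: emeasure_lborel_Icc_eq)
      show "AE v in lborel. (\<lambda>n. indicator {-S..S} v *\<^sub>R ((g (x + s n) v - g x v) / s n)) \<longlonglongrightarrow> indicator {-S..S} v *\<^sub>R g' x v"
        by (intro AE_I2 tendsto_intros lim) (use s in auto)
      show "AE v in lborel. norm (indicator {-S..S} v *\<^sub>R ((g (x + s n) v - g x v) / s n)) \<le> indicator {-S..S} v *\<^sub>R C" for n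
      proof (intro AE_I2)
        fix v
        have "\<bar>g (x + s n) v - g x v - 0 * (x + s n - x)\<bar> \<le> C * \<bar>x + s n - x\<bar>"
          by (rule derivative_approx[where S=UNIV and g="\<lambda>x. g x v"]) (use der bnd in auto)
        then have "\<bar>(g (x + s n) v - g x v) / s n\<bar> \<le> C"
          using s(1) by (simp add: abs_divide divide_le_eq)
        then show "norm (indicator {-S..S} v *\<^sub>R ((g (x + s n) v - g x v) / s n)) \<le> indicator {-S..S} v *\<^sub>R C"
          by (auto split: split_indicator)
      qed
    qed
    have quot: "(LINT v|lborel. indicator {-S..S} v *\<^sub>R ((g (x + s n) v - g x v) / s n))
       = ((LINT v:{-S..S}|lborel. g (x + s n) v) - (LINT v:{-S..S}|lborel. g x v)) / s n" for n
    proof -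
      have d: "((LINT v:{-S..S}|lborel. g (x + s n) v) - (LINT v:{-S..S}|lborel. g x v)) = (LINT v:{-S..S}|lborel. g (x + s n) v - g x v)"
        by (rule set_integral_diff(2)[symmetric]; rule si[OF _ gb]) auto
      have "(LINT v|lborel. indicator {-S..S} v *\<^sub>R ((g (x + s n) v - g x v) / s n))
          = (LINT v|lborel. (indicator {-S..S} v *\<^sub>R (g (x + s n) v - g x v)) / s n)" by simp
      also have "\<dots> = (LINT v:{-S..S}|lborel. g (x + s n) v - g x v) / s n"
        unfolding set_lebesgue_integral_def by (rule integral_divide_zero)
      finally show ?thesis unfolding d .
    qed
    show "(\<lambda>n. ((LINT v:{-S..S}|lborel. g (x + s n) v) - (LINT v:{-S..S}|lborel. g x v)) / s n) \<longlonglongrightarrow> (LINT v:{-S..S}|lborel. g' x v)"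
      using conv[unfolded quot] by (simp only: set_lebesgue_integral_def)
  qed
qed

lemma bounded_derivs_integral:
  fixes g :: "real \<Rightarrow> real \<Rightarrow> real"
  assumes "\<And>v. bounded_derivs k C C (\<lambda>x. g x v)" "\<And>x. g x \<in> borel_measurable borel" "0 \<le> S"
  shows "bounded_derivs k (2 * S * C) (2 * S * C) (\<lambda>x. LINT v:{-S..S}|lborel. g x v)"
  using assms(1,2)
proof (induction k arbitrary: g)
  have int_bound: "\<bar>LINT v:{-S..S}|lborel. h v\<bar> \<le> 2 * S * C" if "\<And>v. \<bar>h v\<bar> \<le> C" "h \<in> borel_measurable borel" for h :: "real \<Rightarrow> real"
  proof -
    note [measurable] = that(2)
    have C: "0 \<le> C" using that(1)[of 0] by linarith
    have cint: "integrable lborel (\<lambda>v. indicator {-S..S} v *\<^sub>R C)"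
      by (intro integrable_scaleR_left integrable_real_indicator) (auto simp: emeasure_lborel_Icc_eq)
    have "norm (LINT v:{-S..S}|lborel. h v) \<le> (LINT v|lborel. indicator {-S..S} v *\<^sub>R C)"
      unfolding set_lebesgue_integral_def
    proof (rule Bochner_Integration.integral_norm_bound_integral[OF _ cint])
      show "integrable lborel (\<lambda>v. indicator {-S..S} v *\<^sub>R h v)"
        by (rule Bochner_Integration.integrable_bound[OF cint])
           (use that(1) in \<open>auto intro!: AE_I2 intro: order_trans[OF _ abs_ge_self] split: split_indicator\<close>)
      show "norm (indicator {-S..S} v *\<^sub>R h v) \<le> indicator {-S..S} v *\<^sub>R C" for v
        using that(1)[of v] by (auto split: split_indicator)
    qed
    then show ?thesis using \<open>0 \<le> S\<close> by simp
  qed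
  {
    case 0
    then show ?case using int_bound by simp
  next
    case (Suc k)
    have "\<forall>v. \<exists>g'. (\<forall>x. ((\<lambda>x. g x v) has_real_derivative g' x) (at x)) \<and> bounded_derivs k C C g'"
      using Suc.prems(1) by simp
    then obtain g' where g': "\<And>v x. ((\<lambda>x. g x v) has_real_derivative g' v x) (at x)" "\<And>v. bounded_derivs k C C (g' v)"
      by metis
    have gb: "\<bar>g x v\<bar> \<le> C" for x v using Suc.prems(1)[of v] by simp
    have gb': "\<bar>g' v x\<bar> \<le> C" for x v using g'(2)[of v] by (cases k) auto
    note ipd = integral_parameter_derivative[where g=g and g'="\<lambda>x v. g' v x", OF g'(1) gb' gb Suc.prems(2)]
    show ?case
    proof (rule bounded_derivs_SucI)
      show "\<bar>LINT v:{-S..S}|lborel. g x v\<bar> \<le> 2 * S * C" for x by (rule int_bound[OF gb Suc.prems(2)])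
      show "((\<lambda>x. LINT v:{-S..S}|lborel. g x v) has_real_derivative (LINT v:{-S..S}|lborel. g' v x)) (at x)" for x by (rule ipd(2))
      show "bounded_derivs k (2 * S * C) (2 * S * C) (\<lambda>x. LINT v:{-S..S}|lborel. g' v x)"
        by (rule Suc.IH[where g="\<lambda>x v. g' v x"]) (use g'(2) ipd(1) in auto)
    qed
  }
qed

section \<open>Bootstrap between densities and fields\<close>

context semidiscrete
begin

text \<open>Characteristics run backwards: step i of the orbit uses the field of time step m - 1 -
  i, and after j steps m - j time steps are left.\<close>

lemma scheme_eq_orbit:
  assumes "j \<le> m"
  shows "scheme \<delta> (m - j) (orbit (\<lambda>i. E_field L (exp_A (\<delta> / 2) (scheme \<delta> (m - 1 - i)))) \<delta> z j) = scheme \<delta> m z"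
  using assms
proof (induction j)
  case (Suc j)
  let ?o = "orbit (\<lambda>i. E_field L (exp_A (\<delta> / 2) (scheme \<delta> (m - 1 - i)))) \<delta> z"
  have "m - j = Suc (m - Suc j)" "m - 1 - j = m - Suc j" using Suc.prems by auto
  moreover obtain x v where o: "?o j = (x, v)" by (cases "?o j")
  ultimately have "scheme \<delta> (m - j) (?o j) = scheme \<delta> (m - Suc j) (?o (Suc j))"
    by (simp add: scheme_Suc exp_A_def exp_B_def Let_def)
  then show ?case using Suc by simp
qed simp

lemma scheme_eq_orbit_f0:
  "scheme \<delta> m z = f0 (orbit (\<lambda>i. E_field L (exp_A (\<delta> / 2) (scheme \<delta> (m - 1 - i)))) \<delta> z m)"
  using scheme_eq_orbit[of m m \<delta> z] by (simp add: scheme_0)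

text \<open>The shear \<sigma> covers two cases: \<delta>/2 for the fields of the scheme itself, and
  \<tau>/2 for the field of a step of another size \<tau> started from one of its iterates.\<close>

definition field_regular :: "nat \<Rightarrow> real \<Rightarrow> bool" where
  "field_regular k A \<longleftrightarrow> (\<forall>\<delta> m \<sigma>. 0 < \<delta> \<and> real m * \<delta> \<le> T \<and> 0 \<le> \<sigma> \<and> \<sigma> \<le> T \<longrightarrow>
     bounded_curve k A A (E_field L (exp_A \<sigma> (scheme \<delta> m))))"

text \<open>By \<open>scheme_eq_orbit_f0\<close> an iterate is \<open>f0\<close> at the end of an
  orbit, so the orbit bound and the smoothness of \<open>f0\<close> combine.\<close>

lemma scheme_curve_regular:
  assumes A: "field_regular k A" and f0: "C_k k f0"
  shows "\<exists>C\<ge>0. \<forall>\<delta> m X V. 0 < \<delta> \<and> real m * \<delta> \<le> T \<and> bounded_curve k B B X \<and> bounded_curve k B B V \<longrightarrow>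
     bounded_derivs k C C (\<lambda>s. scheme \<delta> m (X s, V s))"
proof -
  obtain C where orb: "\<forall>e \<delta> m X V. 0 < \<delta> \<and> real m * \<delta> \<le> T \<and> (\<forall>j<m. bounded_curve k A A (e j)) \<and>
     bounded_curve k B B X \<and> bounded_curve k B B V \<longrightarrow>
     (\<forall>j\<le>m. bounded_curve k C C (\<lambda>s. fst (orbit e \<delta> (X s, V s) j)) \<and>
            bounded_curve k C C (\<lambda>s. snd (orbit e \<delta> (X s, V s) j)))"
    using bounded_curve_orbit[OF T, of k A B] by (elim exE conjE)
  obtain C' where C': "0 \<le> C'" "\<And>X V. bounded_curve k C C X \<Longrightarrow> bounded_curve k C C V \<Longrightarrow> bounded_derivs k C' C' (\<lambda>s. f0 (X s, V s))"
    using C_k_compose_curves[OF f0 f0_periodic f0_supp L, of C] by blast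
  have "bounded_derivs k C' C' (\<lambda>s. scheme \<delta> m (X s, V s))"
    if \<delta>: "0 < \<delta>" "real m * \<delta> \<le> T" and X: "bounded_curve k B B X" and V: "bounded_curve k B B V" for \<delta> m X V
  proof -
    let ?e = "\<lambda>i. E_field L (exp_A (\<delta> / 2) (scheme \<delta> (m - 1 - i)))"
    have e: "bounded_curve k A A (?e j)" if j: "j < m" for j
    proof -
      have "real (m - 1 - j) * \<delta> \<le> real m * \<delta>" using \<delta> by (intro mult_right_mono) auto
      moreover have "1 * \<delta> \<le> real m * \<delta>" using j \<delta> by (intro mult_right_mono) auto
      ultimately have "real (m - 1 - j) * \<delta> \<le> T" "\<delta> / 2 \<le> T" using \<delta> by linarith+
      then show ?thesis using A \<delta> unfolding field_regular_def by simp
    qed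
    have "bounded_curve k C C (\<lambda>s. fst (orbit ?e \<delta> (X s, V s) m)) \<and> bounded_curve k C C (\<lambda>s. snd (orbit ?e \<delta> (X s, V s) m))"
      by (rule orb[rule_format, OF _ order_refl]) (use \<delta> e X V in auto)
    then have "bounded_derivs k C' C' (\<lambda>s. f0 (fst (orbit ?e \<delta> (X s, V s) m), snd (orbit ?e \<delta> (X s, V s) m)))"
      by (intro C'(2)) auto
    then show ?thesis unfolding scheme_eq_orbit_f0[of \<delta> m] by simp
  qed
  then show ?thesis using C'(1) by (intro exI[of _ C']) auto
qed

lemma bounded_curve_affine:
  "\<bar>a\<bar> \<le> B \<Longrightarrow> 0 \<le> B \<Longrightarrow> bounded_curve k B B (\<lambda>s. a * s + b)"
proof (cases k)
  case (Suc j)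
  assume "\<bar>a\<bar> \<le> B" "0 \<le> B"
  then show ?thesis unfolding Suc
    by (intro bounded_curve_SucI[where g'="\<lambda>_. a"] bounded_derivs_const) (auto intro!: derivative_eq_intros)
qed simp

lemma field_regular_Suc:
  assumes A: "field_regular k A" and f0: "C_k k f0"
  shows "\<exists>A'. field_regular (Suc k) A'"
proof -
  obtain C where C: "0 \<le> C" "\<And>\<delta> m X V. 0 < \<delta> \<Longrightarrow> real m * \<delta> \<le> T \<Longrightarrow> bounded_curve k 1 1 X \<Longrightarrow> bounded_curve k 1 1 V \<Longrightarrow>
     bounded_derivs k C C (\<lambda>s. scheme \<delta> m (X s, V s))"
    using scheme_curve_regular[OF assms, of 1] by blast
  have RR: "0 \<le> RR" unfolding RR_def using R T L by simp
  have "bounded_curve (Suc k) (2 * RR * C + 1) (2 * RR * C + 1) (E_field L (exp_A \<sigma> (scheme \<delta> m)))"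
    if \<delta>: "0 < \<delta>" "real m * \<delta> \<le> T" for \<delta> m \<sigma>
  proof (rule bounded_curve_SucI)
    note g = good_exp_A[OF good_scheme, of \<sigma> \<delta> m]
    show "(E_field L (exp_A \<sigma> (scheme \<delta> m)) has_real_derivative (LINT v|lborel. exp_A \<sigma> (scheme \<delta> m) (x, v)) - 1) (at x)" for x
      by (rule good_E_deriv[OF g])
    have supp: "v_supported RR (exp_A \<sigma> (scheme \<delta> m))"
      using scheme_supported[of \<delta> m] \<delta> by (intro v_supported_exp_A) auto
    have "(LINT v|lborel. exp_A \<sigma> (scheme \<delta> m) (x, v)) = (LINT v:{-RR..RR}|lborel. exp_A \<sigma> (scheme \<delta> m) (x, v))" for x
      unfolding set_lebesgue_integral_def
      by (intro Bochner_Integration.integral_cong) (use supp in \<open>auto simp: v_supported_def split: split_indicator\<close>)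
    moreover have "bounded_derivs k (2 * RR * C) (2 * RR * C) (\<lambda>x. LINT v:{-RR..RR}|lborel. exp_A \<sigma> (scheme \<delta> m) (x, v))"
    proof (rule bounded_derivs_integral[OF _ _ RR])
      fix v
      \<comment> \<open>For fixed v, free transport by \<sigma> only moves the horizontal line along
        itself; it stays affine with slopes 1 and 0.\<close>
      have "bounded_derivs k C C (\<lambda>s. scheme \<delta> m (1 * s + - (\<sigma> * v), 0 * s + v))"
        by (rule C(2)[OF \<delta>]) (rule bounded_curve_affine, simp, simp)+
      then show "bounded_derivs k C C (\<lambda>x. exp_A \<sigma> (scheme \<delta> m) (x, v))" unfolding exp_A_def by simp
    next
      fix x
      have [measurable]: "exp_A \<sigma> (scheme \<delta> m) \<in> borel_measurable borel"
        by (rule admissible_measurable[OF good_admissible[OF g]])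
      show "(\<lambda>v. exp_A \<sigma> (scheme \<delta> m) (x, v)) \<in> borel_measurable borel" by measurable
    qed
    ultimately have "bounded_derivs k (2 * RR * C) (2 * RR * C) (\<lambda>x. LINT v|lborel. exp_A \<sigma> (scheme \<delta> m) (x, v))" by simp
    from bounded_derivs_add[OF this bounded_derivs_const[of 1 1 "- 1" k]]
    show "bounded_derivs k (2 * RR * C + 1) (2 * RR * C + 1) (\<lambda>x. (LINT v|lborel. exp_A \<sigma> (scheme \<delta> m) (x, v)) - 1)"
      by simp
  qed
  then show ?thesis unfolding field_regular_def by blast
qed

text \<open>Starts at order 0, which demands nothing of the field; each round gains one order, as
  long as \<open>f0\<close> has the derivatives.\<close>

lemma field_regular_exists:
  assumes "C_k l f0" "k \<le> Suc l"
  shows "\<exists>A. field_regular k A"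
  using assms(2)
proof (induction k)
  case 0
  show ?case unfolding field_regular_def by auto
next
  case (Suc k)
  then show ?case using field_regular_Suc C_k_le[OF assms(1), of k] by auto
qed

text \<open>
  All functions of a splitting step of size \<open>\<tau>\<close> are shears of its result, so that it suffices to
  control the latter along straight lines.
\<close>

lemma scheme_line_regular:
  assumes f0: "C_k k f0"
  shows "\<exists>C\<ge>0. \<forall>\<delta> m \<tau> a. 0 < \<delta> \<and> real m * \<delta> \<le> T \<and> 0 < \<tau> \<and> \<tau> \<le> T \<and> a = exp_A (\<tau> / 2) (scheme \<delta> m) \<longrightarrow>
     (\<forall>w\<in>{scheme \<delta> m, a, exp_B L \<tau> a a, exp_A (\<tau> / 2) (exp_B L \<tau> a a)}. line_regular k C w)"
proof -
  \<comment> \<open>The straight lines below have slopes 0, 1 or \<tau>/2 in absolute value, all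
    bounded by \<open>B\<close>.\<close>
  define B where "B = 1 + T"
  have B: "0 \<le> B" "1 \<le> B" unfolding B_def using T by auto
  obtain A where A: "field_regular k A" using field_regular_exists[OF f0, of k] by auto
  obtain D where orb: "\<forall>e \<delta> m X V. 0 < \<delta> \<and> real m * \<delta> \<le> T \<and> (\<forall>j<m. bounded_curve k A A (e j)) \<and>
     bounded_curve k B B X \<and> bounded_curve k B B V \<longrightarrow>
     (\<forall>j\<le>m. bounded_curve k D D (\<lambda>s. fst (orbit e \<delta> (X s, V s) j)) \<and>
            bounded_curve k D D (\<lambda>s. snd (orbit e \<delta> (X s, V s) j)))"
    using bounded_curve_orbit[OF T, of k A B] by (elim exE conjE)
  define D' where "D' = max B D"
  obtain C where C: "0 \<le> C" "\<And>\<delta> m X V. 0 < \<delta> \<Longrightarrow> real m * \<delta> \<le> T \<Longrightarrow> bounded_curve k D' D' X \<Longrightarrow> bounded_curve k D' D' V \<Longrightarrow>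
     bounded_derivs k C C (\<lambda>s. scheme \<delta> m (X s, V s))"
    using scheme_curve_regular[OF A f0, of D'] by blast
  have "line_regular k C w"
    if \<delta>: "0 < \<delta>" "real m * \<delta> \<le> T" and \<tau>: "0 < \<tau>" "\<tau> \<le> T" and a: "a = exp_A (\<tau> / 2) (scheme \<delta> m)"
      and w: "w \<in> {scheme \<delta> m, a, exp_B L \<tau> a a, exp_A (\<tau> / 2) (exp_B L \<tau> a a)}" for \<delta> m \<tau> a w
  proof -
    have small: "\<bar>\<theta>\<bar> \<le> B" "\<bar>1\<bar> \<le> B" if "\<theta> \<in> {0, - (\<tau> / 2), \<tau> / 2}" for \<theta>
      using that \<tau> unfolding B_def by auto
    have plain: "bounded_derivs k C C (\<lambda>s. scheme \<delta> m (X s, V s))" if X: "bounded_curve k B B X" and V: "bounded_curve k B B V" for X V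
      by (intro C(2) \<delta> bounded_curve_mono[OF X] bounded_curve_mono[OF V]) (auto simp: D'_def)
    define c where "c = exp_A (\<tau> / 2) (exp_B L \<tau> a a)"
    have full: "bounded_derivs k C C (\<lambda>s. c (X s, V s))" if X: "bounded_curve k B B X" and V: "bounded_curve k B B V" for X V
    proof -
      let ?o = "\<lambda>s. orbit (\<lambda>_. E_field L a) \<tau> (X s, V s) 1"
      have ea: "bounded_curve k A A (E_field L a)"
        using A \<delta> \<tau> unfolding field_regular_def a by simp
      have "bounded_curve k D D (\<lambda>s. fst (?o s)) \<and> bounded_curve k D D (\<lambda>s. snd (?o s))"
        by (rule orb[rule_format, of \<tau> 1]) (use \<tau> ea X V in auto)
      then have "bounded_curve k D' D' (\<lambda>s. fst (?o s))" "bounded_curve k D' D' (\<lambda>s. snd (?o s))"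
        unfolding D'_def by (auto elim: bounded_curve_mono)
      from C(2)[OF \<delta> this] have "bounded_derivs k C C (\<lambda>s. scheme \<delta> m (?o s))" by simp
      moreover have "scheme \<delta> m (?o s) = c (X s, V s)" for s
        unfolding c_def exp_A_def exp_B_def a by (simp add: Let_def)
      ultimately show ?thesis by simp
    qed
    have lines: "line_regular k C (\<lambda>z. u (fst z + \<theta> * snd z, snd z))"
      if u: "\<And>X V. bounded_curve k B B X \<Longrightarrow> bounded_curve k B B V \<Longrightarrow> bounded_derivs k C C (\<lambda>s. u (X s, V s))"
        and \<theta>: "\<theta> \<in> {0, - (\<tau> / 2), \<tau> / 2}" for u :: phase_fun and \<theta>
      unfolding line_regular_def
    proof (intro conjI allI)
      fix v
      have "bounded_derivs k C C (\<lambda>s. u (1 * s + \<theta> * v, 0 * s + v))"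
        by (intro u bounded_curve_affine B) (use small[OF \<theta>] B in auto)
      then show "bounded_derivs k C C (\<lambda>x. u (fst (x, v) + \<theta> * snd (x, v), snd (x, v)))" by simp
    next
      fix x
      have "bounded_derivs k C C (\<lambda>s. u (\<theta> * s + x, 1 * s + 0))"
        by (intro u bounded_curve_affine B) (use small[OF \<theta>] B in auto)
      then show "bounded_derivs k C C (\<lambda>v. u (fst (x, v) + \<theta> * snd (x, v), snd (x, v)))" by (simp add: add.commute)
    qed
    \<comment> \<open>The iterate sheared by 0 or - \<tau>/2 gives the first two functions, the
      result \<open>c\<close> sheared by \<tau>/2 or 0 the last two.\<close>
    have "scheme \<delta> m = (\<lambda>z. scheme \<delta> m (fst z + 0 * snd z, snd z))" by simp
    moreover have "a = (\<lambda>z. scheme \<delta> m (fst z + - (\<tau> / 2) * snd z, snd z))"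
      unfolding a exp_A_def by (auto simp: fun_eq_iff)
    moreover have "exp_B L \<tau> a a = (\<lambda>z. c (fst z + \<tau> / 2 * snd z, snd z))"
      unfolding c_def exp_A_def by (auto simp: fun_eq_iff)
    moreover have "exp_A (\<tau> / 2) (exp_B L \<tau> a a) = (\<lambda>z. c (fst z + 0 * snd z, snd z))"
      unfolding c_def by simp
    ultimately show ?thesis
      using w lines[where u="scheme \<delta> m" and \<theta>=0, OF plain] lines[where u="scheme \<delta> m" and \<theta>="- (\<tau> / 2)", OF plain]
        lines[where u=c and \<theta>="\<tau> / 2", OF full] lines[where u=c and \<theta>=0, OF full]
      by (metis insertE insertI1 insertI2 singletonD)
  qed
  note main = this
  show ?thesis
    by (intro exI[of _ C] conjI C(1) allI impI ballI, elim conjE, rule main; assumption)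
qed

end

section \<open>The error bound\<close>

lemma periodic_supported_bounded_in_time:
  fixes g :: "real \<Rightarrow> phase_fun"
  assumes cont: "continuous_on ({0..T} \<times> UNIV) (\<lambda>(t, z). g t z)" and L: "0 < L"
    and per: "\<And>t. t \<in> {0..T} \<Longrightarrow> x_periodic L (g t)" and supp: "\<And>t. t \<in> {0..T} \<Longrightarrow> v_supported R (g t)"
  shows "\<exists>B\<ge>0. \<forall>t\<in>{0..T}. \<forall>z. \<bar>g t z\<bar> \<le> B"
proof -
  have "compact ((\<lambda>(t, z). g t z) ` ({0..T} \<times> ({0..L} \<times> {- R..R})))"
    by (intro compact_continuous_image compact_Times continuous_on_subset[OF cont]) auto
  then obtain B where B: "\<And>y. y \<in> (\<lambda>(t, z). g t z) ` ({0..T} \<times> ({0..L} \<times> {- R..R})) \<Longrightarrow> norm y \<le> B"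
    using compact_imp_bounded bounded_iff by metis
  have "\<bar>g t (x, v)\<bar> \<le> \<bar>B\<bar>" if t: "t \<in> {0..T}" for t x v
  proof (cases "\<bar>v\<bar> \<le> R")
    case True
    have "g t (x, v) = g t (wrap L x, v)" by (rule x_periodic_wrap[OF per[OF t], symmetric])
    moreover have "(t, (wrap L x, v)) \<in> {0..T} \<times> ({0..L} \<times> {- R..R})"
      using wrap_bounds[OF L, of x] True t by auto
    then have "g t (wrap L x, v) \<in> (\<lambda>(t, z). g t z) ` ({0..T} \<times> ({0..L} \<times> {- R..R}))"
      by (rule rev_image_eqI) simp
    ultimately show ?thesis using B[of "g t (wrap L x, v)"] by simp
  next
    case False
    then show ?thesis using supp[OF t] unfolding v_supported_def by simp
  qed
  then show ?thesis by (intro exI[of _ "\<bar>B\<bar>"]) auto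
qed

text \<open>A classical solution comes with continuous derivatives but without bounds. The
  derivatives inherit periodicity and support, so compactness of time interval, period and velocity
  range supplies them.\<close>

lemma solution_vp_data:
  assumes L: "0 < L" and T: "0 < T" and vmax: "0 < vmax"
    and sol: "vlasov_poisson_solution L T f0 f" and supp: "\<forall>t\<in>{0..T}. v_supported vmax (f t)"
  shows "\<exists>M ft fx fv. vp_data L T (vmax + 1) M f ft fx fv"
proof -
  have per: "\<And>t. t \<in> {0..T} \<Longrightarrow> x_periodic L (f t)"
    and field: "\<And>t x. t \<in> {0..T} \<Longrightarrow> (E_field L (f t) has_real_derivative (LINT v|lborel. f t (x, v)) - 1) (at x)"
    using sol unfolding vlasov_poisson_solution_def by blast+
  obtain ft fx fv where cont_t: "continuous_on ({0..T} \<times> UNIV) (\<lambda>(t, z). ft t z)"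
    and cont_x: "continuous_on ({0..T} \<times> UNIV) (\<lambda>(t, z). fx t z)"
    and cont_v: "continuous_on ({0..T} \<times> UNIV) (\<lambda>(t, z). fv t z)"
    and eqs: "\<forall>t\<in>{0..T}. \<forall>x v.
           ((\<lambda>s. f s (x, v)) has_real_derivative ft t (x, v)) (at t within {0..T}) \<and>
           ((\<lambda>y. f t (y, v)) has_real_derivative fx t (x, v)) (at x) \<and>
           ((\<lambda>w. f t (x, w)) has_real_derivative fv t (x, v)) (at v) \<and>
           ft t (x, v) = - v * fx t (x, v) - E_field L (f t) x * fv t (x, v)"
    using sol unfolding vlasov_poisson_solution_def by blast
  have dt: "((\<lambda>s. f s (x, v)) has_real_derivative ft t (x, v)) (at t within {0..T})"
    and dx: "((\<lambda>y. f t (y, v)) has_real_derivative fx t (x, v)) (at x)"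
    and dv: "((\<lambda>w. f t (x, w)) has_real_derivative fv t (x, v)) (at v)"
    and vl: "ft t (x, v) = - v * fx t (x, v) - E_field L (f t) x * fv t (x, v)" if "t \<in> {0..T}" for t x v
    using eqs that by blast+
  have f0: "f t (x, v) = 0" if "t \<in> {0..T}" "vmax < \<bar>v\<bar>" for t x v
    using supp that unfolding v_supported_def by blast
  have fper: "f t (x + L, v) = f t (x, v)" if "t \<in> {0..T}" for t x v
    using per[OF that] unfolding x_periodic_def by blast
  have x_per: "fx t (x + L, v) = fx t (x, v)" if t: "t \<in> {0..T}" for t x v
  proof -
    have "((\<lambda>y. f t (y + L, v)) has_real_derivative fx t (x + L, v)) (at x)"
      using dx[OF t, of v "x + L"] by (simp add: DERIV_shift)
    then have "((\<lambda>y. f t (y, v)) has_real_derivative fx t (x + L, v)) (at x)" by (simp add: fper[OF t])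
    then show ?thesis using dx[OF t] DERIV_unique by blast
  qed
  have v_per: "fv t (x + L, v) = fv t (x, v)" if t: "t \<in> {0..T}" for t x v
  proof -
    have "((\<lambda>w. f t (x, w)) has_real_derivative fv t (x + L, v)) (at v)"
      using dv[OF t, of "x + L" v] by (simp add: fper[OF t])
    then show ?thesis using dv[OF t] DERIV_unique by blast
  qed
  have x_supp: "fx t (x, v) = 0" if t: "t \<in> {0..T}" and v: "vmax < \<bar>v\<bar>" for t x v
  proof -
    have "((\<lambda>y. 0) has_real_derivative fx t (x, v)) (at x)" using dx[OF t, of v x] by (simp add: f0[OF t v])
    then show ?thesis using DERIV_const DERIV_unique by blast
  qed
  have v_supp: "fv t (x, v) = 0" if t: "t \<in> {0..T}" and v: "vmax < \<bar>v\<bar>" for t x v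
  proof -
    have "open {w :: real. vmax < \<bar>w\<bar>}" by (intro open_Collect_less continuous_intros)
    then have "((\<lambda>w. f t (x, w)) has_real_derivative 0) (at v)"
      using v by (intro has_field_derivative_transform_within_open[OF DERIV_const[of 0]]) (auto simp: f0[OF t])
    then show ?thesis using dv[OF t] DERIV_unique by blast
  qed
  obtain Mx where Mx: "0 \<le> Mx" "\<And>t z. t \<in> {0..T} \<Longrightarrow> \<bar>fx t z\<bar> \<le> Mx"
    using periodic_supported_bounded_in_time[OF cont_x L, of vmax] x_per x_supp
    unfolding x_periodic_def v_supported_def by blast
  obtain Mv where Mv: "0 \<le> Mv" "\<And>t z. t \<in> {0..T} \<Longrightarrow> \<bar>fv t z\<bar> \<le> Mv"
    using periodic_supported_bounded_in_time[OF cont_v L, of vmax] v_per v_supp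
    unfolding x_periodic_def v_supported_def by blast
  have t_per: "ft t (x + L, v) = ft t (x, v)" and t_supp: "vmax < \<bar>v\<bar> \<Longrightarrow> ft t (x, v) = 0" if "t \<in> {0..T}" for t x v
    using vl[OF that] x_per[OF that] v_per[OF that] x_supp[OF that] v_supp[OF that] by (simp_all add: E_field_periodic[OF L])
  obtain Mt where Mt: "0 \<le> Mt" "\<And>t z. t \<in> {0..T} \<Longrightarrow> \<bar>ft t z\<bar> \<le> Mt"
    using periodic_supported_bounded_in_time[OF cont_t L, of vmax] t_per t_supp
    unfolding x_periodic_def v_supported_def by blast
  \<comment> \<open>Obtained from the bound of \<open>fv\<close> by starting at v = vmax + 1, where
    \<open>f\<close> vanishes.\<close>
  have Mf: "\<bar>f t (x, v)\<bar> \<le> Mv * (2 * (vmax + 1))" if t: "t \<in> {0..T}" for t x v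
  proof (cases "\<bar>v\<bar> \<le> vmax + 1")
    case True
    have "\<bar>f t (x, vmax + 1) - f t (x, v) - 0 * (vmax + 1 - v)\<bar> \<le> Mv * \<bar>vmax + 1 - v\<bar>"
      by (rule derivative_approx[where S=UNIV and g="\<lambda>w. f t (x, w)", OF _ dv[OF t]]) (use Mv(2)[OF t] in auto)
    also have "\<dots> \<le> Mv * (2 * (vmax + 1))" using True Mv(1) by (intro mult_left_mono) auto
    finally show ?thesis using f0[OF t, of "vmax + 1" x] vmax by simp
  next
    case False
    then show ?thesis using f0[OF t, of v x] Mv(1) vmax by simp
  qed
  define M where "M = Mv * (2 * (vmax + 1)) + Mt + Mx + Mv"
  have pos: "0 \<le> Mv * (2 * (vmax + 1))" using Mv(1) vmax by simp
  have "vp_data L T (vmax + 1) M f ft fx fv"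
  proof
    show "\<bar>f t z\<bar> \<le> M" if "t \<in> {0..T}" for t z
      using Mf[OF that, of "fst z" "snd z"] Mt(1) Mx(1) Mv(1) unfolding M_def by simp
    show "\<bar>ft t z\<bar> \<le> M" if "t \<in> {0..T}" for t z
      using Mt(2)[OF that, of z] pos Mx(1) Mv(1) unfolding M_def by linarith
    show "\<bar>fx t z\<bar> \<le> M" if "t \<in> {0..T}" for t z
      using Mx(2)[OF that, of z] pos Mt(1) Mv(1) unfolding M_def by linarith
    show "\<bar>fv t z\<bar> \<le> M" if "t \<in> {0..T}" for t z
      using Mv(2)[OF that, of z] pos Mt(1) Mx(1) unfolding M_def by linarith
    show "f t (x, v) = 0" if "t \<in> {0..T}" "vmax + 1 \<le> \<bar>v\<bar>" for t v x
      using f0[OF that(1), of v x] that(2) by simp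
  qed (use L T vmax per cont_t cont_x cont_v dt dx dv vl field in auto)
  then show ?thesis by blast
qed

lemma mass_nn_integral:
  assumes "\<forall>z. 0 \<le> f0 z" and [measurable]: "f0 \<in> borel_measurable borel"
    and "(LINT z:{0..L} \<times> UNIV|lborel. f0 z) = L" and "0 < L"
  shows "(\<integral>\<^sup>+z. ennreal (f0 z) * indicator (torus L) z \<partial>lborel) = ennreal L"
proof -
  let ?I = "\<integral>\<^sup>+z. ennreal (f0 z) * indicator (torus L) z \<partial>lborel"
  have "(LINT z:torus L|lborel. f0 z) = enn2real (\<integral>\<^sup>+z. ennreal (indicator (torus L) z *\<^sub>R f0 z) \<partial>lborel)"
    unfolding set_lebesgue_integral_def using assms(1) by (intro integral_eq_nn_integral) auto
  also have "(\<integral>\<^sup>+z. ennreal (indicator (torus L) z *\<^sub>R f0 z) \<partial>lborel) = ?I"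
    by (intro nn_integral_cong) (auto split: split_indicator)
  finally have e: "enn2real ?I = L" using assms(3) unfolding torus_def by simp
  \<comment> \<open>\<open>enn2real\<close> maps infinity to 0, so a positive value excludes
    infinite mass.\<close>
  then have "?I \<noteq> top" using \<open>0 < L\<close> by auto
  then show ?thesis using e by (metis ennreal_enn2real_if)
qed

section \<open>Smoothness of the exact solution through approximation\<close>

locale vp_scheme = vp_data L T R M f ft fx fv + semidiscrete L T R M f0
  for L T R M f ft fx fv f0 +
  assumes initial: "f 0 = f0"
begin

lemma R_le_RR: "R \<le> RR"
  unfolding RR_def using L T by simp

text \<open>This is \<open>convergence\<close> with the identity for P and \<epsilon> = 0; the
  support condition is met with the radius \<open>RR\<close>.\<close>

lemma scheme_close:
  "\<exists>K\<ge>0. \<forall>\<delta> m. 0 < \<delta> \<and> real m * \<delta> \<le> T \<longrightarrow>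
     l2_norm L (\<lambda>z. scheme \<delta> m z - f (real m * \<delta>) z) \<le> K * (real m * \<delta> ^ 3)"
proof -
  from convergence[OF R_le_RR] obtain K where K: "0 \<le> K" and conv: "\<And>P \<tau> N \<epsilon>. stable_consistent RR P \<tau> N \<epsilon> \<Longrightarrow>
      (\<forall>n\<le>N. l2_norm L (\<lambda>z. strang_dg P L \<tau> (f 0) n z - f (real n * \<tau>) z)
          \<le> K * (\<epsilon> + real n * (\<epsilon> + \<tau> ^ 3)))"
    by blast
  have zero: "l2_norm L (\<lambda>z. 0) = 0" unfolding l2_norm_def set_lebesgue_integral_def by simp
  have "l2_norm L (\<lambda>z. scheme \<delta> m z - f (real m * \<delta>) z) \<le> K * (real m * \<delta> ^ 3)"
    if \<delta>: "0 < \<delta>" "real m * \<delta> \<le> T" for \<delta> m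
  proof -
    have "v_supported RR (S_A id \<delta> (strang_dg id L \<delta> (f 0) n))" if "n < m" for n
    proof -
      have "real n * \<delta> \<le> real m * \<delta>" using that \<delta> by (intro mult_right_mono) auto
      with \<delta>(2) have "real n * \<delta> \<le> T" by linarith
      then have "v_supported RR (scheme \<delta> n)" using \<delta>(1) by (intro scheme_supported) auto
      then show ?thesis unfolding S_A_def initial scheme_def by (simp add: v_supported_exp_A)
    qed
    with \<delta> have "stable_consistent RR id \<delta> m 0"
      unfolding stable_consistent_def by (auto simp: zero)
    from conv[OF this] show ?thesis unfolding scheme_def initial by simp
  qed
  then show ?thesis using K by blast
qed

lemma scheme_approximates:
  assumes t: "t \<in> {0..T}" and \<eta>: "0 < \<eta>"
  shows "\<exists>\<delta> m. 0 < \<delta> \<and> real m * \<delta> \<le> T \<and> l2_norm L (\<lambda>z. scheme \<delta> m z - f t z) \<le> \<eta>"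
proof (cases "t = 0")
  case True
  have "l2_norm L (\<lambda>z. scheme T 0 z - f t z) = 0"
    unfolding True scheme_0 initial l2_norm_def set_lebesgue_integral_def by simp
  then show ?thesis using T \<eta> by (intro exI[of _ T] exI[of _ 0]) auto
next
  case False
  with t have t0: "0 < t" by simp
  obtain K where K: "0 \<le> K" "\<And>\<delta> m. 0 < \<delta> \<Longrightarrow> real m * \<delta> \<le> T \<Longrightarrow>
     l2_norm L (\<lambda>z. scheme \<delta> m z - f (real m * \<delta>) z) \<le> K * (real m * \<delta> ^ 3)"
    using scheme_close by blast
  obtain n where n: "K * t ^ 3 / \<eta> < real n" using reals_Archimedean2 by blast
  define m where "m = Suc n"
  have m: "1 \<le> real m" "K * t ^ 3 / \<eta> \<le> real m" using n unfolding m_def by auto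
  \<comment> \<open>The step size t / m reaches t exactly, and the error becomes K * t ^ 3 / m ^
    2.\<close>
  define \<delta> where "\<delta> = t / real m"
  have \<delta>: "0 < \<delta>" "real m * \<delta> = t" unfolding \<delta>_def using t0 m by auto
  have "l2_norm L (\<lambda>z. scheme \<delta> m z - f t z) \<le> K * (real m * \<delta> ^ 3)"
    using K(2)[of \<delta> m] \<delta> t by simp
  also have "\<dots> = K * t ^ 3 / (real m)\<^sup>2"
    unfolding \<delta>_def using m by (simp add: power_divide power3_eq_cube power2_eq_square)
  also have "\<dots> \<le> K * t ^ 3 / real m"
    using m K(1) t0 by (intro divide_left_mono) (auto simp: power2_eq_square)
  also have "\<dots> \<le> \<eta>" using m \<eta> by (simp add: field_simps)
  finally show ?thesis using \<delta> t by (intro exI[of _ \<delta>] exI[of _ m]) auto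
qed

text \<open>The stages of a step on the exact solution are limits of the same stages on
  semi-discrete solutions, all regular with one constant. \<open>P_approximation\<close> tolerates
  the distance to the limit, which is then sent to 0.\<close>

lemma exact_projection_error:
  assumes f0: "C_k (Suc l) f0"
  shows "\<exists>C\<ge>0. \<forall>t \<tau> a w vmax h Nx Nv. t \<in> {0..T} \<and> 0 < \<tau> \<and> \<tau> \<le> T \<and> a = exp_A (\<tau> / 2) (f t) \<and>
     w \<in> {f t, a, exp_B L \<tau> a a, exp_A (\<tau> / 2) (exp_B L \<tau> a a)} \<and> v_supported vmax w \<and> dg_grid L vmax h Nx Nv \<longrightarrow>
     l2_norm L (\<lambda>z. dg_proj L vmax l h Nx Nv w z - w z) \<le> sqrt (4 * vmax * L) * (C * h ^ (l + 1))"
proof -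
  obtain C where C: "0 \<le> C" and reg_all: "\<forall>\<delta> m \<tau> a. 0 < \<delta> \<and> real m * \<delta> \<le> T \<and> 0 < \<tau> \<and> \<tau> \<le> T \<and> a = exp_A (\<tau> / 2) (scheme \<delta> m) \<longrightarrow>
     (\<forall>w\<in>{scheme \<delta> m, a, exp_B L \<tau> a a, exp_A (\<tau> / 2) (exp_B L \<tau> a a)}. line_regular (Suc l) C w)"
    using scheme_line_regular[OF f0] by (elim exE conjE)
  have reg: "line_regular (Suc l) C w" if "0 < \<delta>" "real m * \<delta> \<le> T" "0 < \<tau>" "\<tau> \<le> T" "a = exp_A (\<tau> / 2) (scheme \<delta> m)"
     "w\<in>{scheme \<delta> m, a, exp_B L \<tau> a a, exp_A (\<tau> / 2) (exp_B L \<tau> a a)}" for \<delta> m \<tau> a w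
    using reg_all[rule_format, OF conjI[OF that(1) conjI[OF that(2) conjI[OF that(3) conjI[OF that(4,5)]]]] that(6)] .
  \<comment> \<open>Bounds the amplification of an error by \<open>exp_B\<close> for all \<tau> <=
    T.\<close>
  define k where "k = 1 + T * (M * (T + 1) * stability_const L RR)"
  have RR: "0 \<le> RR" using R_le_RR R by simp
  have k: "1 \<le> k" unfolding k_def stability_const_def using T M0 RR L by simp
  have close: "\<exists>w'. admissible L w' \<and> line_regular (Suc l) C w' \<and> l2_norm L (\<lambda>z. w z - w' z) \<le> k * \<eta>"
    if t: "t \<in> {0..T}" and \<tau>: "0 < \<tau>" "\<tau> \<le> T" and a: "a = exp_A (\<tau> / 2) (f t)"
      and w: "w \<in> {f t, a, exp_B L \<tau> a a, exp_A (\<tau> / 2) (exp_B L \<tau> a a)}" and \<eta>: "0 < \<eta>" for t \<tau> a w \<eta>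
  proof -
    obtain \<delta> m where \<delta>: "0 < \<delta>" "real m * \<delta> \<le> T" and g: "l2_norm L (\<lambda>z. scheme \<delta> m z - f t z) \<le> \<eta>"
      using scheme_approximates[OF t \<eta>] by blast
    define a' where "a' = exp_A (\<tau> / 2) (scheme \<delta> m)"
    note reg' = reg[OF \<delta> \<tau> a'_def]
    note adm = good_admissible[OF good_scheme, of \<delta> m] admissible_f[OF t]
    have adm_a: "admissible L a'" "admissible L a" unfolding a a'_def by (intro admissible_exp_A adm)+
    have adm_b: "admissible L (exp_B L \<tau> a' a')" "admissible L (exp_B L \<tau> a a)"
      by (intro admissible_exp_B adm_a L)+
    have da: "l2_norm L (\<lambda>z. a' z - a z) \<le> \<eta>"
      unfolding a a'_def l2_norm_exp_A_diff[OF adm L] by (rule g)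
    have "l2_norm L (\<lambda>z. exp_B L \<tau> a' a' z - exp_B L \<tau> a a z) \<le> (1 + \<tau> * (M * (T + 1) * stability_const L RR)) * l2_norm L (\<lambda>z. a' z - a z)"
    proof (rule exp_B_stability[OF adm_a(1) _ adm_a(2) _ L RR])
      show "v_supported RR a'" unfolding a'_def using \<delta> by (intro v_supported_exp_A scheme_supported) auto
      show "v_supported RR a" unfolding a by (intro v_supported_exp_A v_supported_mono[OF v_supported_f[OF t] R_le_RR])
      show "\<bar>a (x, v) - a (x, w)\<bar> \<le> M * (T + 1) * \<bar>v - w\<bar>" for x v w
        unfolding a using \<tau> by (intro exp_A_f_lipschitz t) auto
    qed (use \<tau> M0 T in auto)
    also have "\<dots> \<le> k * \<eta>"
    proof (rule mult_mono[OF _ da])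
      have "0 \<le> M * (T + 1) * stability_const L RR" unfolding stability_const_def using T M0 RR L by simp
      then show "1 + \<tau> * (M * (T + 1) * stability_const L RR) \<le> k"
        unfolding k_def using \<tau> by (intro add_left_mono mult_right_mono) auto
    qed (use k l2_norm_nonneg in auto)
    finally have db: "l2_norm L (\<lambda>z. exp_B L \<tau> a' a' z - exp_B L \<tau> a a z) \<le> k * \<eta>" .
    have dc: "l2_norm L (\<lambda>z. exp_A (\<tau> / 2) (exp_B L \<tau> a' a') z - exp_A (\<tau> / 2) (exp_B L \<tau> a a) z) \<le> k * \<eta>"
      unfolding l2_norm_exp_A_diff[OF adm_b L] by (rule db)
    have "1 * \<eta> \<le> k * \<eta>" using k \<eta> by (intro mult_right_mono) auto
    then have le: "\<eta> \<le> k * \<eta>" by simp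
    have sw: "l2_norm L (\<lambda>z. u z - u' z) = l2_norm L (\<lambda>z. u' z - u z)" for u u'
      unfolding l2_norm_def by (simp add: power2_commute)
    consider "w = f t" | "w = a" | "w = exp_B L \<tau> a a" | "w = exp_A (\<tau> / 2) (exp_B L \<tau> a a)" using w by blast
    then show ?thesis
    proof cases
      case 1
      then show ?thesis using reg'[of "scheme \<delta> m"] adm g le sw[of w "scheme \<delta> m"] by (intro exI[of _ "scheme \<delta> m"]) auto
    next
      case 2
      then show ?thesis using reg'[of a'] adm_a da le sw[of w a'] by (intro exI[of _ a']) auto
    next
      case 3
      then show ?thesis using reg'[of "exp_B L \<tau> a' a'"] adm_b db sw[of w "exp_B L \<tau> a' a'"]
        by (intro exI[of _ "exp_B L \<tau> a' a'"]) auto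
    next
      case 4
      then show ?thesis using reg'[of "exp_A (\<tau> / 2) (exp_B L \<tau> a' a')"] admissible_exp_A[OF adm_b(1)] dc
          sw[of w "exp_A (\<tau> / 2) (exp_B L \<tau> a' a')"]
        by (intro exI[of _ "exp_A (\<tau> / 2) (exp_B L \<tau> a' a')"]) auto
    qed
  qed
  define C' where "C' = approx_const l * C"
  have C': "0 \<le> C'" unfolding C'_def approx_const_def using C by simp
  have "l2_norm L (\<lambda>z. dg_proj L vmax l h Nx Nv w z - w z) \<le> sqrt (4 * vmax * L) * (C' * h ^ (l + 1))"
    if t: "t \<in> {0..T}" and \<tau>: "0 < \<tau>" "\<tau> \<le> T" and a: "a = exp_A (\<tau> / 2) (f t)"
      and w: "w \<in> {f t, a, exp_B L \<tau> a a, exp_A (\<tau> / 2) (exp_B L \<tau> a a)}" and supp: "v_supported vmax w"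
      and grid: "dg_grid L vmax h Nx Nv" for t \<tau> a w vmax h Nx Nv
  proof -
    interpret dg_grid L vmax h Nx Nv l by (rule grid)
    have aw: "admissible L w"
      using w admissible_f[OF t] unfolding a by (auto intro!: admissible_exp_A admissible_exp_B L)
    have "(l2_norm L (\<lambda>z. P w z - w z))\<^sup>2 \<le> 4 * vmax * L * (C' * h ^ (l + 1))\<^sup>2 + e" if e: "0 < e" for e
    proof -
      \<comment> \<open>Makes the term 2 * (k * \<eta>) ^ 2 coming from
        \<open>P_approximation\<close> equal to e.\<close>
      define \<eta> where "\<eta> = sqrt (e / 2) / k"
      have \<eta>: "0 < \<eta>" unfolding \<eta>_def using e k by simp
      obtain w' where w': "admissible L w'" "line_regular (Suc l) C w'" "l2_norm L (\<lambda>z. w z - w' z) \<le> k * \<eta>"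
        using close[OF t \<tau> a w \<eta>] by blast
      have "(l2_norm L (\<lambda>z. w z - w' z))\<^sup>2 \<le> (k * \<eta>)\<^sup>2"
        using w'(3) l2_norm_nonneg by (intro power_mono) auto
      also have "(k * \<eta>)\<^sup>2 = e / 2" unfolding \<eta>_def using k e by simp
      finally show ?thesis
        using P_approximation[OF aw supp w'(1,2)] unfolding C'_def by (simp add: mult.assoc)
    qed
    then have "(l2_norm L (\<lambda>z. P w z - w z))\<^sup>2 \<le> 4 * vmax * L * (C' * h ^ (l + 1))\<^sup>2"
      by (rule field_le_epsilon)
    also have "\<dots> = (sqrt (4 * vmax * L) * (C' * h ^ (l + 1)))\<^sup>2"
      using L vmax by (simp add: power_mult_distrib)
    finally show ?thesis
      by (rule power2_le_imp_le) (use L vmax C' h in auto)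
  qed
  note main = this
  show ?thesis
    by (intro exI[of _ C'] conjI C' allI impI, elim conjE, rule main; assumption)
qed

end

theorem theorem2p9:
  fixes L T vmax :: real and l :: nat
    and f0 :: "real \<times> real \<Rightarrow> real" and f :: "real \<Rightarrow> real \<times> real \<Rightarrow> real"
  assumes "0 < L" and "0 < T" and "0 < vmax"
    and "C_k (max (l + 1) 3) f0"
    and "\<forall>z. 0 \<le> f0 z"
    and "\<exists>R. v_supported R f0"
    and "x_periodic L f0"
    and "(LINT z:{0..L} \<times> UNIV|lborel. f0 z) = L"
    and "vlasov_poisson_solution L T f0 f"
    and "\<forall>t\<in>{0..T}. v_supported vmax (f t)"
  shows "\<exists>C. \<forall>\<tau> h :: real. \<forall>N Nx Nv :: nat.
           0 < \<tau> \<and> 0 < h \<and> real N * \<tau> = T \<and> real Nx * h = L \<and> real Nv * h = 2 * vmax \<and>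
           cutoff_exact vmax (dg_proj L vmax l h Nx Nv) L T \<tau> f \<longrightarrow>
           (SUP n\<in>{0..N}. l2_norm L (\<lambda>z. strang_dg (dg_proj L vmax l h Nx Nv) L \<tau> f0 n z
                                            - f (real n * \<tau>) z))
             \<le> C * (\<tau>\<^sup>2 + h ^ (l + 1) / \<tau> + h ^ (l + 1))"
proof -
  obtain M ft fx fv where "vp_data L T (vmax + 1) M f ft fx fv"
    using solution_vp_data[OF assms(1-3,9,10)] by blast
  then interpret vp_data L T "vmax + 1" M f ft fx fv .
  have initial: "f 0 = f0" using assms(9) unfolding vlasov_poisson_solution_def by blast
  have t0: "0 \<in> {0..T}" using T by simp
  interpret vp_scheme L T "vmax + 1" M f ft fx fv f0
  proof
    show "continuous_on UNIV f0" by (rule C_k_imp_continuous[OF assms(4)])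
    then have "f0 \<in> borel_measurable borel" by (rule borel_measurable_continuous_onI)
    then show "(\<integral>\<^sup>+z. ennreal (f0 z) * indicator (torus L) z \<partial>lborel) = ennreal L"
      using assms by (intro mass_nn_integral)
    show "v_supported (vmax + 1) f0" using v_supported_f[OF t0] initial by simp
    show "f0 z \<le> M" for z using bound(1)[OF t0, of z] initial by (simp add: abs_le_iff)
  qed (use assms initial in auto)
  have f0_smooth: "C_k (Suc l) f0" by (rule C_k_le[OF assms(4)]) simp
  obtain C where C: "0 \<le> C" and proj_all: "\<forall>t \<tau> a w vmax h Nx Nv. t \<in> {0..T} \<and> 0 < \<tau> \<and> \<tau> \<le> T \<and> a = exp_A (\<tau> / 2) (f t) \<and>
     w \<in> {f t, a, exp_B L \<tau> a a, exp_A (\<tau> / 2) (exp_B L \<tau> a a)} \<and> v_supported vmax w \<and> dg_grid L vmax h Nx Nv \<longrightarrow>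
     l2_norm L (\<lambda>z. dg_proj L vmax l h Nx Nv w z - w z) \<le> sqrt (4 * vmax * L) * (C * h ^ (l + 1))"
    using exact_projection_error[OF f0_smooth] by (elim exE conjE)
  have proj: "l2_norm L (\<lambda>z. dg_proj L vmax l h Nx Nv w z - w z) \<le> sqrt (4 * vmax * L) * (C * h ^ (l + 1))"
    if "t \<in> {0..T}" "0 < \<tau>" "\<tau> \<le> T" "a = exp_A (\<tau> / 2) (f t)"
     "w \<in> {f t, a, exp_B L \<tau> a a, exp_A (\<tau> / 2) (exp_B L \<tau> a a)}" "v_supported vmax w" "dg_grid L vmax h Nx Nv"
    for t \<tau> a w h Nx Nv
    by (rule proj_all[rule_format], intro conjI) (rule that)+
  from convergence[OF order_refl] obtain K where K: "0 \<le> K" and conv: "\<And>P \<tau> N \<epsilon>. stable_consistent (vmax + 1) P \<tau> N \<epsilon> \<Longrightarrow>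
      (\<forall>n\<le>N. l2_norm L (\<lambda>z. strang_dg P L \<tau> (f 0) n z - f (real n * \<tau>) z)
          \<le> K * (\<epsilon> + real n * (\<epsilon> + \<tau> ^ 3)))"
    by blast
  define c where "c = sqrt (4 * vmax * L) * C"
  have c: "0 \<le> c" unfolding c_def using C assms by simp
  \<comment> \<open>K comes from \<open>convergence\<close>; c belongs to the initial projection, T
    * c and T to at most T/\<tau> steps with errors \<epsilon> and \<tau>^3 each.\<close>
  define G where "G = K * (c + T * c + T)"
  have "(SUP n\<in>{0..N}. l2_norm L (\<lambda>z. strang_dg (dg_proj L vmax l h Nx Nv) L \<tau> f0 n z - f (real n * \<tau>) z))
             \<le> G * (\<tau>\<^sup>2 + h ^ (l + 1) / \<tau> + h ^ (l + 1))"
    if \<tau>: "0 < \<tau>" and h: "0 < h" and N: "real N * \<tau> = T" and Nx: "real Nx * h = L" and Nv: "real Nv * h = 2 * vmax"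
      and cut: "cutoff_exact vmax (dg_proj L vmax l h Nx Nv) L T \<tau> f" for \<tau> h N Nx Nv
  proof -
    have grid: "dg_grid L vmax h Nx Nv" by unfold_locales (use assms h Nx Nv in auto)
    interpret dg_grid L vmax h Nx Nv l by (rule grid)
    define \<epsilon> where "\<epsilon> = c * h ^ (l + 1)"
    have \<epsilon>: "0 \<le> \<epsilon>" unfolding \<epsilon>_def using c h by simp
    have "0 < N" using N T by (cases N) auto
    then have "1 * \<tau> \<le> real N * \<tau>" using \<tau> by (intro mult_right_mono) auto
    then have \<tau>T: "\<tau> \<le> T" using N by simp
    have time: "real n * \<tau> \<in> {0..T}" if "n \<le> N" for n
      using mult_right_mono[of "real n" "real N" \<tau>] that \<tau> N by simp
    have err: "l2_norm L (\<lambda>z. P w z - w z) \<le> \<epsilon>"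
      if t: "t \<in> {0..T}" and w: "w \<in> {f t, exp_A (\<tau> / 2) (f t), exp_B L \<tau> (exp_A (\<tau> / 2) (f t)) (exp_A (\<tau> / 2) (f t)), strang t \<tau>}" for t w
    proof -
      \<comment> \<open>The cutoff condition for the step without projection places its stages
        inside the strip, as the projection estimate requires.\<close>
      have "step_v_supported vmax id L \<tau> (f t)" using cut t unfolding cutoff_exact_def by simp
      then have "v_supported vmax w"
        using w assms(10) t unfolding step_v_supported_def Let_def strang_def by auto
      then have "l2_norm L (\<lambda>z. P w z - w z) \<le> sqrt (4 * vmax * L) * (C * h ^ (l + 1))"
        using w unfolding strang_def by (intro proj[OF t \<tau> \<tau>T refl _ _ grid])
      then show ?thesis unfolding \<epsilon>_def c_def by (simp add: mult.assoc)
    qed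
    have main: "\<forall>n\<le>N. l2_norm L (\<lambda>z. strang_dg P L \<tau> (f 0) n z - f (real n * \<tau>) z) \<le> K * (\<epsilon> + real n * (\<epsilon> + \<tau> ^ 3))"
    proof (rule conv, unfold stable_consistent_def, intro conjI allI impI ballI)
      show "l2_norm L (\<lambda>z. P (f 0) z - f 0 z) \<le> \<epsilon>" by (rule err[OF t0]) simp
      show "l2_norm L (\<lambda>z. P w z - w z) \<le> \<epsilon>" if "n < N"
        "w \<in> {exp_A (\<tau> / 2) (f (real n * \<tau>)),
          exp_B L \<tau> (exp_A (\<tau> / 2) (f (real n * \<tau>))) (exp_A (\<tau> / 2) (f (real n * \<tau>))),
          strang (real n * \<tau>) \<tau>}" for n w
        by (rule err[OF time[of n]]) (use that in auto)
      \<comment> \<open>The numerical half step ends with a projection, whose values vanish outside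
        the strip.\<close>
      show "v_supported (vmax + 1) (S_A P \<tau> (strang_dg P L \<tau> (f 0) n))" for n
        unfolding S_A_def by (rule v_supported_mono[OF v_supported_P]) simp
    qed (use \<tau> N \<epsilon> admissible_P P_contraction in auto)
    show ?thesis
    proof (rule cSUP_least)
      fix n assume "n \<in> {0..N}"
      then have n: "n \<le> N" by simp
      have nT: "real n * \<tau> \<le> T" using time[OF n] by simp
      \<comment> \<open>The factor 1/\<tau> of the bound arises here, from n <= T/\<tau> accumulated
        projection errors.\<close>
      have "real n * \<epsilon> = (real n * \<tau>) * (\<epsilon> / \<tau>)" using \<tau> by simp
      also have "\<dots> \<le> T * (\<epsilon> / \<tau>)" using nT \<epsilon> \<tau> by (intro mult_right_mono) auto
      finally have 1: "real n * \<epsilon> \<le> T * c * (h ^ (l + 1) / \<tau>)" unfolding \<epsilon>_def by simp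
      have "real n * \<tau> ^ 3 = (real n * \<tau>) * \<tau>\<^sup>2" by (simp add: power2_eq_square power3_eq_cube)
      also have "\<dots> \<le> T * \<tau>\<^sup>2" using nT by (intro mult_right_mono) auto
      finally have 2: "real n * \<tau> ^ 3 \<le> T * \<tau>\<^sup>2" .
      define p where "p = \<tau>\<^sup>2"
      define q where "q = h ^ (l + 1) / \<tau>"
      define r where "r = h ^ (l + 1)"
      have pqr: "0 \<le> p" "0 \<le> q" "0 \<le> r" unfolding p_def q_def r_def using h \<tau> by auto
      have "\<epsilon> + real n * (\<epsilon> + \<tau> ^ 3) \<le> c * r + (T * c * q + T * p)"
        using 1 2 unfolding \<epsilon>_def p_def q_def r_def by (simp add: distrib_left)
      also have "\<dots> \<le> (c + T * c + T) * (p + q + r)"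
        using pqr c T by (simp add: algebra_simps add_nonneg_nonneg)
      finally have "K * (\<epsilon> + real n * (\<epsilon> + \<tau> ^ 3)) \<le> K * ((c + T * c + T) * (p + q + r))"
        using K by (rule mult_left_mono)
      then show "l2_norm L (\<lambda>z. strang_dg P L \<tau> f0 n z - f (real n * \<tau>) z) \<le> G * (\<tau>\<^sup>2 + h ^ (l + 1) / \<tau> + h ^ (l + 1))"
        using main n unfolding initial G_def p_def q_def r_def by (fastforce simp: mult.assoc)
    qed simp
  qed
  then show ?thesis by (intro exI[of _ G]) blast
qed

end
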